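(* Let $X=(X^1,\dots,X^d):[0,T]\to\mathbb{R}^d$ be a path and $F=(F^1,\dots,F^d):\mathbb{R}^n\to(\mathbb{R}^n)^d$ with each $F^i:\mathbb{R}^n\to\mathbb{R}^n$ smooth. Let $\alpha\in(\frac14,\frac13]$ and let $\mathbf{X}\in\mathbf{PBRP}^3_\alpha$ be an $\alpha$-Hölder planarly branched rough path above $X$. For sufficiently small $\delta$ (with $0<\delta<T$), there is a unique $\mathbf{Y}\in\mathcal{D}^3_{\mathbf{X};\alpha}$ (paths being taken on $[0,\delta]$) such that $$\mathbf{Y}_t=\mathbf{Y}_0+\int_0^tF(\mathbf{Y}_r)\cdot dX_r,\qquad t\in[0,\delta],$$ that is, the rough differential equation $dY_t=\sum_{i=1}^dF^i(Y_t)\,dX^i_t$, $Y_0=\xi$ (with $\xi\in\mathbb{R}^n$), has a unique (local) solution on $[0,\delta]$.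
   Context: Fix integers $d,n\ge1$, a set $A$ with $d$ elements (identified with $\{1,\dots,d\}$), $\alpha\in(\frac14,\frac13]$ and $T>0$. Forests. A planar forest is a finite ordered sequence (word) of planar rooted trees with vertices decorated by $A$; $\mathcal{F}$ is the set of these, $\mathbb{1}$ the empty forest, $|\tau|$ the number of vertices, $\mathcal{F}^{\le k}=\{\tau\in\mathcal F:|\tau|\le k\}$. For a forest $\tau$ and $a\in A$, $[\tau]_a$ is the tree obtained by grafting the trees of $\tau$, in order from left to right, onto a new root decorated by $a$; $\bullet_a=[\mathbb{1}]_a$. Thus $\mathcal{F}^{\le2}=\{\mathbb{1},\bullet_a,\bullet_a\bullet_b,[\bullet_b]_a:a,b\in A\}$. On $\mathbb{R}\mathcal{F}$, ⧢ is the shuffle product of words whose letters are trees. The Munthe-Kaas–Wright coproduct $\Delta$: for a tree $\tau$, $\Delta(\tau)=\tau\otimes\mathbb{1}+\sum_cP^c(\tau)\otimes T^c(\tau)$, where $c$ ranges over left-admissible cuts, i.e. sets of edges (possibly empty) such that (1) with each edge $e\in c$, every other edge outgoing from the same vertex and to the left of $e$ is in $c$; (2) each path from the root to a leaf contains at most one edge of $c$; $T^c(\tau)$ is the component containing the root, and $P^c(\tau)$ is obtained by keeping the planar order of the subtrees cut off from the same vertex and shuffling together the forests cut off from different vertices. For a forest $\omega$, $\Delta(\omega)=(\mathrm{id}\otimes B_-)(\Delta(B_+(\omega))-B_+(\omega)\otimes\mathbb{1})$, where $B_+$ grafts all trees of $\omega$ onto a new root and $B_-$ is its inverse. Write $\mathcal{H}^{\le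 k}=\mathbb{R}\mathcal{F}^{\le k}$ and $\mathcal{H}^{*\le k}$ for its dual, with pairing $\langle\tau,\tau'\rangle=\delta_{\tau,\tau'}$. $\mathcal{H}^{\le3}$ carries the truncated shuffle product (forests with more than 3 vertices are set to $0$), and $\star$ on $\mathcal{H}^{*\le3}$ is dual to $\Delta$: $\langle x\star y,\tau\rangle=\langle x\otimes y,\Delta\tau\rangle$. Rough paths. An $\alpha$-Hölder planarly branched rough path is a map $\mathbf{X}:[0,T]^2\to\mathcal{H}^{*\le3}$, with $\mathbf{X}^\tau_{s,t}:=\langle\mathbf{X}_{s,t},\tau\rangle$, such that for all $\sigma,\tau\in\mathcal{F}^{\le3}$ and $s,t,u\in[0,T]$: $\mathbf{X}_{s,u}\star\mathbf{X}_{u,t}=\mathbf{X}_{s,t}$; $\langle\mathbf{X}_{s,t},\sigma$ ⧢ $\tau\rangle=\langle\mathbf{X}_{s,t},\sigma\rangle\langle\mathbf{X}_{s,t},\tau\rangle$ (⧢ being the product of $\mathcal{H}^{\le3}$); and $\sup_{s\ne t}|\mathbf{X}^\tau_{s,t}|/|t-s|^{|\tau|\alpha}<\infty$. $\mathbf{PBRP}^3_\alpha$ is the set of these. $\mathbf{X}$ is above $X$ if $\mathbf{X}^{\bullet_i}_{s,t}=X^i_t-X^i_s$ for $i=1,\dots,d$. Controlled paths (on $[0,\delta]$). For a path $\mathbf{Y}:[0,\delta]\to(\mathcal{H}^{\le2})^n$ write $\mathbf{Y}^\tau_t=\langle\tau,\mathbf{Y}_t\rangle\in\mathbb{R}^n$,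 $\mathbf{Y}^\tau_{s,t}=\mathbf{Y}^\tau_t-\mathbf{Y}^\tau_s$, and $$R\mathbf{Y}^{\mathbb{1}}_{s,t}=\mathbf{Y}^{\mathbb{1}}_{s,t}-\sum_{a\in A}\mathbf{Y}^{\bullet_a}_s\mathbf{X}^{\bullet_a}_{s,t}-\sum_{a,b\in A}\mathbf{Y}^{\bullet_a\bullet_b}_s\mathbf{X}^{\bullet_a\bullet_b}_{s,t}-\sum_{a,b\in A}\mathbf{Y}^{[\bullet_b]_a}_s\mathbf{X}^{[\bullet_b]_a}_{s,t},$$ $$R\mathbf{Y}^{\bullet_a}_{s,t}=\mathbf{Y}^{\bullet_a}_{s,t}-\sum_{b\in A}(\mathbf{Y}^{\bullet_a\bullet_b}_s+\mathbf{Y}^{[\bullet_b]_a}_s)\mathbf{X}^{\bullet_b}_{s,t},\quad R\mathbf{Y}^{\bullet_a\bullet_b}_{s,t}=\mathbf{Y}^{\bullet_a\bullet_b}_{s,t},\quad R\mathbf{Y}^{[\bullet_b]_a}_{s,t}=\mathbf{Y}^{[\bullet_b]_a}_{s,t}.$$ $\mathbf{Y}$ is an $\mathbf{X}$-controlled planarly branched rough path if $\sup_{s\ne t\in[0,\delta]}|R\mathbf{Y}^\tau_{s,t}|/|t-s|^{(3-|\tau|)\alpha}<\infty$ for all $\tau\in\mathcal{F}^{\le2}$; $\mathcal{D}^3_{\mathbf{X};\alpha}$ is the space of these. $\mathbf{Y}$ is above the path $Y:[0,\delta]\to\mathbb{R}^n$ if $\mathbf{Y}^{\mathbb{1}}_t=Y_t$.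 $\mathbf{Y}_0\in(\mathcal{H}^{\le2})^n$ is the full value of $\mathbf{Y}$ at time $0$. Composition. For $G:\mathbb{R}^n\to\mathbb{R}^n$ and controlled $\mathbf{Y}$, $G(\mathbf{Y})$ is given by $G(\mathbf{Y})^{\mathbb{1}}_t=G(\mathbf{Y}^{\mathbb{1}}_t)$, $G(\mathbf{Y})^{\bullet_a}_t=G'(\mathbf{Y}^{\mathbb{1}}_t)\mathbf{Y}^{\bullet_a}_t$, $G(\mathbf{Y})^{[\bullet_b]_a}_t=G'(\mathbf{Y}^{\mathbb{1}}_t)\mathbf{Y}^{[\bullet_b]_a}_t$, $G(\mathbf{Y})^{\bullet_a\bullet_b}_t=G'(\mathbf{Y}^{\mathbb{1}}_t)\mathbf{Y}^{\bullet_a\bullet_b}_t+G''(\mathbf{Y}^{\mathbb{1}}_t)(\mathbf{Y}^{\bullet_a}_t,\mathbf{Y}^{\bullet_b}_t)$. Put $F(\mathbf{Y})=(F^1(\mathbf{Y}),\dots,F^d(\mathbf{Y}))$. Integral. For a controlled $\mathbf{Z}$ above $Z$ and $a\in A$, $\int_0^tZ_r\,dX^a_r:=\lim_{|\pi|\to0}\sum_{[u,v]\in\pi}\sum_{\tau\in\mathcal{F}^{\le2}}\mathbf{Z}^\tau_u\mathbf{X}^{[\tau]_a}_{u,v}$ over partitions $\pi$ of $[0,t]$. For $\mathbf{Z}=(\mathbf{Z}^1,\dots,\mathbf{Z}^d)$ with each $\mathbf{Z}^i$ controlled above $Z^i$, the path $\mathbf{I}_t=\int_0^t\mathbf{Z}_r\cdot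 dX_r\in(\mathcal{H}^{\le2})^n$ is defined by $\mathbf{I}^{\mathbb{1}}_t=\sum_{i=1}^d\int_0^tZ^i_r\,dX^i_r$, $\mathbf{I}^{[\tau]_a}_t=(\mathbf{Z}^a)^\tau_t$ (so $\mathbf{I}^{\bullet_a}_t=(\mathbf{Z}^a)^{\mathbb{1}}_t$ and $\mathbf{I}^{[\bullet_b]_a}_t=(\mathbf{Z}^a)^{\bullet_b}_t$), and $\mathbf{I}^{\bullet_a\bullet_b}_t=0$. Solution. A path $Y:[0,\delta]\to\mathbb{R}^n$ with $Y_0=\xi$ is a solution of the rough differential equation on $[0,\delta]$ if there is an $\mathbf{X}$-controlled planarly branched rough path $\mathbf{Y}$ above $Y$ satisfying the displayed equation of the claim.
   Formalization: The initial term Y_0 in the displayed equation is read as ξ times the empty forest, not the full value of Y at time 0 (which would force F^a(ξ)=0 for all a); the shuffle relation for X is required only for |σ|+|τ|≤3. *)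

theory Defs
  imports "HOL-Analysis.Analysis" "HOL-Library.Sublist" "HOL-Library.Multiset"
begin

section \<open>Planar forests\<close>

datatype 'a ptree = Node (label: 'a) (branches: "'a ptree list")

type_synonym 'a pforest = "'a ptree list"

abbreviation bullet :: "'a \<Rightarrow> 'a ptree" where
  "bullet a \<equiv> Node a []"

fun num_vertices :: "'a ptree \<Rightarrow> nat" where
  "num_vertices (Node a ts) = Suc (\<Sum>t\<leftarrow>ts. num_vertices t)"

definition forest_size :: "'a pforest \<Rightarrow> nat" where
  "forest_size \<omega> = (\<Sum>t\<leftarrow>\<omega>. num_vertices t)"

definition forests_le :: "nat \<Rightarrow> 'a pforest set" where
  "forests_le k = {\<omega>. forest_size \<omega> \<le> k}"

text \<open>
  Finite sums over \<open>forests_le 2\<close> enter the rough integral; a sum over an infinite set would be \<open>0\<close>.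
\<close>

lemma forest_size_simps [simp]:
  "forest_size [] = 0"
  "forest_size (t # \<omega>) = num_vertices t + forest_size \<omega>"
  by (simp_all add: forest_size_def)

lemma finite_forests_le: "finite (forests_le k :: 'a::finite pforest set)"
proof (induction k)
  case 0
  have "\<omega> = []" if "\<omega> \<in> forests_le 0" for \<omega> :: "'a pforest"
  proof (cases \<omega>)
    case (Cons t \<omega>')
    with that show ?thesis by (cases t) (simp add: forests_le_def)
  qed simp
  then have "forests_le 0 \<subseteq> {[] :: 'a pforest}" by blast
  then show ?case by (rule finite_subset) simp
next
  case (Suc k)
  let ?g = "\<lambda>(a :: 'a, ts, \<omega>). Node a ts # \<omega>"
  have "\<omega> \<in> insert [] (?g ` (UNIV \<times> forests_le k \<times> forests_le k))"
    if "\<omega> \<in> forests_le (Suc k)" for \<omega> :: "'a pforest"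
  proof (cases \<omega>)
    case (Cons t \<omega>')
    obtain a ts where t: "t = Node a ts" by (cases t)
    have "(a, ts, \<omega>') \<in> UNIV \<times> forests_le k \<times> forests_le k"
      using that Cons t by (auto simp: forests_le_def forest_size_def)
    then have "?g (a, ts, \<omega>') \<in> ?g ` (UNIV \<times> forests_le k \<times> forests_le k)" by (rule imageI)
    then show ?thesis using Cons t by simp
  qed simp
  then have "forests_le (Suc k)
      \<subseteq> insert [] (?g ` (UNIV \<times> (forests_le k :: 'a pforest set) \<times> forests_le k))" by blast
  then show ?case by (rule finite_subset) (simp add: Suc)
qed

text \<open>
  A function \<open>f\<close> in \<open>graded_le k\<close> is the family of coefficients of an element of
  \<open>(\<real>\<F>\<^sup>\<le>\<^sup>k)\<^sup>n\<close> (values in \<open>\<real>\<^sup>n\<close>), or of an element of the dual of \<open>\<real>\<F>\<^sup>\<le>\<^sup>k\<close> (real values):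
  in both cases \<open>f \<tau>\<close> is the pairing with the forest \<open>\<tau>\<close>.
\<close>

definition graded_le :: "nat \<Rightarrow> ('a pforest \<Rightarrow> 'b::zero) set" where
  "graded_le k = {f. \<forall>\<tau>. \<tau> \<notin> forests_le k \<longrightarrow> f \<tau> = 0}"


section \<open>Shuffle product and Munthe-Kaas--Wright coproduct\<close>

text \<open>
  All structure constants are natural numbers, so a multiset of forests stands for the sum of
  its elements, and a multiset of pairs for a sum of elementary tensors.
\<close>

fun shuffle :: "'x list \<Rightarrow> 'x list \<Rightarrow> 'x list multiset" where
  "shuffle [] ys = {#ys#}"
| "shuffle (x # xs) [] = {#x # xs#}"
| "shuffle (x # xs) (y # ys) =
     image_mset ((#) x) (shuffle xs (y # ys)) + image_mset ((#) y) (shuffle (x # xs) ys)"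

definition shuffle_all :: "'x list list \<Rightarrow> 'x list multiset" where
  "shuffle_all ws = foldr (\<lambda>w M. \<Sum>\<^sub># (image_mset (shuffle w) M)) ws {#[]#}"

text \<open>
  A vertex is addressed by the list of child positions leading to it from the root, and an edge
  by the address of its lower endpoint (the one further from the root); the edges outgoing from
  the vertex \<open>p\<close> are thus the addresses \<open>p @ [i]\<close>, ordered from left to right by \<open>i\<close>.
\<close>

fun vertices :: "'a ptree \<Rightarrow> nat list list" where
  "vertices (Node a ts) =
     [] # concat (map (\<lambda>(i, V). map ((#) i) V) (List.enumerate 0 (map vertices ts)))"

definition edges :: "'a ptree \<Rightarrow> nat list set" where
  "edges t = set (vertices t) - {[]}"

definition leaves :: "'a ptree \<Rightarrow> nat list set" where
  "leaves t = {l \<in> set (vertices t). \<forall>i. l @ [i] \<notin> set (vertices t)}"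

fun subtree :: "'a ptree \<Rightarrow> nat list \<Rightarrow> 'a ptree" where
  "subtree t [] = t"
| "subtree (Node a ts) (i # p) = subtree (ts ! i) p"

text \<open>The edges on the path from the root to \<open>l\<close> are the nonempty prefixes of \<open>l\<close>.\<close>

definition left_admissible :: "'a ptree \<Rightarrow> nat list set \<Rightarrow> bool" where
  "left_admissible t c \<longleftrightarrow>
     c \<subseteq> edges t \<and>
     (\<forall>p i j. p @ [i] \<in> c \<and> j < i \<longrightarrow> p @ [j] \<in> c) \<and>
     (\<forall>l\<in>leaves t. card {e \<in> c. prefix e l} \<le> 1)"

text \<open>
  \<open>trunk c p t\<close> removes everything above the cut \<open>c\<close> from a tree \<open>t\<close> whose root has address
  \<open>p\<close> in the ambient tree; \<open>trunks c p i ts\<close> does so for the branches with positions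
  \<open>i, i + 1, \<dots>\<close> at the vertex \<open>p\<close>.
\<close>

fun trunk :: "nat list set \<Rightarrow> nat list \<Rightarrow> 'a ptree \<Rightarrow> 'a ptree"
  and trunks :: "nat list set \<Rightarrow> nat list \<Rightarrow> nat \<Rightarrow> 'a ptree list \<Rightarrow> 'a ptree list" where
  "trunk c p (Node a ts) = Node a (trunks c p 0 ts)"
| "trunks c p i [] = []"
| "trunks c p i (t # ts) =
     (if p @ [i] \<in> c then [] else [trunk c (p @ [i]) t]) @ trunks c p (Suc i) ts"

definition cut_off_at :: "'a ptree \<Rightarrow> nat list set \<Rightarrow> nat list \<Rightarrow> 'a pforest" where
  "cut_off_at t c p =
     map (\<lambda>i. subtree t (p @ [i]))
       (filter (\<lambda>i. p @ [i] \<in> c) [0..<length (branches (subtree t p))])"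

definition pruned :: "'a ptree \<Rightarrow> nat list set \<Rightarrow> 'a pforest multiset" where
  "pruned t c = shuffle_all (map (cut_off_at t c) (vertices t))"

definition coproduct_tree :: "'a ptree \<Rightarrow> ('a pforest \<times> 'a pforest) multiset" where
  "coproduct_tree t =
     {#([t], [])#} +
     (\<Sum>c\<in>{c. left_admissible t c}. image_mset (\<lambda>\<omega>. (\<omega>, [trunk c [] t])) (pruned t c))"

text \<open>
  The decoration of the auxiliary root created by \<open>B\<^sub>+\<close> is erased again by \<open>B\<^sub>-\<close>, so it is
  immaterial which one is used.
\<close>

definition B_plus :: "'a pforest \<Rightarrow> 'a ptree" where
  "B_plus \<omega> = Node undefined \<omega>"

definition B_minus :: "'a pforest \<Rightarrow> 'a pforest" where
  "B_minus \<omega> = branches (hd \<omega>)"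

definition coproduct :: "'a pforest \<Rightarrow> ('a pforest \<times> 'a pforest) multiset" where
  "coproduct \<omega> =
     (case \<omega> of
        [t] \<Rightarrow> coproduct_tree t
      | _ \<Rightarrow> image_mset (map_prod id B_minus) (coproduct_tree (B_plus \<omega>) - {#([B_plus \<omega>], [])#}))"

definition star :: "('a pforest \<Rightarrow> real) \<Rightarrow> ('a pforest \<Rightarrow> real) \<Rightarrow> 'a pforest \<Rightarrow> real" where
  "star x y = (\<lambda>\<tau>. if \<tau> \<in> forests_le 3 then \<Sum>(\<sigma>, \<rho>)\<in>#coproduct \<tau>. x \<sigma> * y \<rho> else 0)"


section \<open>Planarly branched rough paths\<close>

text \<open>
  Multiplicativity is required where the shuffle product is not affected by the truncation, as
  usual for truncated characters. Demanding it also for \<open>|\<sigma>| + |\<tau>| > 3\<close>, where the truncated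
  product vanishes, would give \<open>(\<XX>\<^sup>\<tau>)\<^sup>2 = 0\<close> for \<open>|\<tau>| \<in> {2, 3}\<close>, hence also \<open>(\<XX>\<^sup>a)\<^sup>2 = 0\<close> for
  one-vertex forests, and leave only trivial rough paths. The set below contains the one obtained
  in that way.
\<close>

definition PBRP :: "real \<Rightarrow> real \<Rightarrow> (real \<Rightarrow> real \<Rightarrow> 'd pforest \<Rightarrow> real) set" where
  "PBRP \<alpha> T =
     {XX. (\<forall>s\<in>{0..T}. \<forall>t\<in>{0..T}. XX s t \<in> graded_le 3) \<and>
          (\<forall>s\<in>{0..T}. \<forall>u\<in>{0..T}. \<forall>t\<in>{0..T}. star (XX s u) (XX u t) = XX s t) \<and>
          (\<forall>s\<in>{0..T}. \<forall>t\<in>{0..T}. \<forall>\<sigma> \<tau>. forest_size \<sigma> + forest_size \<tau> \<le> 3 \<longrightarrow>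
             (\<Sum>\<rho>\<in>#shuffle \<sigma> \<tau>. XX s t \<rho>) = XX s t \<sigma> * XX s t \<tau>) \<and>
          (\<forall>\<tau>\<in>forests_le 3.
             bdd_above {\<bar>XX s t \<tau>\<bar> / \<bar>t - s\<bar> powr (real (forest_size \<tau>) * \<alpha>) | s t.
                          s \<in> {0..T} \<and> t \<in> {0..T} \<and> s \<noteq> t})}"

definition lies_above ::
    "real \<Rightarrow> (real \<Rightarrow> real \<Rightarrow> 'd pforest \<Rightarrow> real) \<Rightarrow> (real \<Rightarrow> real ^ 'd) \<Rightarrow> bool" where
  "lies_above T XX X \<longleftrightarrow>
     (\<forall>s\<in>{0..T}. \<forall>t\<in>{0..T}. \<forall>i. XX s t [bullet i] = X t $ i - X s $ i)"


section \<open>Controlled paths\<close>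

definition remainder ::
    "(real \<Rightarrow> real \<Rightarrow> 'd::finite pforest \<Rightarrow> real) \<Rightarrow> (real \<Rightarrow> 'd pforest \<Rightarrow> real ^ 'n) \<Rightarrow>
     'd pforest \<Rightarrow> real \<Rightarrow> real \<Rightarrow> real ^ 'n" where
  "remainder XX Y \<tau> s t =
     (Y t \<tau> - Y s \<tau>) -
     (case \<tau> of
        [] \<Rightarrow>
          (\<Sum>a\<in>UNIV. XX s t [bullet a] *\<^sub>R Y s [bullet a]) +
          (\<Sum>a\<in>UNIV. \<Sum>b\<in>UNIV. XX s t [bullet a, bullet b] *\<^sub>R Y s [bullet a, bullet b]) +
          (\<Sum>a\<in>UNIV. \<Sum>b\<in>UNIV. XX s t [Node a [bullet b]] *\<^sub>R Y s [Node a [bullet b]])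
      | [Node a []] \<Rightarrow>
          (\<Sum>b\<in>UNIV. XX s t [bullet b] *\<^sub>R (Y s [bullet a, bullet b] + Y s [Node a [bullet b]]))
      | _ \<Rightarrow> 0)"

definition controlled ::
    "(real \<Rightarrow> real \<Rightarrow> 'd::finite pforest \<Rightarrow> real) \<Rightarrow> real \<Rightarrow> real \<Rightarrow>
     (real \<Rightarrow> 'd pforest \<Rightarrow> real ^ 'n) set" where
  "controlled XX \<alpha> \<delta> =
     {Y \<in> {0..\<delta>} \<rightarrow>\<^sub>E graded_le 2.
        \<forall>\<tau>\<in>forests_le 2.
          bdd_above {norm (remainder XX Y \<tau> s t) / \<bar>t - s\<bar> powr ((3 - real (forest_size \<tau>)) * \<alpha>) | s t.
                       s \<in> {0..\<delta>} \<and> t \<in> {0..\<delta>} \<and> s \<noteq> t}}"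

primrec times_differentiable :: "nat \<Rightarrow> (real ^ 'm \<Rightarrow> real ^ 'n) \<Rightarrow> bool" where
  "times_differentiable 0 G \<longleftrightarrow> continuous_on UNIV G"
| "times_differentiable (Suc k) G \<longleftrightarrow>
     (\<forall>x. G differentiable (at x)) \<and>
     (\<forall>v. times_differentiable k (\<lambda>x. frechet_derivative G (at x) v))"

definition smooth :: "(real ^ 'm \<Rightarrow> real ^ 'n) \<Rightarrow> bool" where
  "smooth G \<longleftrightarrow> (\<forall>k. times_differentiable k G)"

definition deriv1 :: "(real ^ 'm \<Rightarrow> real ^ 'n) \<Rightarrow> real ^ 'm \<Rightarrow> real ^ 'm \<Rightarrow> real ^ 'n" where
  "deriv1 G y v = frechet_derivative G (at y) v"

definition deriv2 ::
    "(real ^ 'm \<Rightarrow> real ^ 'n) \<Rightarrow> real ^ 'm \<Rightarrow> real ^ 'm \<Rightarrow> real ^ 'm \<Rightarrow> real ^ 'n" where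
  "deriv2 G y v w = frechet_derivative (\<lambda>z. frechet_derivative G (at z) w) (at y) v"

definition compose_controlled ::
    "(real ^ 'n \<Rightarrow> real ^ 'n) \<Rightarrow> (real \<Rightarrow> 'd pforest \<Rightarrow> real ^ 'n) \<Rightarrow>
     real \<Rightarrow> 'd pforest \<Rightarrow> real ^ 'n" where
  "compose_controlled G Y t \<tau> =
     (case \<tau> of
        [] \<Rightarrow> G (Y t [])
      | [Node a []] \<Rightarrow> deriv1 G (Y t []) (Y t \<tau>)
      | [Node a [Node b []]] \<Rightarrow> deriv1 G (Y t []) (Y t \<tau>)
      | [Node a [], Node b []] \<Rightarrow>
          deriv1 G (Y t []) (Y t \<tau>) + deriv2 G (Y t []) (Y t [bullet a]) (Y t [bullet b])
      | _ \<Rightarrow> 0)"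


section \<open>Rough integral and rough differential equation\<close>

text \<open>
  Partitions of \<open>[0,t]\<close> are divisions of \<open>{0..t}\<close>, that is, finite sets of compact intervals
  \<open>{u..v}\<close>; \<open>partitions_mesh t\<close> is the filter of partitions with mesh tending to \<open>0\<close>.
\<close>

definition partitions_mesh :: "real \<Rightarrow> real set set filter" where
  "partitions_mesh t =
     (INF \<eta>\<in>{0<..}. principal {\<pi>. \<pi> division_of {0..t} \<and> (\<forall>K\<in>\<pi>. Sup K - Inf K < \<eta>)})"

definition rough_sum ::
    "(real \<Rightarrow> real \<Rightarrow> 'd pforest \<Rightarrow> real) \<Rightarrow> (real \<Rightarrow> 'd pforest \<Rightarrow> real ^ 'n) \<Rightarrow> 'd \<Rightarrow>
     real set set \<Rightarrow> real ^ 'n" where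
  "rough_sum XX Z a \<pi> =
     (\<Sum>K\<in>\<pi>. \<Sum>\<tau>\<in>forests_le 2. XX (Inf K) (Sup K) [Node a \<tau>] *\<^sub>R Z (Inf K) \<tau>)"

definition rough_integrable ::
    "(real \<Rightarrow> real \<Rightarrow> 'd pforest \<Rightarrow> real) \<Rightarrow> (real \<Rightarrow> 'd pforest \<Rightarrow> real ^ 'n) \<Rightarrow> 'd \<Rightarrow>
     real \<Rightarrow> bool" where
  "rough_integrable XX Z a t \<longleftrightarrow> (\<exists>L. (rough_sum XX Z a \<longlongrightarrow> L) (partitions_mesh t))"

definition rough_integral ::
    "(real \<Rightarrow> real \<Rightarrow> 'd pforest \<Rightarrow> real) \<Rightarrow> (real \<Rightarrow> 'd pforest \<Rightarrow> real ^ 'n) \<Rightarrow> 'd \<Rightarrow>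
     real \<Rightarrow> real ^ 'n" where
  "rough_integral XX Z a t = Lim (partitions_mesh t) (rough_sum XX Z a)"

definition integral_path ::
    "(real \<Rightarrow> real \<Rightarrow> 'd::finite pforest \<Rightarrow> real) \<Rightarrow> ('d \<Rightarrow> real \<Rightarrow> 'd pforest \<Rightarrow> real ^ 'n) \<Rightarrow>
     real \<Rightarrow> 'd pforest \<Rightarrow> real ^ 'n" where
  "integral_path XX Z t \<tau> =
     (case \<tau> of
        [] \<Rightarrow> \<Sum>i\<in>UNIV. rough_integral XX (Z i) i t
      | [Node a \<sigma>] \<Rightarrow> if \<tau> \<in> forests_le 2 then Z a t \<sigma> else 0
      | _ \<Rightarrow> 0)"

definition unit_multiple :: "real ^ 'n \<Rightarrow> 'd pforest \<Rightarrow> real ^ 'n" where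
  "unit_multiple y = (\<lambda>\<tau>. if \<tau> = [] then y else 0)"

text \<open>
  The initial term of \<open>\<bold>Y\<^sub>t = \<bold>Y\<^sub>0 + \<integral>\<^sub>0\<^sup>t F(\<bold>Y\<^sub>r) \<cdot> dX\<^sub>r\<close> is the initial condition \<open>Y\<^sub>0 = \<bold>Y\<^sub>0\<^sup>\<one>\<close> of
  the path, embedded as the constant \<open>Y\<^sub>0 \<one>\<close>. It cannot be the full value \<open>\<bold>Y\<^sub>0\<close> on the
  nontrivial forests: the integral path has component \<open>F\<^sup>a(Y\<^sub>0)\<close> on the one-vertex tree decorated by
  \<open>a\<close> already at \<open>t = 0\<close>, so the equation at \<open>t = 0\<close> would force \<open>F\<^sup>a(Y\<^sub>0) = 0\<close> for all \<open>a\<close>.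
  On the empty forest the two readings agree.
\<close>

definition solves_RDE ::
    "(real \<Rightarrow> real \<Rightarrow> 'd::finite pforest \<Rightarrow> real) \<Rightarrow> ('d \<Rightarrow> real ^ 'n \<Rightarrow> real ^ 'n) \<Rightarrow> real \<Rightarrow>
     (real \<Rightarrow> 'd pforest \<Rightarrow> real ^ 'n) \<Rightarrow> bool" where
  "solves_RDE XX F \<delta> Y \<longleftrightarrow>
     (\<forall>t\<in>{0..\<delta>}.
        (\<forall>a. rough_integrable XX (compose_controlled (F a) Y) a t) \<and>
        (\<forall>\<tau>. Y t \<tau> =
           unit_multiple (Y 0 []) \<tau> + integral_path XX (\<lambda>a. compose_controlled (F a) Y) t \<tau>))"

definition RDE_solution ::
    "(real \<Rightarrow> real \<Rightarrow> 'd::finite pforest \<Rightarrow> real) \<Rightarrow> real \<Rightarrow> ('d \<Rightarrow> real ^ 'n \<Rightarrow> real ^ 'n) \<Rightarrow>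
     real ^ 'n \<Rightarrow> real \<Rightarrow> (real \<Rightarrow> real ^ 'n) \<Rightarrow> bool" where
  "RDE_solution XX \<alpha> F \<xi> \<delta> y \<longleftrightarrow>
     y \<in> extensional {0..\<delta>} \<and> y 0 = \<xi> \<and>
     (\<exists>Y\<in>controlled XX \<alpha> \<delta>. (\<forall>t\<in>{0..\<delta>}. Y t [] = y t) \<and> solves_RDE XX F \<delta> Y)"

end

theory Submission
  imports Defs "HOL-Complex_Analysis.Great_Picard"
begin

text \<open>
  A controlled path solving the equation vanishes on two-tree forests, and its remaining components are
  determined by its value \<open>y\<close> on the empty forest. The equation is then equivalent to Davie's condition
  \<open>\<bar>y t - \<mu> s t (y s)\<bar> \<le> C \<bar>t - s\<bar> powr (4 * \<alpha>)\<close>, where \<open>\<mu> s t x\<close> is \<open>x\<close> plus the sum over the trees with at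
  most three vertices of their elementary differentials at \<open>x\<close> times their values under \<open>XX s t\<close>. By Chen's
  relation, the shuffle relation and the symmetry of second derivatives, \<open>\<mu> s t x - \<mu> u t (\<mu> s u x)\<close> and its
  Lipschitz constant in \<open>x\<close> are of order \<open>4 \<alpha> > 1\<close>. Hence limits of dyadic Euler schemes are solutions,
  and the difference of two solutions with the same initial value vanishes, since on short intervals its
  defect contracts under halving. The integrals exist by sewing.
\<close>

text \<open>On the empty forest the remainder of a controlled path has order 3 \<alpha> only, which
  does not exceed 1 and so cannot determine the path. Order 3 does suffice to sew the integrals,
  since the Lipschitz constant of the germ contributes one further factor (t - s)^\<alpha>; the
  equation then returns order 4. Conversely, remainders must also be bounded for s > t, which is
  done by expanding about the earlier time. The vector fields are only locally bounded, so all
  estimates live on balls. A short interval keeps the Euler scheme inside one ball and makes the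
  Lipschitz constant of \<mu> s t - id small. Existence goes through compactness and asks only for
  the size of the flow defect; uniqueness compares two paths and also needs its Lipschitz constant,
  so \<open>of_order\<close> carries both. The sewing lemma is the same existence result for
  translations x + \<Xi> s t. Times are cut down to \<open>min T 1\<close>, so that higher powers of
  (t - s)^\<alpha> are absorbed by lower ones.\<close>

section \<open>Coproducts of small forests, relations and bounds for the rough path\<close>

lemma left_admissible_small:
  "{e. left_admissible (Node a []) e} = {{}}"
  "{e. left_admissible (Node a [bullet b]) e} = {{}, {[0]}}"
  "{e. left_admissible (Node a [bullet b, bullet c]) e} = {{}, {[0]}, {[0], [1]}}"
  "{e. left_admissible (Node a [Node b [bullet c]]) e} = {{}, {[0]}, {[0, 0]}}"
proof -
  show "{e. left_admissible (Node a []) e} = {{}}"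
    by (auto simp: left_admissible_def edges_def)
  have *: "left_admissible t e \<longleftrightarrow> e \<in> Pow (edges t) \<and>
     (\<forall>p i j. p @ [i] \<in> e \<and> j < i \<longrightarrow> p @ [j] \<in> e) \<and>
     (\<forall>l\<in>leaves t. card {x \<in> e. prefix x l} \<le> 1)" for t :: "'a ptree" and e
    by (simp add: left_admissible_def)
  have c1: "{x. x = [0] \<and> prefix x [0::nat]} = {[0]}" by auto
  have e1: "edges (Node a [bullet b]) = {[0]}"
    by (auto simp: edges_def)
  have l1: "leaves (Node a [bullet b]) = {[0]}"
    by (auto simp: leaves_def)
  show "{e. left_admissible (Node a [bullet b]) e} = {{}, {[0]}}"
    by (auto simp: * e1 l1 Pow_insert append_eq_Cons_conv c1)
  have e2: "edges (Node a [bullet b, bullet c]) = {[0], [1]}"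
    by (auto simp: edges_def)
  have l2: "leaves (Node a [bullet b, bullet c]) = {[0], [1]}"
    by (auto simp: leaves_def)
  have c2: "{x. (x = [0] \<or> x = [Suc 0]) \<and> prefix x [0::nat]} = {[0]}"
    "{x. (x = [0] \<or> x = [Suc 0]) \<and> prefix x [Suc 0]} = {[Suc 0]}"
    "{x. (x = [0]) \<and> prefix x [Suc 0]} = {}"
    by auto
  \<comment> \<open>\<open>{[1]}\<close> is missing: it would cut the right edge without the edge to
    its left.\<close>
  show "{e. left_admissible (Node a [bullet b, bullet c]) e} = {{}, {[0]}, {[0], [1]}}"
    by (auto simp: * e2 l2 Pow_insert append_eq_Cons_conv c1 c2)
  have e3: "edges (Node a [Node b [bullet c]]) = {[0], [0, 0]}"
    by (auto simp: edges_def)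
  have l3: "leaves (Node a [Node b [bullet c]]) = {[0, 0]}"
    by (auto simp: leaves_def)
  have c3: "{x. (x = [0] \<or> x = [0, 0]) \<and> prefix x [0, 0::nat]} = {[0], [0, 0]}"
    "{x. (x = [0, 0]) \<and> prefix x [0, 0::nat]} = {[0, 0]}"
    "{x. (x = [0]) \<and> prefix x [0, 0::nat]} = {[0]}"
    by auto
  \<comment> \<open>\<open>{[0], [0, 0]}\<close> is missing: both edges lie on the path to the only
    leaf.\<close>
  show "{e. left_admissible (Node a [Node b [bullet c]]) e} = {{}, {[0]}, {[0, 0]}}"
    by (auto simp: * e3 l3 Pow_insert append_eq_Cons_conv c3)
qed

text \<open>The scheme involves only trees with at most three vertices; the empty forest serves
  \<open>PBRP_unit\<close>. The pruned forest is the left factor, so in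
  \<open>star (XX s u) (XX u t)\<close> the branches belong to the earlier interval and the trunk to
  the later one.\<close>

lemma coproduct_small:
  "coproduct [] = {#([], [])#}"
  "coproduct [Node a []] = {#([Node a []], []), ([], [Node a []])#}"
  "coproduct [Node a [bullet b]] =
     {#([Node a [bullet b]], []), ([], [Node a [bullet b]]), ([bullet b], [bullet a])#}"
  "coproduct [Node a [bullet b, bullet c]] =
     {#([Node a [bullet b, bullet c]], []), ([], [Node a [bullet b, bullet c]]),
       ([bullet b], [Node a [bullet c]]), ([bullet b, bullet c], [bullet a])#}"
  "coproduct [Node a [Node b [bullet c]]] =
     {#([Node a [Node b [bullet c]]], []), ([], [Node a [Node b [bullet c]]]),
       ([Node b [bullet c]], [bullet a]), ([bullet c], [Node a [bullet b]])#}"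
  by (simp_all add: coproduct_def coproduct_tree_def left_admissible_small pruned_def
      cut_off_at_def shuffle_all_def doubleton_eq_iff
      B_plus_def B_minus_def)

lemma star_small:
  "star x y [Node a []] = x [Node a []] * y [] + x [] * y [Node a []]"
  "star x y [Node a [bullet b]] =
     x [Node a [bullet b]] * y [] + x [] * y [Node a [bullet b]] + x [bullet b] * y [bullet a]"
  "star x y [Node a [bullet b, bullet c]] =
     x [Node a [bullet b, bullet c]] * y [] + x [] * y [Node a [bullet b, bullet c]] +
     x [bullet b] * y [Node a [bullet c]] + x [bullet b, bullet c] * y [bullet a]"
  "star x y [Node a [Node b [bullet c]]] =
     x [Node a [Node b [bullet c]]] * y [] + x [] * y [Node a [Node b [bullet c]]] +
     x [Node b [bullet c]] * y [bullet a] + x [bullet c] * y [Node a [bullet b]]"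
  by (simp_all add: star_def coproduct_small forests_le_def)

text \<open>
  The character \<open>XX s t\<close> takes the value \<open>0\<close> or \<open>1\<close> on the empty forest; in the former case it
  vanishes identically, so the relations below hold in both cases.
\<close>

lemma PBRP_unit:
  assumes "XX \<in> PBRP \<alpha> T" "s \<in> {0..T}" "t \<in> {0..T}" "u \<in> {0..T}" "v \<in> {0..T}"
    and "forest_size \<tau> \<le> 3"
  shows "XX s t \<tau> * XX u v [] = XX s t \<tau>" "XX u v [] * XX s t \<tau> = XX s t \<tau>"
proof -
  have sh: "(\<Sum>\<rho>\<in>#shuffle \<sigma> \<tau>. XX s t \<rho>) = XX s t \<sigma> * XX s t \<tau>"
    if "s \<in> {0..T}" "t \<in> {0..T}" "forest_size \<sigma> + forest_size \<tau> \<le> 3" for s t \<sigma> \<tau>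
    using assms(1) that by (auto simp: PBRP_def)
  have mul: "XX s t [] = XX s u [] * XX u t []"
    if "s \<in> {0..T}" "t \<in> {0..T}" "u \<in> {0..T}" for s t u
  proof -
    have "star (XX s u) (XX u t) = XX s t" using assms(1) that by (auto simp: PBRP_def)
    from fun_cong[OF this, of "[]"] show ?thesis
      by (simp add: star_def coproduct_small forests_le_def)
  qed
  have idem: "XX s t [] * XX s t [] = XX s t []" if "s \<in> {0..T}" "t \<in> {0..T}" for s t
    using sh[OF that, of "[]" "[]"] by simp
  have ex: "XX s t [] * XX s t \<tau> = XX s t \<tau>"
    using sh[of s t "[]" \<tau>] assms by simp
  have "XX u v [] = 1 \<or> XX s t [] = 0"
  proof -
    \<comment> \<open>Chen's relation through \<open>u\<close> and \<open>v\<close> makes the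
      idempotent \<open>XX u v []\<close> a factor of \<open>XX s t []\<close>.\<close>
    have "XX s t [] = XX s u [] * (XX u v [] * XX v t [])"
      using mul[of s t u] mul[of u t v] assms by simp
    then show ?thesis using idem[of u v] assms by auto
  qed
  then show "XX s t \<tau> * XX u v [] = XX s t \<tau>" "XX u v [] * XX s t \<tau> = XX s t \<tau>"
    using ex by auto
qed

lemma PBRP_star:
  assumes "XX \<in> PBRP \<alpha> T" "s \<in> {0..T}" "u \<in> {0..T}" "t \<in> {0..T}"
  shows "XX s t \<tau> = star (XX s u) (XX u t) \<tau>"
  using assms by (auto simp: PBRP_def)

lemma PBRP_chen:
  assumes "XX \<in> PBRP \<alpha> T" "s \<in> {0..T}" "u \<in> {0..T}" "t \<in> {0..T}"
  shows "XX s t [bullet a] = XX s u [bullet a] + XX u t [bullet a]"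
    and "XX s t [Node a [bullet b]] =
      XX s u [Node a [bullet b]] + XX u t [Node a [bullet b]] +
      XX s u [bullet b] * XX u t [bullet a]"
    and "XX s t [Node a [bullet b, bullet c]] =
      XX s u [Node a [bullet b, bullet c]] + XX u t [Node a [bullet b, bullet c]] +
      XX s u [bullet b] * XX u t [Node a [bullet c]] +
      XX s u [bullet b, bullet c] * XX u t [bullet a]"
    and "XX s t [Node a [Node b [bullet c]]] =
      XX s u [Node a [Node b [bullet c]]] + XX u t [Node a [Node b [bullet c]]] +
      XX s u [Node b [bullet c]] * XX u t [bullet a] +
      XX s u [bullet c] * XX u t [Node a [bullet b]]"
  unfolding PBRP_star[OF assms] star_small
  by (simp_all add: PBRP_unit(1)[OF assms(1,2,3,3,4)] PBRP_unit(2)[OF assms(1,3,4,2,3)])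

lemma PBRP_shuffle:
  assumes "XX \<in> PBRP \<alpha> T" "s \<in> {0..T}" "t \<in> {0..T}"
  shows "XX s t [bullet a, bullet b] + XX s t [bullet b, bullet a] =
    XX s t [bullet a] * XX s t [bullet b]"
proof -
  have "(\<Sum>\<rho>\<in>#shuffle [bullet a] [bullet b]. XX s t \<rho>) = XX s t [bullet a] * XX s t [bullet b]"
    using assms by (auto simp: PBRP_def simp del: shuffle.simps)
  then show ?thesis by (simp add: add.commute)
qed

text \<open>The Hoelder condition is silent about s = t, where for nonempty \<open>\<tau>\<close>
  the bound says that the value vanishes; \<open>diag\<close> supplies this and will come from
  Chen's relation. Integer powers of (t - s)^\<alpha> replace real exponents from here on.\<close>

lemma PBRP_bound:
  assumes XX: "XX \<in> PBRP \<alpha> T" and "\<tau> \<in> forests_le 3"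
    and diag: "\<And>s. s \<in> {0..T} \<Longrightarrow> XX s s \<tau> = 0"
  shows "\<exists>K\<ge>0. \<forall>s\<in>{0..T}. \<forall>t\<in>{0..T}.
    \<bar>XX s t \<tau>\<bar> \<le> K * (\<bar>t - s\<bar> powr \<alpha>) ^ forest_size \<tau>"
proof -
  let ?w = "\<lambda>s t. \<bar>t - s\<bar> powr (real (forest_size \<tau>) * \<alpha>)"
  let ?S = "{\<bar>XX s t \<tau>\<bar> / ?w s t | s t.
                          s \<in> {0..T} \<and> t \<in> {0..T} \<and> s \<noteq> t}"
  have "bdd_above ?S" using assms by (auto simp: PBRP_def)
  then obtain K where K: "\<And>z. z \<in> ?S \<Longrightarrow> z \<le> K" by (auto simp: bdd_above_def)
  have "\<bar>XX s t \<tau>\<bar> \<le> max K 0 * (\<bar>t - s\<bar> powr \<alpha>) ^ forest_size \<tau>"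
    if st: "s \<in> {0..T}" "t \<in> {0..T}" for s t
  proof (cases "s = t")
    case True then show ?thesis using diag st by simp
  next
    case False
    have pw: "(\<bar>t - s\<bar> powr \<alpha>) ^ forest_size \<tau> = ?w s t"
      using False by (simp add: powr_realpow[symmetric] powr_powr mult.commute)
    have "\<bar>XX s t \<tau>\<bar> / ?w s t \<le> K"
      using st False by (intro K) auto
    then have "\<bar>XX s t \<tau>\<bar> \<le> K * ?w s t"
      using False by (simp add: divide_le_eq)
    also have "\<dots> \<le> max K 0 * ?w s t"
      by (intro mult_right_mono) auto
    finally show ?thesis by (simp add: pw)
  qed
  then show ?thesis by (intro exI[of _ "max K 0"]) auto
qed

text \<open>Vanishing on the diagonal is a premise for each forest separately, because the empty
  forest need not have it. The sum of the finitely many constants serves the others.\<close>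

lemma PBRP_bounds:
  fixes XX :: "real \<Rightarrow> real \<Rightarrow> 'd::finite pforest \<Rightarrow> real"
  assumes XX: "XX \<in> PBRP \<alpha> T"
  shows "\<exists>K\<ge>0. \<forall>\<tau>\<in>forests_le 3. (\<forall>s\<in>{0..T}. XX s s \<tau> = 0) \<longrightarrow>
    (\<forall>s\<in>{0..T}. \<forall>t\<in>{0..T}. \<bar>XX s t \<tau>\<bar> \<le> K * (\<bar>t - s\<bar> powr \<alpha>) ^ forest_size \<tau>)"
proof -
  define \<S> where "\<S> = {\<tau> \<in> forests_le 3. \<forall>s\<in>{0..T}. XX s s \<tau> = 0}"
  have "\<forall>\<tau>\<in>\<S>. \<exists>K\<ge>0. \<forall>s\<in>{0..T}. \<forall>t\<in>{0..T}.
    \<bar>XX s t \<tau>\<bar> \<le> K * (\<bar>t - s\<bar> powr \<alpha>) ^ forest_size \<tau>"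
    by (intro ballI PBRP_bound[OF XX]) (auto simp: \<S>_def)
  then obtain K where K: "\<And>\<tau>. \<tau> \<in> \<S> \<Longrightarrow> K \<tau> \<ge> 0"
    "\<And>\<tau> s t. \<lbrakk>\<tau> \<in> \<S>; s \<in> {0..T}; t \<in> {0..T}\<rbrakk> \<Longrightarrow>
      \<bar>XX s t \<tau>\<bar> \<le> K \<tau> * (\<bar>t - s\<bar> powr \<alpha>) ^ forest_size \<tau>"
    by metis
  define K' where "K' = (\<Sum>\<tau>\<in>\<S>. K \<tau>)"
  have "\<bar>XX s t \<tau>\<bar> \<le> K' * (\<bar>t - s\<bar> powr \<alpha>) ^ forest_size \<tau>"
    if "\<tau> \<in> \<S>" "s \<in> {0..T}" "t \<in> {0..T}" for \<tau> s t
  proof -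
    have "K \<tau> \<le> K'"
      unfolding K'_def using that K finite_forests_le[of 3] by (intro member_le_sum) (auto simp: \<S>_def)
    then show ?thesis using K(2)[OF that]
      by (meson order_trans mult_right_mono powr_ge_zero zero_le_power)
  qed
  moreover have "K' \<ge> 0" unfolding K'_def using K by (intro sum_nonneg) auto
  ultimately show ?thesis by (intro exI[of _ K']) (simp add: \<S>_def)
qed

subsection \<open>Smooth maps\<close>

lemma smooth_differentiable: "smooth G \<Longrightarrow> G differentiable (at x)"
proof -
  assume "smooth G"
  then have "times_differentiable (Suc 0) G" unfolding smooth_def by blast
  then show ?thesis by simp
qed

lemma smooth_deriv1: "smooth G \<Longrightarrow> smooth (\<lambda>x. deriv1 G x v)"
  unfolding smooth_def deriv1_def
proof
  fix k
  assume "\<forall>k. times_differentiable k G"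
  then have "times_differentiable (Suc k) G" by blast
  then show "times_differentiable k (\<lambda>x. frechet_derivative G (at x) v)" by simp
qed

lemma smooth_has_derivative: "smooth G \<Longrightarrow> (G has_derivative deriv1 G x) (at x)"
  using smooth_differentiable[of G x] frechet_derivative_works[of G "at x"]
  by (simp add: deriv1_def[abs_def])

lemma smooth_linear: "smooth G \<Longrightarrow> linear (deriv1 G x)"
  using smooth_has_derivative has_derivative_linear by blast

lemma smooth_continuous: "smooth G \<Longrightarrow> continuous_on S G"
  by (intro continuous_at_imp_continuous_on ballI differentiable_imp_continuous_within
      smooth_differentiable)

lemma deriv1_eqI: "(G has_derivative G') (at x) \<Longrightarrow> deriv1 G x v = G' v"
  using frechet_derivative_at[of G G' x] by (simp add: deriv1_def)

lemma times_differentiable_Suc_imp: "times_differentiable (Suc k) G \<Longrightarrow> times_differentiable k G"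
proof (induction k arbitrary: G)
  case 0
  then have "continuous (at x) G" for x
    using differentiable_imp_continuous_within[of G x UNIV] by simp
  then show ?case by (simp add: continuous_at_imp_continuous_on)
qed auto

lemma times_differentiable_add:
  "times_differentiable k G \<Longrightarrow> times_differentiable k H \<Longrightarrow> times_differentiable k (\<lambda>x. G x + H x)"
proof (induction k arbitrary: G H)
  case 0
  then show ?case by (auto intro: continuous_on_add)
next
  case (Suc k)
  have "(G has_derivative frechet_derivative G (at x)) (at x)"
    "(H has_derivative frechet_derivative H (at x)) (at x)" for x
    using Suc.prems by (simp_all add: frechet_derivative_works[symmetric])
  then have d: "((\<lambda>x. G x + H x) has_derivative
      (\<lambda>v. frechet_derivative G (at x) v + frechet_derivative H (at x) v)) (at x)" for x
    by (rule has_derivative_add)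
  have "frechet_derivative (\<lambda>x. G x + H x) (at x) v =
      frechet_derivative G (at x) v + frechet_derivative H (at x) v" for x v
    by (simp add: frechet_derivative_at[OF d, symmetric])
  then show ?case
    using Suc differentiableI[OF d] by simp
qed

lemma times_differentiable_const: "times_differentiable k (\<lambda>x. c)"
proof (induction k arbitrary: c)
  case (Suc k)
  have "frechet_derivative (\<lambda>x. c) (at x) v = 0" for x v :: "real ^ 'a"
    by (metis frechet_derivative_const)
  with Suc show ?case by simp
qed auto

text \<open>Smoothness is defined for maps between spaces \<open>real ^ 'n\<close> only, so a real
  factor is represented as a coordinate of such a map.\<close>

lemma times_differentiable_coord_scaleR:
  fixes G :: "real ^ 'm \<Rightarrow> real ^ 'n" and H :: "real ^ 'm \<Rightarrow> real ^ 'l"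
  shows "times_differentiable k G \<Longrightarrow> times_differentiable k H \<Longrightarrow>
    times_differentiable k (\<lambda>x. (H x $ i) *\<^sub>R G x)"
proof (induction k arbitrary: G H)
  case 0
  then show ?case by (auto intro!: continuous_intros)
next
  case (Suc k)
  have dG: "(G has_derivative frechet_derivative G (at x)) (at x)"
    and dH: "(H has_derivative frechet_derivative H (at x)) (at x)" for x
    using Suc.prems by (auto simp: frechet_derivative_works[symmetric])
  have d: "((\<lambda>x. (H x $ i) *\<^sub>R G x) has_derivative
     (\<lambda>v. (H x $ i) *\<^sub>R frechet_derivative G (at x) v + (frechet_derivative H (at x) v $ i) *\<^sub>R G x)) (at x)" for x
    by (rule has_derivative_eq_rhs[OF has_derivative_scaleR[OF
          bounded_linear.has_derivative[OF bounded_linear_vec_nth dH] dG]]) simp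
  have *: "frechet_derivative (\<lambda>x. (H x $ i) *\<^sub>R G x) (at x) v =
     (H x $ i) *\<^sub>R frechet_derivative G (at x) v + (frechet_derivative H (at x) v $ i) *\<^sub>R G x" for x v
    by (simp add: frechet_derivative_at[OF d, symmetric])
  have k: "times_differentiable k G" "times_differentiable k H"
    using Suc.prems times_differentiable_Suc_imp by blast+
  show ?case
    using Suc.prems k differentiableI[OF d] unfolding times_differentiable.simps *
    by (auto intro!: times_differentiable_add Suc.IH)
qed

lemma smooth_add: "smooth G \<Longrightarrow> smooth H \<Longrightarrow> smooth (\<lambda>x. G x + H x)"
  by (simp add: smooth_def times_differentiable_add)

lemma smooth_coord_scaleR: "smooth G \<Longrightarrow> smooth H \<Longrightarrow> smooth (\<lambda>x. (H x $ i) *\<^sub>R G x)"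
  by (simp add: smooth_def times_differentiable_coord_scaleR)

lemma smooth_const: "smooth (\<lambda>x. c)"
  by (simp add: smooth_def times_differentiable_const)

lemma smooth_sum: "finite I \<Longrightarrow> (\<And>i. i \<in> I \<Longrightarrow> smooth (G i)) \<Longrightarrow> smooth (\<lambda>x. \<Sum>i\<in>I. G i x)"
  by (induction I rule: finite_induct) (auto intro: smooth_add smooth_const)

text \<open>The constant is a coordinate of a constant map into \<open>real ^ 1\<close>.\<close>

lemma smooth_scaleR: "smooth G \<Longrightarrow> smooth (\<lambda>x. c *\<^sub>R G x)"
  using smooth_coord_scaleR[OF _ smooth_const[of "(\<chi> i. c) :: real ^ 1"], of G undefined] by simp

lemma linear_eq_sum_axis:
  fixes f :: "real ^ 'n \<Rightarrow> 'b::real_vector"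
  assumes "linear f"
  shows "f v = (\<Sum>i\<in>UNIV. (v $ i) *\<^sub>R f (axis i 1))"
proof -
  have "f v = f (\<Sum>i\<in>UNIV. (v $ i) *\<^sub>R axis i 1)"
    using basis_expansion[of v] by (simp add: scalar_mult_eq_scaleR)
  also have "\<dots> = (\<Sum>i\<in>UNIV. (v $ i) *\<^sub>R f (axis i 1))"
    by (simp add: linear_sum[OF assms] linear_cmul[OF assms])
  finally show ?thesis .
qed

text \<open>A derivative in a direction that varies with \<open>x\<close> becomes a sum of
  coordinates times derivatives in fixed directions, which the product rule
  \<open>smooth_coord_scaleR\<close> can handle.\<close>

lemma deriv1_eq_sum:
  "smooth G \<Longrightarrow> deriv1 G x v = (\<Sum>i\<in>UNIV. (v $ i) *\<^sub>R deriv1 G x (axis i 1))"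
  by (rule linear_eq_sum_axis[OF smooth_linear])

lemma smooth_deriv1_field:
  assumes "smooth G" "smooth H"
  shows "smooth (\<lambda>x. deriv1 G x (H x))"
  unfolding deriv1_eq_sum[OF assms(1), of _ "H _"]
  by (intro smooth_sum smooth_coord_scaleR smooth_deriv1 assms) simp

lemma deriv2_eq: "deriv2 G x v w = deriv1 (\<lambda>z. deriv1 G z w) x v"
  by (simp add: deriv2_def deriv1_def)

lemma deriv1_sum:
  assumes "finite I" "\<And>i. i \<in> I \<Longrightarrow> smooth (G i)"
  shows "deriv1 (\<lambda>x. \<Sum>i\<in>I. G i x) x v = (\<Sum>i\<in>I. deriv1 (G i) x v)"
  by (rule deriv1_eqI) (intro has_derivative_sum smooth_has_derivative assms)

lemma deriv1_scaleR: "smooth G \<Longrightarrow> deriv1 (\<lambda>x. c *\<^sub>R G x) x v = c *\<^sub>R deriv1 G x v"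
  by (rule deriv1_eqI) (intro has_derivative_scaleR_right smooth_has_derivative)

lemma deriv2_eq_sum:
  assumes "smooth G"
  shows "deriv2 G x v w = (\<Sum>i\<in>UNIV. (w $ i) *\<^sub>R deriv1 (\<lambda>z. deriv1 G z (axis i 1)) x v)"
  unfolding deriv2_eq deriv1_eq_sum[OF assms, of _ w]
  by (simp add: deriv1_sum deriv1_scaleR smooth_scaleR smooth_deriv1 assms)

lemma smooth_deriv2_field:
  assumes "smooth G" "smooth H" "smooth K"
  shows "smooth (\<lambda>x. deriv2 G x (H x) (K x))"
  unfolding deriv2_eq_sum[OF assms(1)]
  by (intro smooth_sum smooth_coord_scaleR smooth_deriv1_field smooth_deriv1 assms) simp

lemma deriv2_linear_left: "smooth G \<Longrightarrow> linear (\<lambda>v. deriv2 G x v w)"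
  unfolding deriv2_eq by (intro smooth_linear smooth_deriv1)

lemma deriv2_linear_right: "smooth G \<Longrightarrow> linear (deriv2 G x v)"
  unfolding deriv2_eq_sum
  by (rule linearI) (simp_all add: deriv2_eq_sum algebra_simps sum.distrib scaleR_sum_right)

text \<open>Moving the base point of \<open>deriv1 G\<close> produces the second derivative, with
  the new direction \<open>v\<close> in its first slot; moving the field \<open>H\<close> produces
  the other term.\<close>

lemma deriv1_deriv1_field:
  assumes "smooth G" "smooth H"
  shows "deriv1 (\<lambda>x. deriv1 G x (H x)) x v = deriv2 G x v (H x) + deriv1 G x (deriv1 H x v)"
proof -
  have "((\<lambda>x. deriv1 G x (H x)) has_derivative
      (\<lambda>v. \<Sum>i\<in>UNIV. (H x $ i) *\<^sub>R deriv1 (\<lambda>z. deriv1 G z (axis i 1)) x v +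
         (deriv1 H x v $ i) *\<^sub>R deriv1 G x (axis i 1))) (at x)"
    unfolding deriv1_eq_sum[OF assms(1), of _ "H _"]
    by (intro has_derivative_sum has_derivative_scaleR smooth_has_derivative smooth_deriv1 assms
        bounded_linear.has_derivative[OF bounded_linear_vec_nth])
  from deriv1_eqI[OF this, of v] show ?thesis
    by (simp add: sum.distrib deriv2_eq_sum[OF assms(1)] deriv1_eq_sum[OF assms(1), of _ "deriv1 H x v"])
qed

lemma smooth_locally_bounded:
  assumes "smooth (G :: real ^ 'm \<Rightarrow> real ^ 'n)"
  obtains C where "C \<ge> 0" "\<And>x. x \<in> cball 0 R \<Longrightarrow> norm (G x) \<le> C"
proof -
  have "compact (G ` cball 0 R)"
    by (intro compact_continuous_image smooth_continuous assms compact_cball)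
  then obtain C where "\<forall>y\<in>G ` cball 0 R. norm y \<le> C"
    using compact_imp_bounded bounded_iff by blast
  then show thesis by (intro that[of "max C 0"]) (auto simp: le_max_iff_disj)
qed

lemma norm_sum_scaleR_bound:
  assumes "\<And>i. norm (c i) \<le> C"
  shows "norm (\<Sum>i\<in>UNIV. (v $ i) *\<^sub>R c i) \<le> real CARD('n) * C * norm (v :: real ^ 'n)"
proof -
  have "norm (\<Sum>i\<in>UNIV. (v $ i) *\<^sub>R c i) \<le> (\<Sum>i\<in>(UNIV::'n set). norm v * C)"
    by (intro order_trans[OF norm_sum] sum_mono)
       (auto intro!: mult_mono assms component_le_norm_cart)
  then show ?thesis by (simp add: mult_ac)
qed

text \<open>Mean value inequality on the convex ball. The operator norm of the derivative is
  controlled through the partial derivatives, which are bounded by compactness; this costs the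
  factor \<open>CARD('m)\<close>.\<close>

lemma smooth_locally_lipschitz:
  assumes "smooth (G :: real ^ 'm \<Rightarrow> real ^ 'n)"
  obtains C where "C \<ge> 0"
    "\<And>x y. x \<in> cball 0 R \<Longrightarrow> y \<in> cball 0 R \<Longrightarrow> norm (G x - G y) \<le> C * norm (x - y)"
proof -
  have "\<exists>C. C \<ge> 0 \<and> (\<forall>x\<in>cball 0 R. norm (deriv1 G x (axis i 1)) \<le> C)" for i
  proof -
    obtain C where "C \<ge> 0" "\<And>x. x \<in> cball 0 R \<Longrightarrow> norm (deriv1 G x (axis i 1)) \<le> C"
      using smooth_locally_bounded[OF smooth_deriv1[OF assms], of R "axis i 1"] by blast
    then show ?thesis by blast
  qed
  then have "\<exists>C. \<forall>i. C i \<ge> 0 \<and> (\<forall>x\<in>cball 0 R. norm (deriv1 G x (axis i 1)) \<le> C i)"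
    by (intro choice allI)
  then obtain C where C: "\<And>i. C i \<ge> 0"
    "\<And>i x. x \<in> cball 0 R \<Longrightarrow> norm (deriv1 G x (axis i 1)) \<le> C i"
    by blast
  define C' where "C' = (\<Sum>i\<in>UNIV. C i)"
  have C': "C i \<le> C'" for i unfolding C'_def using C(1) by (intro member_le_sum) auto
  have "C' \<ge> 0" unfolding C'_def using C(1) by (intro sum_nonneg) auto
  show thesis
  proof
    show "real CARD('m) * C' \<ge> 0" using \<open>C' \<ge> 0\<close> by simp
    show "norm (G x - G y) \<le> real CARD('m) * C' * norm (x - y)"
      if "x \<in> cball 0 R" "y \<in> cball 0 R" for x y
    proof (rule differentiable_bound[OF convex_cball _ _ that])
      show "(G has_derivative deriv1 G z) (at z within cball 0 R)" for z
        by (rule has_derivative_at_withinI[OF smooth_has_derivative[OF assms]])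
      show "onorm (deriv1 G z) \<le> real CARD('m) * C'" if "z \<in> cball 0 R" for z
      proof (rule onorm_bound)
        show "real CARD('m) * C' \<ge> 0" using \<open>C' \<ge> 0\<close> by simp
        show "norm (deriv1 G z v) \<le> real CARD('m) * C' * norm v" for v
          unfolding deriv1_eq_sum[OF assms, of z v]
          by (rule norm_sum_scaleR_bound) (rule order_trans[OF C(2)[OF that] C'])
      qed
    qed
  qed
qed

subsection \<open>Families of maps of a given order in a scaling parameter\<close>

text \<open>Size and Lipschitz constant in \<open>x\<close> share the same order in
  \<open>lam p\<close>. Bundling them lets sums, products and Taylor remainders be estimated once
  for single solutions and for differences of solutions.\<close>

definition of_order_by ::
  "real \<Rightarrow> 'p set \<Rightarrow> ('p \<Rightarrow> real) \<Rightarrow> 'a::real_normed_vector set \<Rightarrow> nat \<Rightarrow> ('p \<Rightarrow> 'a \<Rightarrow> 'b::real_normed_vector) \<Rightarrow> bool" where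
  "of_order_by C P lam B k f \<longleftrightarrow> C \<ge> 0 \<and> (\<forall>p\<in>P. \<forall>x\<in>B. norm (f p x) \<le> C * lam p ^ k \<and>
     (\<forall>y\<in>B. norm (f p x - f p y) \<le> C * lam p ^ k * norm (x - y)))"

definition of_order ::
  "'p set \<Rightarrow> ('p \<Rightarrow> real) \<Rightarrow> 'a::real_normed_vector set \<Rightarrow> nat \<Rightarrow> ('p \<Rightarrow> 'a \<Rightarrow> 'b::real_normed_vector) \<Rightarrow> bool" where
  "of_order P lam B k f \<longleftrightarrow> (\<exists>C. of_order_by C P lam B k f)"

lemma of_order_byD:
  assumes "of_order_by C P lam B k f"
  shows "C \<ge> 0" "\<And>p x. p \<in> P \<Longrightarrow> x \<in> B \<Longrightarrow> norm (f p x) \<le> C * lam p ^ k"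
    "\<And>p x y. \<lbrakk>p \<in> P; x \<in> B; y \<in> B\<rbrakk> \<Longrightarrow> norm (f p x - f p y) \<le> C * lam p ^ k * norm (x - y)"
  using assms unfolding of_order_by_def by blast+

lemma of_orderE:
  assumes "of_order P lam B k f"
  obtains C where "of_order_by C P lam B k f"
  using assms unfolding of_order_def by blast

lemma of_orderI:
  assumes "C \<ge> 0" "\<And>p x. p \<in> P \<Longrightarrow> x \<in> B \<Longrightarrow> norm (f p x) \<le> C * lam p ^ k"
    "\<And>p x y. \<lbrakk>p \<in> P; x \<in> B; y \<in> B\<rbrakk> \<Longrightarrow> norm (f p x - f p y) \<le> C * lam p ^ k * norm (x - y)"
  shows "of_order P lam B k f"
  unfolding of_order_def of_order_by_def using assms by blast

lemma of_order_cong: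
  "(\<And>p x. p \<in> P \<Longrightarrow> x \<in> B \<Longrightarrow> f p x = g p x) \<Longrightarrow> of_order P lam B k f \<longleftrightarrow> of_order P lam B k g"
  unfolding of_order_def of_order_by_def by simp

lemma of_order_by_mono:
  assumes "of_order_by C P lam B k f" "C \<le> C'" "\<And>p. p \<in> P \<Longrightarrow> 0 \<le> lam p"
  shows "of_order_by C' P lam B k f"
proof -
  note C = of_order_byD[OF assms(1)]
  have le: "C * lam p ^ k \<le> C' * lam p ^ k" if "p \<in> P" for p
    using assms(2,3) that by (intro mult_right_mono) auto
  show ?thesis
    unfolding of_order_by_def
  proof (intro conjI ballI)
    show "C' \<ge> 0" using C(1) assms(2) by simp
    show "norm (f p x) \<le> C' * lam p ^ k" if "p \<in> P" "x \<in> B" for p x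
      by (rule order_trans[OF C(2)[OF that] le[OF that(1)]])
    show "norm (f p x - f p y) \<le> C' * lam p ^ k * norm (x - y)" if "p \<in> P" "x \<in> B" "y \<in> B" for p x y
      by (rule order_trans[OF C(3)[OF that] mult_right_mono[OF le[OF that(1)] norm_ge_zero]])
  qed
qed

lemma uniform_of_order:
  fixes f :: "'i::finite \<Rightarrow> 'p \<Rightarrow> 'a::real_normed_vector \<Rightarrow> 'b::real_normed_vector"
  assumes "\<And>i. of_order P lam B k (f i)" "\<And>p. p \<in> P \<Longrightarrow> 0 \<le> lam p"
  shows "\<exists>C. \<forall>i. of_order_by C P lam B k (f i)"
proof -
  have "\<forall>i. \<exists>C. of_order_by C P lam B k (f i)" using assms(1) unfolding of_order_def by blast
  from choice[OF this] obtain C where C: "\<And>i. of_order_by (C i) P lam B k (f i)" by blast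
  have "C i \<le> (\<Sum>i\<in>UNIV. C i)" for i using of_order_byD(1)[OF C] by (intro member_le_sum) auto
  then have "of_order_by (\<Sum>i\<in>UNIV. C i) P lam B k (f i)" for i
    by (rule of_order_by_mono[OF C _ assms(2)])
  then show ?thesis by blast
qed

text \<open>The bound 1 on \<open>lam\<close> makes a higher order imply every lower one
  (\<open>OL_mono\<close>); boundedness of \<open>B\<close> keeps shifted points
  \<open>x + h p x\<close> in a compact ball (\<open>OL_smooth_shift\<close>).\<close>

locale scaled_family =
  fixes P :: "'p set" and lam :: "'p \<Rightarrow> real" and B :: "'a::real_normed_vector set" and R :: real
  assumes lam: "p \<in> P \<Longrightarrow> 0 \<le> lam p \<and> lam p \<le> 1" and B: "B \<subseteq> cball 0 R"
begin

abbreviation OL :: "nat \<Rightarrow> ('p \<Rightarrow> 'a \<Rightarrow> 'b::real_normed_vector) \<Rightarrow> bool" where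
  "OL \<equiv> of_order P lam B"

lemma lam_power: "p \<in> P \<Longrightarrow> 0 \<le> lam p ^ k"
  using lam by simp

lemma OL_add:
  assumes "OL k f" "OL k g"
  shows "OL k (\<lambda>p x. f p x + g p x)"
proof -
  obtain C where "of_order_by C P lam B k f"
    by (rule of_orderE[OF assms(1)])
  note C = of_order_byD[OF this]
  obtain D where "of_order_by D P lam B k g"
    by (rule of_orderE[OF assms(2)])
  note D = of_order_byD[OF this]
  show ?thesis
  proof (rule of_orderI)
    show "C + D \<ge> 0" using C D by simp
    show "norm (f p x + g p x) \<le> (C + D) * lam p ^ k" if "p \<in> P" "x \<in> B" for p x
      using C(2)[OF that] D(2)[OF that] norm_triangle_ineq[of "f p x" "g p x"]
      by (simp add: algebra_simps)
    show "norm (f p x + g p x - (f p y + g p y)) \<le> (C + D) * lam p ^ k * norm (x - y)"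
      if "p \<in> P" "x \<in> B" "y \<in> B" for p x y
      using C(3)[OF that] D(3)[OF that] norm_triangle_ineq[of "f p x - f p y" "g p x - g p y"]
      by (simp add: algebra_simps)
  qed
qed

lemma OL_zero: "OL k (\<lambda>p x. 0)"
  by (rule of_orderI[of 0]) auto

lemma OL_sum:
  "finite I \<Longrightarrow> (\<And>i. i \<in> I \<Longrightarrow> OL k (f i)) \<Longrightarrow> OL k (\<lambda>p x. \<Sum>i\<in>I. f i p x)"
  by (induction I rule: finite_induct) (auto intro: OL_add OL_zero)

lemma OL_const:
  assumes "K \<ge> 0" "\<And>p. p \<in> P \<Longrightarrow> norm (c p) \<le> K * lam p ^ k"
  shows "OL k (\<lambda>p x. c p)"
  by (rule of_orderI[of K]) (use assms lam_power in auto)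

lemma OL_mono:
  assumes "j \<le> k" "OL k f"
  shows "OL j f"
proof -
  obtain C where "of_order_by C P lam B k f"
    by (rule of_orderE[OF assms(2)])
  note C = of_order_byD[OF this]
  have le: "C * lam p ^ k \<le> C * lam p ^ j" if "p \<in> P" for p
    using lam[OF that] assms(1) C(1) by (intro mult_left_mono power_decreasing) auto
  show ?thesis
  proof (rule of_orderI[OF C(1)])
    show "norm (f p x) \<le> C * lam p ^ j" if "p \<in> P" "x \<in> B" for p x
      using C(2)[OF that] le[OF that(1)] by simp
    show "norm (f p x - f p y) \<le> C * lam p ^ j * norm (x - y)"
      if "p \<in> P" "x \<in> B" "y \<in> B" for p x y
      using C(3)[OF that] mult_right_mono[OF le[OF that(1)], of "norm (x - y)"] by simp
  qed
qed

text \<open>The factor 2 comes from the two terms of the product rule in the Lipschitz estimate; the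
  size estimate simply tolerates it.\<close>

lemma OL_scaleR:
  assumes "OL j f" "OL k g"
  shows "OL (j + k) (\<lambda>p x. f p x *\<^sub>R g p x)"
proof -
  obtain C where "of_order_by C P lam B j f"
    by (rule of_orderE[OF assms(1)])
  note C = of_order_byD[OF this]
  obtain D where "of_order_by D P lam B k g"
    by (rule of_orderE[OF assms(2)])
  note D = of_order_byD[OF this]
  show ?thesis
  proof (rule of_orderI)
    show "2 * C * D \<ge> 0" using C D by simp
    show "norm (f p x *\<^sub>R g p x) \<le> (2 * C * D) * lam p ^ (j + k)" if "p \<in> P" "x \<in> B" for p x
    proof -
      have "norm (f p x *\<^sub>R g p x) \<le> (C * lam p ^ j) * (D * lam p ^ k)"
        using C(2)[OF that] D(2)[OF that] lam_power[OF that(1)] C(1)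
        by (auto intro!: mult_mono)
      also have "\<dots> \<le> 2 * ((C * lam p ^ j) * (D * lam p ^ k))"
        using C(1) D(1) lam_power[OF that(1)] by simp
      finally show ?thesis by (simp add: power_add algebra_simps)
    qed
    show "norm (f p x *\<^sub>R g p x - f p y *\<^sub>R g p y) \<le> (2 * C * D) * lam p ^ (j + k) * norm (x - y)"
      if "p \<in> P" "x \<in> B" "y \<in> B" for p x y
    proof -
      have "norm (f p x *\<^sub>R g p x - f p y *\<^sub>R g p y) =
          norm (f p x *\<^sub>R (g p x - g p y) + (f p x - f p y) *\<^sub>R g p y)"
        by (simp add: algebra_simps)
      also have "\<dots> \<le> norm (f p x) * norm (g p x - g p y) + norm (f p x - f p y) * norm (g p y)"
        by (rule order_trans[OF norm_triangle_ineq]) simp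
      also have "\<dots> \<le> (C * lam p ^ j) * (D * lam p ^ k * norm (x - y)) +
          (C * lam p ^ j * norm (x - y)) * (D * lam p ^ k)"
        using C(2)[OF that(1,2)] D(2)[OF that(1,3)] C(3)[OF that] D(3)[OF that]
          lam_power[OF that(1)] C(1)
        by (intro add_mono mult_mono) auto
      finally show ?thesis by (simp add: power_add algebra_simps)
    qed
  qed
qed

lemma OL_scaleR_eq: "\<lbrakk>OL j f; OL k g; l = j + k\<rbrakk> \<Longrightarrow> OL l (\<lambda>p x. f p x *\<^sub>R g p x)"
  using OL_scaleR by blast

lemma OL_cmul: "OL k g \<Longrightarrow> OL k (\<lambda>p x. c *\<^sub>R g p x)"
  by (rule OL_scaleR_eq[of 0 "\<lambda>p x. c" k]) (auto intro: OL_const[of "\<bar>c\<bar>"])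

lemma OL_component: "OL k f \<Longrightarrow> OL k (\<lambda>p x. f p x $ i)"
proof -
  assume a: "OL k f"
  obtain C where "of_order_by C P lam B k f"
    by (rule of_orderE[OF a])
  note C = of_order_byD[OF this]
  show ?thesis
  proof (rule of_orderI[OF C(1)])
    show "norm (f p x $ i) \<le> C * lam p ^ k" if "p \<in> P" "x \<in> B" for p x
      using C(2)[OF that] Finite_Cartesian_Product.norm_nth_le order_trans by blast
    show "norm (f p x $ i - f p y $ i) \<le> C * lam p ^ k * norm (x - y)"
      if "p \<in> P" "x \<in> B" "y \<in> B" for p x y
      using C(3)[OF that] Finite_Cartesian_Product.norm_nth_le[of "f p x - f p y" i] by simp
  qed
qed

end

locale scaled_family_vec = scaled_family P lam B R
  for P :: "'p set" and lam :: "'p \<Rightarrow> real" and B :: "(real ^ 'n) set" and R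
begin

text \<open>The shifted points stay in the ball of radius \<open>R + C\<close>, where
  \<open>V\<close> has bound \<open>K\<close> and Lipschitz constant \<open>L\<close>. The map
  \<open>x + h p x\<close> has Lipschitz constant \<open>1 + C\<close>.\<close>

lemma OL_smooth_shift:
  fixes V :: "real ^ 'n \<Rightarrow> real ^ 'm"
  assumes "smooth V" "OL 0 h"
  shows "OL 0 (\<lambda>p x. V (x + h p x))"
proof -
  obtain C where "of_order_by C P lam B 0 h"
    by (rule of_orderE[OF assms(2)])
  note C = of_order_byD[OF this, unfolded power_0 mult_1_right]
  obtain K where K: "K \<ge> 0" "\<And>x. x \<in> cball 0 (R + C) \<Longrightarrow> norm (V x) \<le> K"
    using smooth_locally_bounded[OF assms(1)] by blast
  obtain L where L: "L \<ge> 0" "\<And>x y. x \<in> cball 0 (R + C) \<Longrightarrow> y \<in> cball 0 (R + C) \<Longrightarrow>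
      norm (V x - V y) \<le> L * norm (x - y)"
    using smooth_locally_lipschitz[OF assms(1)] by blast
  have dom: "x + h p x \<in> cball 0 (R + C)" if "p \<in> P" "x \<in> B" for p x
    using C(2)[OF that] B that norm_triangle_ineq[of x "h p x"] by fastforce
  show ?thesis
  proof (rule of_orderI)
    show "K + L * (1 + C) \<ge> 0" using K L C by simp
    show "norm (V (x + h p x)) \<le> (K + L * (1 + C)) * lam p ^ 0" if "p \<in> P" "x \<in> B" for p x
      unfolding power_0 mult_1_right
      using K(2)[OF dom[OF that]] mult_nonneg_nonneg[of L "1 + C"] L(1) C(1) by linarith
    show "norm (V (x + h p x) - V (y + h p y)) \<le> (K + L * (1 + C)) * lam p ^ 0 * norm (x - y)"
      if "p \<in> P" "x \<in> B" "y \<in> B" for p x y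
    proof -
      have "norm (V (x + h p x) - V (y + h p y)) \<le> L * norm ((x + h p x) - (y + h p y))"
        using that by (intro L dom)
      also have "\<dots> \<le> L * (norm (x - y) + C * norm (x - y))"
        using C(3)[OF that] norm_triangle_ineq[of "x - y" "h p x - h p y"] L(1)
        by (intro mult_left_mono) (auto simp: algebra_simps)
      also have "\<dots> \<le> (K + L * (1 + C)) * norm (x - y)"
        using K(1) by (simp add: algebra_simps)
      finally show ?thesis by simp
    qed
  qed
qed

lemma OL_smooth: "smooth (V :: real ^ 'n \<Rightarrow> real ^ 'm) \<Longrightarrow> OL 0 (\<lambda>p. V)"
  using OL_smooth_shift[of V "\<lambda>p x. 0"] OL_zero[of 0] by simp

end

subsection \<open>Taylor expansion\<close>

text \<open>The \<open>k\<close>-th derivative evaluated on \<open>k\<close> copies of one fixed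
  direction.\<close>

primrec dir_deriv :: "nat \<Rightarrow> (real ^ 'm \<Rightarrow> real ^ 'n) \<Rightarrow> real ^ 'm \<Rightarrow> real ^ 'm \<Rightarrow> real ^ 'n" where
  "dir_deriv 0 V v = V"
| "dir_deriv (Suc k) V v = dir_deriv k (\<lambda>x. deriv1 V x v) v"

lemma smooth_dir_deriv: "smooth V \<Longrightarrow> smooth (dir_deriv k V v)"
  by (induction k arbitrary: V) (auto intro: smooth_deriv1)

lemma deriv1_dir_deriv: "smooth V \<Longrightarrow> deriv1 (dir_deriv k V v) x v = dir_deriv (Suc k) V v x"
  by (induction k arbitrary: V) (auto simp: smooth_deriv1)

lemma dir_deriv_sum_scaleR:
  "finite I \<Longrightarrow> (\<And>i. i \<in> I \<Longrightarrow> smooth (V i)) \<Longrightarrow>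
    dir_deriv k (\<lambda>x. \<Sum>i\<in>I. c i *\<^sub>R V i x) v y = (\<Sum>i\<in>I. c i *\<^sub>R dir_deriv k (V i) v y)"
  by (induction k arbitrary: V) (simp_all add: deriv1_sum deriv1_scaleR smooth_scaleR smooth_deriv1)

lemma dir_deriv_Suc_sum:
  assumes "smooth V"
  shows "dir_deriv (Suc k) V v y =
    (\<Sum>i\<in>UNIV. (v $ i) *\<^sub>R dir_deriv k (\<lambda>x. deriv1 V x (axis i 1)) v y)"
proof -
  have "(\<lambda>x. deriv1 V x v) = (\<lambda>x. \<Sum>i\<in>UNIV. (v $ i) *\<^sub>R deriv1 V x (axis i 1))"
    using deriv1_eq_sum[OF assms, of _ v] by blast
  then show ?thesis by (simp add: dir_deriv_sum_scaleR smooth_deriv1 assms)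
qed

text \<open>The integral form of the remainder is chosen because the difference of two remainders is
  the integral of the difference, so a Lipschitz bound of the integrand passes to the
  remainder.\<close>

lemma smooth_taylor:
  assumes "smooth V" "p > 0"
  shows "((\<lambda>\<theta>. ((1 - \<theta>) ^ (p - 1) / fact (p - 1)) *\<^sub>R dir_deriv p V h (x + \<theta> *\<^sub>R h))
     has_integral V (x + h) - (\<Sum>i<p. (1 / fact i) *\<^sub>R dir_deriv i V h x)) {0..1}"
proof -
  have "((\<lambda>\<theta>. dir_deriv m V h (x + \<theta> *\<^sub>R h)) has_vector_derivative
      dir_deriv (Suc m) V h (x + t *\<^sub>R h)) (at t within {0..1})" for m t
  proof -
    have s: "smooth (dir_deriv m V h)" by (rule smooth_dir_deriv[OF assms(1)])
    have "((\<lambda>\<theta>. x + \<theta> *\<^sub>R h) has_derivative (\<lambda>\<theta>. \<theta> *\<^sub>R h)) (at t within {0..1})"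
      by (auto intro!: derivative_eq_intros)
    from has_derivative_compose[OF this smooth_has_derivative[OF s]] show ?thesis
      using linear_cmul[OF smooth_linear[OF s]]
      by (simp add: has_vector_derivative_def deriv1_dir_deriv[OF assms(1)])
  qed
  from Taylor_has_integral[OF assms(2), of "\<lambda>m \<theta>. dir_deriv m V h (x + \<theta> *\<^sub>R h)"
      "\<lambda>\<theta>. V (x + \<theta> *\<^sub>R h)" 0 1] this
  show ?thesis by simp
qed

context scaled_family_vec
begin

text \<open>The integration variable \<theta> of Taylor's formula joins the parameter
  \<open>p\<close>, which makes the constant uniform in \<theta>. Each of the \<open>k\<close>
  differentiations contributes one coordinate of \<open>h\<close>, of order 1.\<close>

lemma OL_dir_deriv:
  fixes V :: "real ^ 'n \<Rightarrow> real ^ 'm"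
  assumes "smooth V" "OL 1 h"
  shows "of_order (P \<times> {0..1::real}) (\<lambda>q. lam (fst q)) B k
    (\<lambda>(p, \<theta>) x. dir_deriv k V (h p x) (x + \<theta> *\<^sub>R h p x))"
proof -
  interpret S: scaled_family_vec "P \<times> {0..1::real}" "\<lambda>q. lam (fst q)" B R
    by unfold_locales (use lam B in auto)
  have h: "S.OL 1 (\<lambda>q x. h (fst q) x)"
    using assms(2) unfolding of_order_def of_order_by_def by fastforce
  have th: "S.OL 0 (\<lambda>q x. snd q)"
    by (rule S.OL_const[of 1]) auto
  have sh: "S.OL 0 (\<lambda>q x. snd q *\<^sub>R h (fst q) x)"
    using S.OL_scaleR[OF th S.OL_mono[OF _ h, of 0]] by simp
  have "S.OL k (\<lambda>q x. dir_deriv k V (h (fst q) x) (x + snd q *\<^sub>R h (fst q) x))"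
    using assms(1)
  proof (induction k arbitrary: V)
    case 0
    then show ?case using S.OL_smooth_shift[OF 0 sh] by simp
  next
    case (Suc k)
    show ?case
      unfolding dir_deriv_Suc_sum[OF Suc.prems]
      by (intro S.OL_sum S.OL_scaleR_eq[OF S.OL_component[OF h] Suc.IH] smooth_deriv1 Suc.prems) auto
  qed
  then show ?thesis by (simp add: case_prod_unfold)
qed

text \<open>The kernel of the integral remainder is at most 1 on the unit interval, so the constant
  of \<open>OL_dir_deriv\<close> is inherited unchanged.\<close>

lemma OL_taylor:
  fixes V :: "real ^ 'n \<Rightarrow> real ^ 'm"
  assumes "smooth V" "OL 1 h" "k > 0"
  shows "OL k (\<lambda>p x. V (x + h p x) - (\<Sum>i<k. (1 / fact i) *\<^sub>R dir_deriv i V (h p x) x))"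
proof -
  obtain C where "of_order_by C (P \<times> {0..1::real}) (\<lambda>q. lam (fst q)) B k
      (\<lambda>(p, \<theta>) x. dir_deriv k V (h p x) (x + \<theta> *\<^sub>R h p x))"
    by (rule of_orderE[OF OL_dir_deriv[OF assms(1,2)]])
  note C = of_order_byD(1)[OF this] of_order_byD(2,3)[OF this SigmaI, unfolded case_prod_conv fst_conv]
  let ?c = "\<lambda>\<theta>::real. (1 - \<theta>) ^ (k - 1) / fact (k - 1)"
  have c: "\<bar>?c \<theta>\<bar> \<le> 1" if "\<theta> \<in> {0..1}" for \<theta>
  proof -
    have "\<bar>(1 - \<theta>) ^ (k - 1)\<bar> \<le> 1" using that by (simp add: power_abs power_le_one)
    moreover have "(1::real) \<le> fact (k - 1)" by (rule fact_ge_1)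
    ultimately have "\<bar>(1 - \<theta>) ^ (k - 1)\<bar> \<le> fact (k - 1)" by (rule order_trans)
    then show ?thesis by (simp add: divide_le_eq)
  qed
  have cb: "norm (?c \<theta> *\<^sub>R z) \<le> D" if "\<theta> \<in> {0..1}" "norm z \<le> D" for \<theta> D and z :: "real ^ 'm"
    using mult_mono[OF c[OF that(1)] that(2)] by simp
  have hb: "norm i \<le> D"
    if "(f has_integral i) {0..1::real}" "0 \<le> D" "\<And>\<theta>. \<theta> \<in> {0..1} \<Longrightarrow> norm (f \<theta>) \<le> D"
    for f and i :: "real ^ 'm" and D
    using has_integral_bound[of D f i 0 1] that by simp
  show ?thesis
  proof (rule of_orderI[OF C(1)])
    show "norm (V (x + h p x) - (\<Sum>i<k. (1 / fact i) *\<^sub>R dir_deriv i V (h p x) x)) \<le> C * lam p ^ k"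
      if "p \<in> P" "x \<in> B" for p x
      using C(1) lam_power[OF that(1)]
      by (intro hb[OF smooth_taylor[OF assms(1,3)]] cb C(2) that) auto
    show "norm (V (x + h p x) - (\<Sum>i<k. (1 / fact i) *\<^sub>R dir_deriv i V (h p x) x) -
       (V (y + h p y) - (\<Sum>i<k. (1 / fact i) *\<^sub>R dir_deriv i V (h p y) y))) \<le> C * lam p ^ k * norm (x - y)"
      if "p \<in> P" "x \<in> B" "y \<in> B" for p x y
    proof (rule hb[OF has_integral_diff[OF smooth_taylor[OF assms(1,3)] smooth_taylor[OF assms(1,3)]]])
      show "0 \<le> C * lam p ^ k * norm (x - y)" using C(1) lam_power[OF that(1)] by simp
    qed (simp only: scaleR_right_diff_distrib[symmetric], intro cb C(3) that)
  qed
qed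

lemma OL_taylor1: "smooth (V :: real ^ 'n \<Rightarrow> real ^ 'm) \<Longrightarrow> OL 1 h \<Longrightarrow> OL 1 (\<lambda>p x. V (x + h p x) - V x)"
  using OL_taylor[of V h 1] by simp

lemma OL_taylor2: "smooth (V :: real ^ 'n \<Rightarrow> real ^ 'm) \<Longrightarrow> OL 1 h \<Longrightarrow>
    OL 2 (\<lambda>p x. V (x + h p x) - V x - deriv1 V x (h p x))"
  using OL_taylor[of V h 2] by (simp add: numeral_2_eq_2 diff_diff_eq)

lemma OL_taylor3: "smooth (V :: real ^ 'n \<Rightarrow> real ^ 'm) \<Longrightarrow> OL 1 h \<Longrightarrow>
    OL 3 (\<lambda>p x. V (x + h p x) - V x - deriv1 V x (h p x) - (1/2) *\<^sub>R deriv2 V x (h p x) (h p x))"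
  using OL_taylor[of V h 3] by (simp add: numeral_3_eq_3 diff_diff_eq deriv2_eq add.assoc)

lemma OL_deriv1:
  assumes "smooth (V :: real ^ 'n \<Rightarrow> real ^ 'm)" "OL k h"
  shows "OL k (\<lambda>p x. deriv1 V x (h p x))"
  unfolding deriv1_eq_sum[OF assms(1), of _ "h _ _"]
  by (intro OL_sum OL_scaleR_eq[OF OL_component[OF assms(2)] OL_smooth] smooth_deriv1 assms) auto

lemma OL_deriv2:
  assumes "smooth (V :: real ^ 'n \<Rightarrow> real ^ 'm)" "OL j h" "OL k g"
  shows "OL (k + j) (\<lambda>p x. deriv2 V x (h p x) (g p x))"
  unfolding deriv2_eq_sum[OF assms(1)]
  by (intro OL_sum OL_scaleR OL_component[OF assms(3)] OL_deriv1 smooth_deriv1 assms) auto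

lemma OL_deriv2_eq:
  "\<lbrakk>smooth (V :: real ^ 'n \<Rightarrow> real ^ 'm); OL j h; OL k g; l = k + j\<rbrakk> \<Longrightarrow>
    OL l (\<lambda>p x. deriv2 V x (h p x) (g p x))"
  using OL_deriv2 by blast

end

text \<open>
  \<open>V (x + e k + e l) - V (x + e k) - V (x + e l) + V x\<close> is symmetric in \<open>k\<close> and \<open>l\<close>, and its
  coefficient of \<open>e\<^sup>2\<close> is the mixed second derivative.
\<close>

lemma deriv2_commute:
  fixes V :: "real ^ 'n \<Rightarrow> real ^ 'm"
  assumes V: "smooth V"
  shows "deriv2 V x k l = deriv2 V x l k"
proof -
  define E where "E k l e = V (x + e *\<^sub>R k + e *\<^sub>R l) - V (x + e *\<^sub>R k) - V (x + e *\<^sub>R l) + V x -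
      e^2 *\<^sub>R deriv2 V x k l" for k l e
  have key: "\<exists>C\<ge>0. \<forall>e\<in>{0..1}. norm (E k l e) \<le> C * e^3" for k l
  proof -
    interpret S: scaled_family_vec "{0..1::real}" "\<lambda>e. e" "cball 0 (norm x + norm k)" "norm x + norm k"
      by unfold_locales auto
    have h: "S.OL 1 (\<lambda>e x. e *\<^sub>R v)" for v :: "real ^ 'n"
      by (rule S.OL_const[of "norm v"]) auto
    let ?r = "\<lambda>e z. V (z + e *\<^sub>R l) - V z - deriv1 V z (e *\<^sub>R l)"
    let ?s = "\<lambda>e z. deriv1 V (z + e *\<^sub>R k) l - deriv1 V z l - deriv1 (\<lambda>x. deriv1 V x l) z (e *\<^sub>R k)"
    obtain C where "of_order_by C {0..1} (\<lambda>e. e) (cball 0 (norm x + norm k)) 2 ?r"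
      by (rule of_orderE[OF S.OL_taylor2[OF V h[of l]]])
    note C = of_order_byD[OF this]
    obtain D where "of_order_by D {0..1} (\<lambda>e. e) (cball 0 (norm x + norm k)) 2 ?s"
      by (rule of_orderE[OF S.OL_taylor2[OF smooth_deriv1[OF V, of l] h[of k]]])
    note D = of_order_byD[OF this]
    have "norm (E k l e) \<le> (C * norm k + D) * e^3" if e: "e \<in> {0..1}" for e
    proof -
      let ?z = "x + e *\<^sub>R k"
      have z: "?z \<in> cball 0 (norm x + norm k)" "x \<in> cball 0 (norm x + norm k)"
        using e norm_triangle_ineq[of x "e *\<^sub>R k"] mult_right_mono[of e 1 "norm k"] by auto
      \<comment> \<open>The Lipschitz constant of the remainder is of order \<open>e^2\<close>, and
        the two base points are at distance \<open>e * norm k\<close>: this yields the third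
        power.\<close>
      have 1: "norm (?r e ?z - ?r e x) \<le> C * norm k * e^3"
        using C(3)[OF e z] e by (simp add: power2_eq_square power3_eq_cube mult_ac)
      have 2: "norm (e *\<^sub>R ?s e x) \<le> D * e^3"
        using mult_left_mono[OF D(2)[OF e z(2)], of e] e by (simp add: power2_eq_square power3_eq_cube mult_ac)
      have eq: "E k l e = (?r e ?z - ?r e x) + e *\<^sub>R ?s e x"
        unfolding E_def deriv2_eq linear_cmul[OF smooth_linear[OF V]]
          linear_cmul[OF smooth_linear[OF smooth_deriv1[OF V]]]
        by (simp add: scaleR_diff_right power2_eq_square)
      show ?thesis unfolding eq distrib_right by (rule norm_triangle_mono[OF 1 2])
    qed
    then show ?thesis using C(1) D(1) by (intro exI[of _ "C * norm k + D"]) auto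
  qed
  obtain C where C: "C \<ge> 0" "\<And>e. e \<in> {0..1} \<Longrightarrow> norm (E k l e) \<le> C * e^3"
    using key[of k l] by blast
  obtain D where D: "D \<ge> 0" "\<And>e. e \<in> {0..1} \<Longrightarrow> norm (E l k e) \<le> D * e^3"
    using key[of l k] by blast
  define w where "w = deriv2 V x k l - deriv2 V x l k"
  have bound: "norm w \<le> (C + D) * e" if "0 < e" "e \<le> 1" for e
  proof -
    have "e^2 * norm w = norm (e^2 *\<^sub>R w)" by simp
    \<comment> \<open>The second difference of \<open>V\<close> is the same in
      \<open>E k l e\<close> and \<open>E l k e\<close> and cancels.\<close>
    also have "e^2 *\<^sub>R w = E l k e - E k l e"
      by (simp add: w_def E_def algebra_simps)
    also have "norm \<dots> \<le> D * e^3 + C * e^3"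
      by (rule order_trans[OF norm_triangle_ineq4 add_mono[OF D(2) C(2)]]) (use that in auto)
    also have "\<dots> = e^2 * ((C + D) * e)"
      by (simp add: power2_eq_square power3_eq_cube algebra_simps)
    finally show ?thesis using that by simp
  qed
  have "w = 0"
  proof (rule ccontr)
    assume "w \<noteq> 0"
    define e where "e = min 1 (norm w / (2 * (C + D + 1)))"
    have e: "0 < e" "e \<le> 1" using \<open>w \<noteq> 0\<close> C(1) D(1) by (auto simp: e_def)
    have "(C + D) * e \<le> (C + D + 1) * (norm w / (2 * (C + D + 1)))"
      using C(1) D(1) e by (intro mult_mono) (auto simp: e_def)
    also have "\<dots> = norm w / 2" using C(1) D(1) by (simp add: field_simps)
    finally have "(C + D) * e \<le> norm w / 2" .
    moreover have "norm w > 0" using \<open>w \<noteq> 0\<close> by simp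
    ultimately show False using bound[OF e] by linarith
  qed
  then show ?thesis by (simp add: w_def)
qed

subsection \<open>The defect of the Davie scheme\<close>

text \<open>The coordinates of the rough path that enter the scheme: \<open>x1\<close> on one
  vertex, \<open>x2\<close> on the tree with two vertices, \<open>x3\<close> on the cherry,
  \<open>x4\<close> on the ladder. The forest of two vertices \<open>x11\<close> comes in through
  Chen's relation for the cherry and is resolved by the shuffle relation.\<close>

locale rough_data =
  fixes T \<alpha> K :: real
    and x1 :: "real \<Rightarrow> real \<Rightarrow> 'd::finite \<Rightarrow> real"
    and x2 x11 :: "real \<Rightarrow> real \<Rightarrow> 'd \<Rightarrow> 'd \<Rightarrow> real"
    and x3 x4 :: "real \<Rightarrow> real \<Rightarrow> 'd \<Rightarrow> 'd \<Rightarrow> 'd \<Rightarrow> real"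
    and F :: "'d \<Rightarrow> real ^ 'n \<Rightarrow> real ^ 'n"
  assumes T: "T \<le> 1" and \<alpha>: "\<alpha> > 0" and K: "K \<ge> 0"
    and bound1: "\<lbrakk>0 \<le> s; s \<le> t; t \<le> T\<rbrakk> \<Longrightarrow> \<bar>x1 s t a\<bar> \<le> K * (t - s) powr \<alpha>"
    and bound2: "\<lbrakk>0 \<le> s; s \<le> t; t \<le> T\<rbrakk> \<Longrightarrow> \<bar>x2 s t a b\<bar> \<le> K * ((t - s) powr \<alpha>) ^ 2"
    and bound3: "\<lbrakk>0 \<le> s; s \<le> t; t \<le> T\<rbrakk> \<Longrightarrow> \<bar>x3 s t a b c\<bar> \<le> K * ((t - s) powr \<alpha>) ^ 3"
    and bound4: "\<lbrakk>0 \<le> s; s \<le> t; t \<le> T\<rbrakk> \<Longrightarrow> \<bar>x4 s t a b c\<bar> \<le> K * ((t - s) powr \<alpha>) ^ 3"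
    and chen1: "\<lbrakk>0 \<le> s; s \<le> u; u \<le> t; t \<le> T\<rbrakk> \<Longrightarrow> x1 s t a = x1 s u a + x1 u t a"
    and chen2: "\<lbrakk>0 \<le> s; s \<le> u; u \<le> t; t \<le> T\<rbrakk> \<Longrightarrow>
      x2 s t a b = x2 s u a b + x2 u t a b + x1 s u b * x1 u t a"
    and chen3: "\<lbrakk>0 \<le> s; s \<le> u; u \<le> t; t \<le> T\<rbrakk> \<Longrightarrow>
      x3 s t a b c = x3 s u a b c + x3 u t a b c + x1 s u b * x2 u t a c + x11 s u b c * x1 u t a"
    and chen4: "\<lbrakk>0 \<le> s; s \<le> u; u \<le> t; t \<le> T\<rbrakk> \<Longrightarrow>
      x4 s t a b c = x4 s u a b c + x4 u t a b c + x2 s u b c * x1 u t a + x1 s u c * x2 u t a b"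
    and shuffle: "\<lbrakk>0 \<le> s; s \<le> t; t \<le> T\<rbrakk> \<Longrightarrow> x11 s t b c + x11 s t c b = x1 s t b * x1 s t c"
    and F: "smooth (F a)"
begin

text \<open>\<open>V2\<close>, \<open>V3\<close> and \<open>V4\<close> are the elementary
  differentials of the two-vertex tree, the cherry and the ladder, with the indices in the order of
  \<open>x2\<close>, \<open>x3\<close> and \<open>x4\<close>.\<close>

definition V2 :: "'d \<Rightarrow> 'd \<Rightarrow> real ^ 'n \<Rightarrow> real ^ 'n" where
  "V2 a b x = deriv1 (F a) x (F b x)"

definition V3 :: "'d \<Rightarrow> 'd \<Rightarrow> 'd \<Rightarrow> real ^ 'n \<Rightarrow> real ^ 'n" where
  "V3 a b c x = deriv2 (F a) x (F b x) (F c x)"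

definition V4 :: "'d \<Rightarrow> 'd \<Rightarrow> 'd \<Rightarrow> real ^ 'n \<Rightarrow> real ^ 'n" where
  "V4 a b c x = deriv1 (F a) x (V2 b c x)"

text \<open>The trees with root \<open>a\<close>. Sorting by root turns \<open>part a\<close> into
  the germ of the rough integral against the component \<open>a\<close> of the driver.\<close>

definition part :: "'d \<Rightarrow> real \<Rightarrow> real \<Rightarrow> real ^ 'n \<Rightarrow> real ^ 'n" where
  "part a s t x = x1 s t a *\<^sub>R F a x + (\<Sum>b\<in>UNIV. x2 s t a b *\<^sub>R V2 a b x) +
     (\<Sum>b\<in>UNIV. \<Sum>c\<in>UNIV. x3 s t a b c *\<^sub>R V3 a b c x) +
     (\<Sum>b\<in>UNIV. \<Sum>c\<in>UNIV. x4 s t a b c *\<^sub>R V4 a b c x)"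

definition davie :: "real \<Rightarrow> real \<Rightarrow> real ^ 'n \<Rightarrow> real ^ 'n" where
  "davie s t x = x + (\<Sum>a\<in>UNIV. part a s t x)"

text \<open>Kept separate for each root, since the integral against each component has to be sewn on
  its own; the sum over \<open>a\<close> is the flow defect of \<open>davie\<close>.\<close>

definition defect :: "'d \<Rightarrow> real \<Rightarrow> real \<Rightarrow> real \<Rightarrow> real ^ 'n \<Rightarrow> real ^ 'n" where
  "defect a s u t x = part a s u x + part a u t (davie s u x) - part a s t x"

lemma smooth_V2: "smooth (V2 a b)"
  unfolding V2_def[abs_def] by (intro smooth_deriv1_field F)

lemma smooth_V3: "smooth (V3 a b c)"
  unfolding V3_def[abs_def] by (intro smooth_deriv2_field F)

lemma smooth_V4: "smooth (V4 a b c)"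
  unfolding V4_def[abs_def] by (intro smooth_deriv1_field F smooth_V2)

lemma V3_commute: "V3 a b c x = V3 a c b x"
  unfolding V3_def by (rule deriv2_commute[OF F])

lemma deriv1_V2: "deriv1 (V2 a b) x (F c x) = V3 a c b x + V4 a b c x"
  unfolding V2_def[abs_def] V3_def V4_def by (simp add: deriv1_deriv1_field[OF F F])

lemma davie_defect: "davie u t (davie s u x) - davie s t x = (\<Sum>a\<in>UNIV. defect a s u t x)"
  unfolding davie_def[of u t] davie_def[of s t] defect_def sum.distrib sum_subtractf
  by (simp add: davie_def[of s u])

definition h1 :: "real \<Rightarrow> real \<Rightarrow> real ^ 'n \<Rightarrow> real ^ 'n" where
  "h1 s u x = (\<Sum>b\<in>UNIV. x1 s u b *\<^sub>R F b x)"

definition h2 :: "real \<Rightarrow> real \<Rightarrow> real ^ 'n \<Rightarrow> real ^ 'n" where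
  "h2 s u x = (\<Sum>b\<in>UNIV. \<Sum>c\<in>UNIV. x2 s u b c *\<^sub>R V2 b c x)"

definition h3 :: "real \<Rightarrow> real \<Rightarrow> real ^ 'n \<Rightarrow> real ^ 'n" where
  "h3 s u x = (\<Sum>a\<in>UNIV. (\<Sum>b\<in>UNIV. \<Sum>c\<in>UNIV. x3 s u a b c *\<^sub>R V3 a b c x) +
     (\<Sum>b\<in>UNIV. \<Sum>c\<in>UNIV. x4 s u a b c *\<^sub>R V4 a b c x))"

lemma davie_eq: "davie s u x = x + (h1 s u x + h2 s u x + h3 s u x)"
  unfolding davie_def part_def h1_def h2_def h3_def by (simp add: sum.distrib algebra_simps)

text \<open>The factor that \<open>x1 u t a\<close> carries in the defect: from
  \<open>F a (davie s u x)\<close> are removed exactly the terms that Chen's relation pairs with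
  \<open>x1 u t a\<close>. They form the second-order expansion, with \<open>x11\<close> in place of
  half the product of increments.\<close>

definition rem1 :: "'d \<Rightarrow> real \<Rightarrow> real \<Rightarrow> real ^ 'n \<Rightarrow> real ^ 'n" where
  "rem1 a s u x = F a (davie s u x) - F a x - (\<Sum>b\<in>UNIV. x1 s u b *\<^sub>R V2 a b x) -
     (\<Sum>b\<in>UNIV. \<Sum>c\<in>UNIV. x2 s u b c *\<^sub>R V4 a b c x) -
     (\<Sum>b\<in>UNIV. \<Sum>c\<in>UNIV. x11 s u b c *\<^sub>R V3 a b c x)"

definition rem2 :: "'d \<Rightarrow> 'd \<Rightarrow> real \<Rightarrow> real \<Rightarrow> real ^ 'n \<Rightarrow> real ^ 'n" where
  "rem2 a b s u x = V2 a b (davie s u x) - V2 a b x - (\<Sum>c\<in>UNIV. x1 s u c *\<^sub>R V3 a c b x) -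
     (\<Sum>c\<in>UNIV. x1 s u c *\<^sub>R V4 a b c x)"

text \<open>Chen's relation cancels everything except what is grouped here by the coefficients over
  \<open>{u..t}\<close>. A coefficient of order j meets a remainder of order 4 - j, which yields the
  total order 4.\<close>

lemma defect_eq:
  assumes st: "0 \<le> s" "s \<le> u" "u \<le> t" "t \<le> T"
  shows "defect a s u t x = x1 u t a *\<^sub>R rem1 a s u x + (\<Sum>b\<in>UNIV. x2 u t a b *\<^sub>R rem2 a b s u x) +
    (\<Sum>b\<in>UNIV. \<Sum>c\<in>UNIV. x3 u t a b c *\<^sub>R (V3 a b c (davie s u x) - V3 a b c x)) +
    (\<Sum>b\<in>UNIV. \<Sum>c\<in>UNIV. x4 u t a b c *\<^sub>R (V4 a b c (davie s u x) - V4 a b c x))"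
proof -
  \<comment> \<open>Chen's relation for the cherry produces \<open>x2 u t a c\<close>, while
    \<open>rem2\<close> stands behind \<open>x2 u t a b\<close>; the summation indices are exchanged
    to match.\<close>
  have sw: "(\<Sum>b\<in>UNIV. \<Sum>c\<in>UNIV. (x1 s u b * x2 u t a c) *\<^sub>R V3 a b c x) =
      (\<Sum>b\<in>UNIV. \<Sum>c\<in>UNIV. (x2 u t a b * x1 s u c) *\<^sub>R V3 a c b x)"
    by (subst sum.swap) (simp add: mult.commute)
  have c3: "(\<Sum>b\<in>UNIV. \<Sum>c\<in>UNIV. x3 s t a b c *\<^sub>R V3 a b c x) =
      (\<Sum>b\<in>UNIV. \<Sum>c\<in>UNIV. x3 s u a b c *\<^sub>R V3 a b c x) + (\<Sum>b\<in>UNIV. \<Sum>c\<in>UNIV. x3 u t a b c *\<^sub>R V3 a b c x) +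
      (\<Sum>b\<in>UNIV. \<Sum>c\<in>UNIV. (x2 u t a b * x1 s u c) *\<^sub>R V3 a c b x) +
      (\<Sum>b\<in>UNIV. \<Sum>c\<in>UNIV. (x1 u t a * x11 s u b c) *\<^sub>R V3 a b c x)"
    unfolding sw[symmetric] by (simp add: chen3[OF st] scaleR_add_left sum.distrib mult.commute)
  have c4: "(\<Sum>b\<in>UNIV. \<Sum>c\<in>UNIV. x4 s t a b c *\<^sub>R V4 a b c x) =
      (\<Sum>b\<in>UNIV. \<Sum>c\<in>UNIV. x4 s u a b c *\<^sub>R V4 a b c x) + (\<Sum>b\<in>UNIV. \<Sum>c\<in>UNIV. x4 u t a b c *\<^sub>R V4 a b c x) +
      (\<Sum>b\<in>UNIV. \<Sum>c\<in>UNIV. (x1 u t a * x2 s u b c) *\<^sub>R V4 a b c x) +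
      (\<Sum>b\<in>UNIV. \<Sum>c\<in>UNIV. (x2 u t a b * x1 s u c) *\<^sub>R V4 a b c x)"
    by (simp add: chen4[OF st] scaleR_add_left sum.distrib mult.commute)
  have c2: "(\<Sum>b\<in>UNIV. x2 s t a b *\<^sub>R V2 a b x) = (\<Sum>b\<in>UNIV. x2 s u a b *\<^sub>R V2 a b x) +
      (\<Sum>b\<in>UNIV. x2 u t a b *\<^sub>R V2 a b x) + (\<Sum>b\<in>UNIV. (x1 u t a * x1 s u b) *\<^sub>R V2 a b x)"
    by (simp add: chen2[OF st] scaleR_add_left sum.distrib mult.commute)
  show ?thesis
    unfolding defect_def part_def rem1_def rem2_def c2 c3 c4 chen1[OF st]
    by (simp add: scaleR_add_left scaleR_diff_right scaleR_add_right sum.distrib sum_subtractf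
        scaleR_sum_right)
qed

definition times :: "(real \<times> real \<times> real) set" where
  "times = {(s, u, t). 0 \<le> s \<and> s \<le> u \<and> u \<le> t \<and> t \<le> T}"

text \<open>The scale is the length of the whole interval, so that it dominates increments over
  \<open>{s..u}\<close> as well as over \<open>{u..t}\<close>.\<close>

definition width :: "real \<times> real \<times> real \<Rightarrow> real" where
  "width = (\<lambda>(s, u, t). (t - s) powr \<alpha>)"

abbreviation su :: "(real \<Rightarrow> real \<Rightarrow> 'z) \<Rightarrow> real \<times> real \<times> real \<Rightarrow> 'z" where
  "su f \<equiv> \<lambda>p. f (fst p) (fst (snd p))"

abbreviation ut :: "(real \<Rightarrow> real \<Rightarrow> 'z) \<Rightarrow> real \<times> real \<times> real \<Rightarrow> 'z" where
  "ut f \<equiv> \<lambda>p. f (fst (snd p)) (snd (snd p))"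

lemma width: "p \<in> times \<Longrightarrow> 0 \<le> width p \<and> width p \<le> 1"
proof (cases p)
  case (fields s u t)
  assume "p \<in> times"
  with fields have "0 \<le> t - s" "t - s \<le> 1" using T by (auto simp: times_def)
  then show ?thesis using powr_mono2[of \<alpha> "t - s" 1] \<alpha> by (simp add: width_def fields)
qed

lemma scaled_times: "scaled_family_vec times width (cball 0 R) R"
  by unfold_locales (use width in auto)

end

text \<open>The radius gets a locale of its own because the later proofs use the estimates on balls
  of several radii at once.\<close>

locale rough_data_ball = rough_data T \<alpha> K x1 x2 x11 x3 x4 F
  for T \<alpha> K x1 x2 x11 x3 x4 and F :: "'d::finite \<Rightarrow> real ^ 'n \<Rightarrow> real ^ 'n" +
  fixes R :: real
begin

sublocale scaled_family_vec times width "cball 0 R" R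
  by (rule scaled_times)

lemma coeff_OL:
  assumes "\<And>s t. \<lbrakk>0 \<le> s; s \<le> t; t \<le> T\<rbrakk> \<Longrightarrow> \<bar>c s t\<bar> \<le> K * ((t - s) powr \<alpha>) ^ k"
  shows "OL k (\<lambda>p x. c (fst p) (fst (snd p)))" "OL k (\<lambda>p x. c (fst (snd p)) (snd (snd p)))"
proof -
  have w: "K * ((t' - s') powr \<alpha>) ^ k \<le> K * ((t - s) powr \<alpha>) ^ k"
    if "s \<le> s'" "s' \<le> t'" "t' \<le> t" for s s' t t'
    using that K \<alpha> by (intro mult_left_mono power_mono powr_mono2) auto
  show "OL k (\<lambda>p x. c (fst p) (fst (snd p)))"
    by (rule OL_const[OF K]) (auto simp: times_def width_def intro!: order_trans[OF assms w])
  show "OL k (\<lambda>p x. c (fst (snd p)) (snd (snd p)))"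
    by (rule OL_const[OF K]) (auto simp: times_def width_def intro!: order_trans[OF assms w])
qed

lemmas OL_x1 = coeff_OL[of "\<lambda>s t. x1 s t a" 1 for a, simplified, OF bound1]
lemmas OL_x2 = coeff_OL[of "\<lambda>s t. x2 s t a b" 2 for a b, OF bound2]
lemmas OL_x3 = coeff_OL[of "\<lambda>s t. x3 s t a b c" 3 for a b c, OF bound3]
lemmas OL_x4 = coeff_OL[of "\<lambda>s t. x4 s t a b c" 3 for a b c, OF bound4]

lemma OL_h1: "OL 1 (su h1)"
  unfolding h1_def[abs_def] by (intro OL_sum OL_scaleR_eq[OF OL_x1(1) OL_smooth[OF F]]) auto

lemma OL_h2: "OL 2 (su h2)"
  unfolding h2_def[abs_def] by (intro OL_sum OL_scaleR_eq[OF OL_x2(1) OL_smooth[OF smooth_V2]]) auto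

lemma OL_h3: "OL 3 (su h3)"
  unfolding h3_def[abs_def]
  by (intro OL_sum OL_add OL_scaleR_eq[OF OL_x3(1) OL_smooth[OF smooth_V3]]
      OL_scaleR_eq[OF OL_x4(1) OL_smooth[OF smooth_V4]]) auto

lemma OL_h23: "OL 2 (\<lambda>p x. su h2 p x + su h3 p x)"
  by (intro OL_add OL_h2 OL_mono[OF _ OL_h3]) simp

lemma OL_h: "OL 1 (\<lambda>p x. su h1 p x + su h2 p x + su h3 p x)"
  using OL_add[OF OL_h1 OL_mono[OF _ OL_h23, of 1]] by (simp add: add.assoc)

lemma deriv1_h1:
  "smooth V \<Longrightarrow> deriv1 V x (h1 s u x) = (\<Sum>b\<in>UNIV. x1 s u b *\<^sub>R deriv1 V x (F b x))"
  unfolding h1_def by (simp add: linear_sum[OF smooth_linear] linear_cmul[OF smooth_linear])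

lemma deriv1_h2:
  "smooth V \<Longrightarrow> deriv1 V x (h2 s u x) = (\<Sum>b\<in>UNIV. \<Sum>c\<in>UNIV. x2 s u b c *\<^sub>R deriv1 V x (V2 b c x))"
  unfolding h2_def by (simp add: linear_sum[OF smooth_linear] linear_cmul[OF smooth_linear])

text \<open>The shuffle relation splits each product of increments into two values of
  \<open>x11\<close>. By symmetry of \<open>V3\<close> in its last two indices both give the same
  sum, which absorbs the Taylor factor 1/2.\<close>

lemma deriv2_h1:
  assumes "0 \<le> s" "s \<le> u" "u \<le> T"
  shows "(1/2) *\<^sub>R deriv2 (F a) x (h1 s u x) (h1 s u x) = (\<Sum>b\<in>UNIV. \<Sum>c\<in>UNIV. x11 s u b c *\<^sub>R V3 a b c x)"
    (is "_ = ?S")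
proof -
  have "deriv2 (F a) x (h1 s u x) (h1 s u x) =
      (\<Sum>c\<in>UNIV. \<Sum>b\<in>UNIV. (x1 s u b * x1 s u c) *\<^sub>R V3 a b c x)"
    unfolding h1_def V3_def
    by (simp add: linear_sum[OF deriv2_linear_left[OF F]] linear_cmul[OF deriv2_linear_left[OF F]]
        linear_sum[OF deriv2_linear_right[OF F]] linear_cmul[OF deriv2_linear_right[OF F]]
        scaleR_sum_right mult.commute)
  also have "\<dots> = (\<Sum>c\<in>UNIV. \<Sum>b\<in>UNIV. x11 s u b c *\<^sub>R V3 a b c x) +
      (\<Sum>c\<in>UNIV. \<Sum>b\<in>UNIV. x11 s u c b *\<^sub>R V3 a b c x)"
    by (simp add: shuffle[OF assms, symmetric] scaleR_add_left sum.distrib)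
  also have "(\<Sum>c\<in>UNIV. \<Sum>b\<in>UNIV. x11 s u b c *\<^sub>R V3 a b c x) = ?S"
    by (rule sum.swap)
  also have "(\<Sum>c\<in>UNIV. \<Sum>b\<in>UNIV. x11 s u c b *\<^sub>R V3 a b c x) = ?S"
    by (subst V3_commute) (rule refl)
  finally show ?thesis by (simp add: scaleR_2[symmetric])
qed

text \<open>With \<open>h = h1 + h2 + h3\<close>, the expansion of \<open>F a (x + h)\<close> to
  second order contributes \<open>deriv1\<close> at \<open>h1 + h2\<close> and half of
  \<open>deriv2\<close> at \<open>(h1, h1)\<close>, which \<open>rem1\<close> subtracts. The Taylor
  remainder, \<open>deriv1\<close> at \<open>h3\<close> and the mixed second derivatives all have
  order 3.\<close>

lemma OL_rem1: "OL 3 (su (rem1 a))"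
proof -
  let ?h1 = "su h1" and ?h2 = "su h2"
    and ?h3 = "su h3"
  let ?h = "\<lambda>p x. ?h1 p x + ?h2 p x + ?h3 p x"
  have "OL 3 (\<lambda>p x. (F a (x + ?h p x) - F a x - deriv1 (F a) x (?h p x) - (1/2) *\<^sub>R deriv2 (F a) x (?h p x) (?h p x)) +
      (deriv1 (F a) x (?h3 p x) + (1/2) *\<^sub>R (deriv2 (F a) x (?h p x) (?h2 p x + ?h3 p x) +
       deriv2 (F a) x (?h2 p x + ?h3 p x) (?h1 p x))))"
    by (intro OL_add[OF OL_taylor3[OF F OL_h]] OL_add[OF OL_deriv1[OF F OL_h3]] OL_cmul
        OL_add[OF OL_deriv2_eq[OF F OL_h OL_h23] OL_deriv2_eq[OF F OL_h23 OL_h1]]) simp_all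
  moreover have "(F a (x + ?h p x) - F a x - deriv1 (F a) x (?h p x) - (1/2) *\<^sub>R deriv2 (F a) x (?h p x) (?h p x)) +
      (deriv1 (F a) x (?h3 p x) + (1/2) *\<^sub>R (deriv2 (F a) x (?h p x) (?h2 p x + ?h3 p x) +
       deriv2 (F a) x (?h2 p x + ?h3 p x) (?h1 p x))) = su (rem1 a) p x"
    if p: "p \<in> times" for p x
  proof -
    have 1: "deriv1 (F a) x (?h p x) = (\<Sum>b\<in>UNIV. su x1 p b *\<^sub>R V2 a b x) +
        (\<Sum>b\<in>UNIV. \<Sum>c\<in>UNIV. su x2 p b c *\<^sub>R V4 a b c x) + deriv1 (F a) x (?h3 p x)"
      by (simp add: linear_add[OF smooth_linear[OF F]] deriv1_h1[OF F] deriv1_h2[OF F] V2_def V4_def)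
    have 2: "deriv2 (F a) x (?h p x) (?h p x) = deriv2 (F a) x (?h1 p x) (?h1 p x) +
        deriv2 (F a) x (?h p x) (?h2 p x + ?h3 p x) + deriv2 (F a) x (?h2 p x + ?h3 p x) (?h1 p x)"
      by (simp add: linear_add[OF deriv2_linear_left[OF F]] linear_add[OF deriv2_linear_right[OF F]])
    have 3: "(1/2) *\<^sub>R deriv2 (F a) x (?h1 p x) (?h1 p x) =
        (\<Sum>b\<in>UNIV. \<Sum>c\<in>UNIV. su x11 p b c *\<^sub>R V3 a b c x)"
      using p by (intro deriv2_h1) (auto simp: times_def)
    show ?thesis
      unfolding rem1_def davie_eq 3[symmetric] 1 2 by (simp add: scaleR_add_right)
  qed
  ultimately show ?thesis
    by (rule iffD1[OF of_order_cong, rotated])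
qed

lemma OL_rem2: "OL 2 (su (rem2 a b))"
proof -
  let ?h1 = "su h1" and ?h2 = "su h2"
    and ?h3 = "su h3"
  let ?h = "\<lambda>p x. ?h1 p x + ?h2 p x + ?h3 p x"
  have "OL 2 (\<lambda>p x. (V2 a b (x + ?h p x) - V2 a b x - deriv1 (V2 a b) x (?h p x)) +
      deriv1 (V2 a b) x (?h2 p x + ?h3 p x))"
    by (intro OL_add OL_taylor2 OL_deriv1 smooth_V2 OL_h OL_h23)
  moreover have "(V2 a b (x + ?h p x) - V2 a b x - deriv1 (V2 a b) x (?h p x)) +
      deriv1 (V2 a b) x (?h2 p x + ?h3 p x) = su (rem2 a b) p x" for p x
    by (simp add: rem2_def davie_eq linear_add[OF smooth_linear[OF smooth_V2]] deriv1_h1[OF smooth_V2]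
        deriv1_V2 scaleR_add_right sum.distrib)
  ultimately show ?thesis
    by (rule iffD1[OF of_order_cong, rotated])
qed

text \<open>Serves the remainders of the lifted path on one-vertex forests, for which order 2 is
  required.\<close>

lemma OL_first_order:
  "OL 2 (\<lambda>p x. F a (su davie p x) - F a x - (\<Sum>b\<in>UNIV. su x1 p b *\<^sub>R V2 a b x))"
proof -
  let ?h1 = "su h1" and ?h2 = "su h2"
    and ?h3 = "su h3"
  let ?h = "\<lambda>p x. ?h1 p x + ?h2 p x + ?h3 p x"
  have "OL 2 (\<lambda>p x. (F a (x + ?h p x) - F a x - deriv1 (F a) x (?h p x)) +
      deriv1 (F a) x (?h2 p x + ?h3 p x))"
    by (intro OL_add OL_taylor2 OL_deriv1 F OL_h OL_h23)
  moreover have "(F a (x + ?h p x) - F a x - deriv1 (F a) x (?h p x)) + deriv1 (F a) x (?h2 p x + ?h3 p x) =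
      F a (su davie p x) - F a x - (\<Sum>b\<in>UNIV. su x1 p b *\<^sub>R V2 a b x)" for p x
    by (simp add: davie_eq linear_add[OF smooth_linear[OF F]] deriv1_h1[OF F] V2_def)
  ultimately show ?thesis
    by (rule iffD1[OF of_order_cong, rotated])
qed

lemma OL_shift_diff: "smooth (V :: real ^ 'n \<Rightarrow> real ^ 'n) \<Longrightarrow> OL 1 (\<lambda>p x. V (su davie p x) - V x)"
  unfolding davie_eq by (intro OL_taylor1 OL_h)

lemma OL_defect: "OL 4 (\<lambda>p. defect a (fst p) (fst (snd p)) (snd (snd p)))"
proof -
  have "OL 4 (\<lambda>p x. ut x1 p a *\<^sub>R su (rem1 a) p x +
    (\<Sum>b\<in>UNIV. ut x2 p a b *\<^sub>R su (rem2 a b) p x) +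
    (\<Sum>b\<in>UNIV. \<Sum>c\<in>UNIV. ut x3 p a b c *\<^sub>R (V3 a b c (su davie p x) - V3 a b c x)) +
    (\<Sum>b\<in>UNIV. \<Sum>c\<in>UNIV. ut x4 p a b c *\<^sub>R (V4 a b c (su davie p x) - V4 a b c x)))"
    by (intro OL_add OL_sum OL_scaleR_eq[OF OL_x1(2) OL_rem1] OL_scaleR_eq[OF OL_x2(2) OL_rem2]
        OL_scaleR_eq[OF OL_x3(2) OL_shift_diff[OF smooth_V3]]
        OL_scaleR_eq[OF OL_x4(2) OL_shift_diff[OF smooth_V4]]) auto
  then show ?thesis
    by (subst of_order_cong) (auto simp: times_def intro!: defect_eq)
qed

lemma OL_part: "OL 1 (su (part a))"
  unfolding part_def[abs_def]
  by (intro OL_add OL_sum OL_scaleR_eq[OF OL_x1(1) OL_smooth[OF F]]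
      OL_mono[OF _ OL_scaleR[OF OL_x2(1) OL_smooth[OF smooth_V2]]]
      OL_mono[OF _ OL_scaleR[OF OL_x3(1) OL_smooth[OF smooth_V3]]]
      OL_mono[OF _ OL_scaleR[OF OL_x4(1) OL_smooth[OF smooth_V4]]]) auto

lemma OL_davie: "OL 1 (\<lambda>p x. su davie p x - x)"
  unfolding davie_def add_diff_cancel_left' by (intro OL_sum OL_part) simp

lemma OL_davie_defect:
  "OL 4 (\<lambda>p x. ut davie p (su davie p x) - davie (fst p) (snd (snd p)) x)"
  unfolding davie_defect by (intro OL_sum OL_defect) simp

end

subsection \<open>Paths driven by an almost flow\<close>

text \<open>Superadditivity of the power: a factor (2/3 h)^(\<theta> - 1) is pulled out and the
  lengths add up. The ratio 2/3 instead of 1/2 leaves room for midpoints rounded to a grid.\<close>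

lemma powr_split_le:
  fixes h1 h2 :: real
  assumes "0 \<le> h1" "0 \<le> h2" "h1 \<le> 2/3 * (h1 + h2)" "h2 \<le> 2/3 * (h1 + h2)" "1 \<le> \<theta>"
  shows "h1 powr \<theta> + h2 powr \<theta> \<le> (2/3) powr (\<theta> - 1) * (h1 + h2) powr \<theta>"
proof -
  let ?h = "h1 + h2"
  have *: "x powr \<theta> = x * x powr (\<theta> - 1)" if "0 \<le> x" for x :: real
    using that powr_add[of x 1 "\<theta> - 1"] by (cases "x = 0") auto
  have "h1 powr \<theta> + h2 powr \<theta> = h1 * h1 powr (\<theta> - 1) + h2 * h2 powr (\<theta> - 1)"
    using assms * by simp
  also have "\<dots> \<le> h1 * (2/3 * ?h) powr (\<theta> - 1) + h2 * (2/3 * ?h) powr (\<theta> - 1)"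
    using assms by (intro add_mono mult_left_mono powr_mono2) auto
  also have "\<dots> = (2/3) powr (\<theta> - 1) * (?h * ?h powr (\<theta> - 1))"
    using assms by (subst (1 2) powr_mult) (auto simp: algebra_simps)
  also have "?h * ?h powr (\<theta> - 1) = ?h powr \<theta>"
    using * assms by simp
  finally show ?thesis .
qed

text \<open>\<open>lip\<close> concerns the displacement, whose Lipschitz constant \<open>L\<close>
  is small, so that \<open>q\<close> can hold. Radius \<open>2 * R\<close> is needed because one
  application of \<mu> may carry a point of the ball of radius \<open>R\<close> a further distance
  \<open>R\<close>. \<open>small\<close> says that a path within the resulting error bound never
  leaves the smaller ball.\<close>

locale almost_flow =
  fixes \<mu> :: "real \<Rightarrow> real \<Rightarrow> 'a::{real_normed_vector, heine_borel, complete_space} \<Rightarrow> 'a"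
    and \<delta> \<theta> \<alpha> R C1 C L :: real and \<xi> :: 'a
  assumes \<delta>: "\<delta> > 0" and \<theta>: "\<theta> > 1" and \<alpha>: "0 < \<alpha>" "\<alpha> \<le> \<theta>"
    and nonneg: "C1 \<ge> 0" "C \<ge> 0" "L \<ge> 0"
    and lip: "\<And>s t x y. \<lbrakk>0 \<le> s; s \<le> t; t \<le> \<delta>; x \<in> cball \<xi> (2 * R); y \<in> cball \<xi> (2 * R)\<rbrakk> \<Longrightarrow>
      norm ((\<mu> s t x - x) - (\<mu> s t y - y)) \<le> L * norm (x - y)"
    and displacement: "\<And>s t x. \<lbrakk>0 \<le> s; s \<le> t; t \<le> \<delta>; x \<in> cball \<xi> (2 * R)\<rbrakk> \<Longrightarrow>
      norm (\<mu> s t x - x) \<le> C1 * (t - s) powr \<alpha>"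
    and almost: "\<And>s u t x. \<lbrakk>0 \<le> s; s \<le> u; u \<le> t; t \<le> \<delta>; x \<in> cball \<xi> R\<rbrakk> \<Longrightarrow>
      norm (\<mu> u t (\<mu> s u x) - \<mu> s t x) \<le> C * (t - s) powr \<theta>"
    and q: "(2/3) powr (\<theta> - 1) + L < 1"
    and small: "C / (1 - ((2/3) powr (\<theta> - 1) + L)) * \<delta> powr \<theta> + C1 * \<delta> powr \<alpha> \<le> R"
begin

text \<open>The fixed point of the recursion for the error constant when an interval is split in
  two.\<close>

definition m :: real where "m = C / (1 - ((2/3) powr (\<theta> - 1) + L))"

lemma m: "m \<ge> 0" "m * ((2/3) powr (\<theta> - 1) + L) + C = m"
  using q nonneg by (auto simp: m_def field_simps)

lemma small1: "C1 * \<delta> powr \<alpha> \<le> R" and small2: "m * \<delta> powr \<theta> + C1 * \<delta> powr \<alpha> \<le> R" and R: "R \<ge> 0"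
proof -
  show "m * \<delta> powr \<theta> + C1 * \<delta> powr \<alpha> \<le> R" using small by (simp add: m_def)
  moreover have "0 \<le> m * \<delta> powr \<theta>" using m(1) by simp
  ultimately show "C1 * \<delta> powr \<alpha> \<le> R" by linarith
  moreover have "0 \<le> C1 * \<delta> powr \<alpha>" using nonneg(1) by simp
  ultimately show "R \<ge> 0" by linarith
qed

lemma stay:
  assumes "0 \<le> s" "s \<le> t" "t \<le> \<delta>" "x \<in> cball \<xi> R"
  shows "\<mu> s t x \<in> cball \<xi> (2 * R)"
proof -
  have "norm (\<mu> s t x - x) \<le> C1 * (t - s) powr \<alpha>"
    using assms R by (intro displacement) auto
  also have "\<dots> \<le> C1 * \<delta> powr \<alpha>"
    using assms nonneg \<alpha> by (intro mult_left_mono powr_mono2) auto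
  finally have "dist x (\<mu> s t x) \<le> R" using small1 by (simp add: dist_norm norm_minus_commute)
  then show ?thesis using assms(4) dist_triangle[of \<xi> "\<mu> s t x" x] by simp
qed

lemma lip': "\<lbrakk>0 \<le> s; s \<le> t; t \<le> \<delta>; x \<in> cball \<xi> (2 * R); y \<in> cball \<xi> (2 * R)\<rbrakk> \<Longrightarrow>
    norm (\<mu> s t x - \<mu> s t y) \<le> (1 + L) * norm (x - y)"
  using lip[of s t x y] norm_triangle_ineq[of "(\<mu> s t x - x) - (\<mu> s t y - y)" "x - y"]
  by (simp add: algebra_simps)

lemma subball: "x \<in> cball \<xi> R \<Longrightarrow> x \<in> cball \<xi> (2 * R)"
  using R by auto

lemma diag: "\<lbrakk>0 \<le> t; t \<le> \<delta>; x \<in> cball \<xi> (2 * R)\<rbrakk> \<Longrightarrow> \<mu> t t x = x"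
  using displacement[of t t x] by simp

primrec euler :: "nat \<Rightarrow> nat \<Rightarrow> 'a" where
  "euler N 0 = \<xi>"
| "euler N (Suc k) = \<mu> (\<delta> * real k / real N) (\<delta> * real (Suc k) / real N) (euler N k)"

text \<open>The pair (i, k) is split at a midpoint l: the pair (l, k) is covered by the inner
  induction on \<open>k - i\<close>, the pair (i, l) by the outer one because l < k. That the point
  with index k lies in the ball is only known afterwards, from the estimate with i = 0.\<close>

lemma euler_bound:
  assumes "k \<le> N" "N > 0"
  shows "euler N k \<in> cball \<xi> R \<and> (\<forall>i\<le>k. norm (euler N k - \<mu> (\<delta> * real i / real N) (\<delta> * real k / real N) (euler N i))
    \<le> m * (\<delta> * real k / real N - \<delta> * real i / real N) powr \<theta>)"
  using assms(1)
proof (induction k rule: less_induct)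
  case (less k)
  define g where "g i = \<delta> * real i / real N" for i
  let ?w = "\<lambda>i j. (g j - g i) powr \<theta>" and ?\<mu> = "\<lambda>i j. \<mu> (g i) (g j)"
  have gmono: "g i \<le> g j" if "i \<le> j" for i j
    using that \<delta> by (auto simp: g_def intro!: divide_right_mono)
  have g0: "0 \<le> g i" for i using \<delta> by (simp add: g_def)
  have g\<delta>: "g i \<le> \<delta>" if "i \<le> N" for i
    using that \<delta> assms(2) by (simp add: g_def field_simps)
  have ball: "euler N j \<in> cball \<xi> R" if "j < k" for j
    using less.IH[of j] less.prems that by auto
  have IH: "norm (euler N j - ?\<mu> i j (euler N i)) \<le> m * ?w i j"
    if "j < k" "i \<le> j" for i j
    using less.IH[of j] less.prems that by (auto simp: g_def)
  have main: "norm (euler N k - ?\<mu> i k (euler N i)) \<le> m * ?w i k" if "i < k" for i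
    using that
  proof (induction "k - i" arbitrary: i rule: less_induct)
    case (less i)
    show ?case
    proof (cases "k = Suc i")
      case True
      have "euler N k = ?\<mu> i k (euler N i)" using True by (simp add: g_def)
      then show ?thesis using m(1) by simp
    next
      case False
      define l where "l = (i + k) div 2"
      have l: "i < l" "l < k" using less.prems False by (auto simp: l_def)
      \<comment> \<open>Integer division gives unequal halves; the ratio 2/3 is attained for
        \<open>k - i = 3\<close>.\<close>
      have l3: "3 * (l - i) \<le> 2 * (k - i)" "3 * (k - l) \<le> 2 * (k - i)"
        using less.prems False by (auto simp: l_def)
      have kN: "k \<le> N" by fact
      define c where "c = \<delta> / real N"
      have scale: "g a - g b = c * real (a - b)" if "b \<le> a" for a b
        using that by (simp add: g_def c_def of_nat_diff diff_divide_distrib right_diff_distrib)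
      have c: "0 \<le> c" using \<delta> by (simp add: c_def)
      have r: "real (l - i) \<le> 2/3 * real (k - i)" "real (k - l) \<le> 2/3 * real (k - i)"
        using l3[unfolded of_nat_le_iff[where 'a = real, symmetric]] by simp_all
      have h: "g l - g i \<le> 2/3 * (g k - g i)" "g k - g l \<le> 2/3 * (g k - g i)"
        using mult_left_mono[OF r(1) c] mult_left_mono[OF r(2) c]
        unfolding scale[OF less_imp_le[OF l(1)]] scale[OF less_imp_le[OF l(2)]]
          scale[OF less_imp_le[OF less_trans[OF l]]]
        by (simp_all only: mult.left_commute)
      have psi: "?w i l + ?w l k \<le> (2/3) powr (\<theta> - 1) * ?w i k"
        using powr_split_le[of "g l - g i" "g k - g l" \<theta>] h gmono l \<theta> by simp
      let ?e = "euler N" and ?z = "?\<mu> i l (euler N i)"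
      have w1: "norm (?e k - ?\<mu> l k (?e l)) \<le> m * ?w l k"
        using l by (intro less.hyps) auto
      have w0: "norm (?e l - ?z) \<le> m * ?w i l"
        using l by (intro IH) auto
      have "norm (?\<mu> l k (?e l) - ?\<mu> l k ?z) \<le> (1 + L) * norm (?e l - ?z)"
        using l kN by (intro lip' g0 gmono g\<delta> subball ball stay) auto
      also have "\<dots> \<le> (1 + L) * (m * ?w i l)"
        using w0 nonneg by (intro mult_left_mono) auto
      \<comment> \<open>Only the part with \<open>L\<close> is enlarged to the whole interval. The
        other part must stay on \<open>{g i..g l}\<close> to profit from
        \<open>powr_split_le\<close>.\<close>
      also have "\<dots> \<le> m * ?w i l + L * (m * ?w i k)"
        using nonneg m(1) l gmono[of i l] gmono[of l k] \<theta>
        by (auto simp: distrib_right intro!: mult_left_mono powr_mono2)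
      finally have w2: "norm (?\<mu> l k (?e l) - ?\<mu> l k ?z) \<le>
          m * ?w i l + L * (m * ?w i k)" .
      have w3: "norm (?\<mu> l k ?z - ?\<mu> i k (?e i)) \<le> C * ?w i k"
        using l kN by (intro almost g0 gmono g\<delta> ball) auto
      have "?e k - ?\<mu> i k (?e i) = (?e k - ?\<mu> l k (?e l)) +
          (?\<mu> l k (?e l) - ?\<mu> l k ?z) + (?\<mu> l k ?z - ?\<mu> i k (?e i))"
        by simp
      also have "norm \<dots> \<le> m * ?w l k +
          (m * ?w i l + L * (m * ?w i k)) + C * ?w i k"
        by (intro norm_triangle_mono w1 w2 w3)
      also have "\<dots> = m * (?w i l + ?w l k) + (m * L + C) * ?w i k"
        by (simp add: algebra_simps)
      also have "\<dots> \<le> m * ((2/3) powr (\<theta> - 1) * ?w i k) + (m * L + C) * ?w i k"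
        using psi m(1) by (intro add_right_mono mult_left_mono)
      also have "\<dots> = (m * ((2/3) powr (\<theta> - 1) + L) + C) * ?w i k"
        by (simp add: algebra_simps)
      finally show ?thesis unfolding m(2) .
    qed
  qed
  have ballk: "euler N k \<in> cball \<xi> R"
  proof (cases "k = 0")
    case True then show ?thesis using R by simp
  next
    case False
    have "norm (euler N k - \<mu> 0 (g k) \<xi>) \<le> m * (g k) powr \<theta>"
      using main[of 0] False by (simp add: g_def)
    also have "\<dots> \<le> m * \<delta> powr \<theta>"
      using g0 g\<delta>[OF less.prems] m(1) \<theta> by (intro mult_left_mono powr_mono2) auto
    finally have 1: "norm (euler N k - \<mu> 0 (g k) \<xi>) \<le> m * \<delta> powr \<theta>" .
    have "norm (\<mu> 0 (g k) \<xi> - \<xi>) \<le> C1 * (g k - 0) powr \<alpha>"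
      using g0 g\<delta>[OF less.prems] R by (intro displacement) auto
    also have "\<dots> \<le> C1 * \<delta> powr \<alpha>"
      using g0 g\<delta>[OF less.prems] nonneg \<alpha> by (intro mult_left_mono powr_mono2) auto
    finally have "norm ((euler N k - \<mu> 0 (g k) \<xi>) + (\<mu> 0 (g k) \<xi> - \<xi>)) \<le> R"
      using 1 small2 norm_triangle_ineq[of "euler N k - \<mu> 0 (g k) \<xi>" "\<mu> 0 (g k) \<xi> - \<xi>"] by linarith
    then show ?thesis by (simp add: dist_norm norm_minus_commute)
  qed
  have "norm (euler N k - ?\<mu> i k (euler N i)) \<le> m * ?w i k" if "i \<le> k" for i
  proof (cases "i = k")
    case True
    then show ?thesis using diag[OF g0 g\<delta>[OF less.prems] subball[OF ballk]] by simp
  next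
    case False
    then show ?thesis using main that by simp
  qed
  then show ?case using ballk by (simp add: g_def)
qed

definition dyadic :: "real set" where
  "dyadic = (\<Union>n. (\<lambda>k. \<delta> * real k / 2 ^ n) ` {..2 ^ n})"

text \<open>Rounding down to the grid gives a value at every time on every level, as the choice of a
  diagonal subsequence requires; a dyadic time is a grid point from some level on.\<close>

definition euler_path :: "nat \<Rightarrow> real \<Rightarrow> 'a" where
  "euler_path n t = euler (2 ^ n) (nat \<lfloor>t * 2 ^ n / \<delta>\<rfloor>)"

lemma dyadic_sub: "dyadic \<subseteq> {0..\<delta>}"
proof
  fix t assume "t \<in> dyadic"
  then obtain n k where "t = \<delta> * real k / 2 ^ n" "k \<le> 2 ^ n" by (auto simp: dyadic_def)
  moreover from this have "real k / 2 ^ n \<le> 1"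
    by simp
  ultimately show "t \<in> {0..\<delta>}" using \<delta> mult_left_mono[of "real k / 2 ^ n" 1 \<delta>] by auto
qed

lemma countable_dyadic: "countable dyadic"
  unfolding dyadic_def by (intro countable_UN countable_image) auto

lemma dyadic_grid:
  assumes "t \<in> dyadic"
  shows "\<exists>n. \<forall>N\<ge>n. \<exists>k\<le>2 ^ N. t = \<delta> * real k / real (2 ^ N) \<and> euler_path N t = euler (2 ^ N) k"
proof -
  obtain n k where nk: "t = \<delta> * real k / 2 ^ n" "k \<le> 2 ^ n"
    using assms by (auto simp: dyadic_def)
  have "k * 2 ^ (N - n) \<le> 2 ^ N \<and> t = \<delta> * real (k * 2 ^ (N - n)) / real (2 ^ N) \<and>
      euler_path N t = euler (2 ^ N) (k * 2 ^ (N - n))" if "n \<le> N" for N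
  proof -
    have p: "(2::nat) ^ N = 2 ^ n * 2 ^ (N - n)" "(2::real) ^ N = 2 ^ n * 2 ^ (N - n)"
      using that by (simp_all flip: power_add)
    have t: "t = \<delta> * real (k * 2 ^ (N - n)) / real (2 ^ N)"
      by (simp add: nk(1) p)
    then have "t * 2 ^ N / \<delta> = real (k * 2 ^ (N - n))" using \<delta> by simp
    then have "nat \<lfloor>t * 2 ^ N / \<delta>\<rfloor> = k * 2 ^ (N - n)" by (metis floor_of_nat nat_int)
    then show ?thesis using t nk(2) by (simp add: euler_path_def p)
  qed
  then show ?thesis by blast
qed

text \<open>The Euler values are bounded and the dyadic times countable, so a diagonal subsequence
  converges at all of them; the estimate passes to the limit because \<open>\<mu> s t\<close> is
  Lipschitz. Different levels are never compared.\<close>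

lemma dyadic_limit:
  obtains y where "y 0 = \<xi>" "\<And>t. t \<in> dyadic \<Longrightarrow> y t \<in> cball \<xi> R"
    "\<And>s t. \<lbrakk>s \<in> dyadic; t \<in> dyadic; s \<le> t\<rbrakk> \<Longrightarrow> norm (y t - \<mu> s t (y s)) \<le> m * (t - s) powr \<theta>"
proof -
  have "norm (euler_path n t) \<le> norm \<xi> + R" if "t \<in> dyadic" for n t
  proof -
    have "0 \<le> t" "t \<le> \<delta>" using that dyadic_sub by auto
    then have "t * 2 ^ n / \<delta> \<le> 2 ^ n" using \<delta> by (simp add: field_simps)
    then have "\<lfloor>t * 2 ^ n / \<delta>\<rfloor> \<le> 2 ^ n" by (simp add: floor_le_iff)
    then have "nat \<lfloor>t * 2 ^ n / \<delta>\<rfloor> \<le> 2 ^ n" by simp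
    then have "euler_path n t \<in> cball \<xi> R" unfolding euler_path_def using euler_bound by auto
    then show ?thesis using norm_triangle_ineq[of \<xi> "euler_path n t - \<xi>"]
      by (simp add: dist_norm norm_minus_commute)
  qed
  then obtain r where r: "strict_mono (r :: nat \<Rightarrow> nat)"
    "\<And>t. t \<in> dyadic \<Longrightarrow> \<exists>l. (\<lambda>n. euler_path (r n) t) \<longlonglongrightarrow> l"
    using function_convergent_subsequence[OF countable_dyadic, of euler_path] by blast
  then obtain y where y: "\<And>t. t \<in> dyadic \<Longrightarrow> (\<lambda>n. euler_path (r n) t) \<longlonglongrightarrow> y t" by metis
  let ?e = "\<lambda>n. euler_path (r n)"
  have ev: "\<forall>\<^sub>F n in sequentially. \<exists>k\<le>2 ^ r n. t = \<delta> * real k / real (2 ^ r n) \<and> ?e n t = euler (2 ^ r n) k"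
    if td: "t \<in> dyadic" for t
  proof -
    obtain n where n: "\<forall>N\<ge>n. \<exists>k\<le>2 ^ N. t = \<delta> * real k / real (2 ^ N) \<and> euler_path N t = euler (2 ^ N) k"
      using dyadic_grid[OF td] by blast
    show ?thesis
      using eventually_ge_at_top[of n] by eventually_elim (meson n order_trans r(1) seq_suble)
  qed
  have ball: "y t \<in> cball \<xi> R" if "t \<in> dyadic" for t
  proof (rule Lim_in_closed_set[OF closed_cball _ _ y[OF that]])
    show "\<forall>\<^sub>F n in sequentially. ?e n t \<in> cball \<xi> R"
      using ev[OF that] by eventually_elim (use euler_bound in force)
  qed simp
  have davie: "norm (y t - \<mu> s t (y s)) \<le> m * (t - s) powr \<theta>"
    if st: "s \<in> dyadic" "t \<in> dyadic" "s \<le> t" for s t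
  proof -
    have in_range: "0 \<le> s" "t \<le> \<delta>" using st dyadic_sub by auto
    have evball: "\<forall>\<^sub>F n in sequentially. ?e n s \<in> cball \<xi> R"
      using ev[OF st(1)] by eventually_elim (use euler_bound in force)
    have "(\<lambda>n. \<mu> s t (?e n s) - \<mu> s t (y s)) \<longlonglongrightarrow> 0"
    proof (rule Lim_null_comparison)
      show "\<forall>\<^sub>F n in sequentially. norm (\<mu> s t (?e n s) - \<mu> s t (y s))
          \<le> (1 + L) * norm (?e n s - y s)"
        using evball by eventually_elim (intro lip' in_range st subball ball)
      show "(\<lambda>n. (1 + L) * norm (?e n s - y s)) \<longlonglongrightarrow> 0"
        using tendsto_mult_right_zero[OF tendsto_norm_zero[OF LIM_zero[OF y[OF st(1)]]]] .
    qed
    then have "(\<lambda>n. \<mu> s t (?e n s)) \<longlonglongrightarrow> \<mu> s t (y s)" by (rule LIM_zero_cancel)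
    with y[OF st(2)] have lim: "(\<lambda>n. norm (?e n t - \<mu> s t (?e n s))) \<longlonglongrightarrow> norm (y t - \<mu> s t (y s))"
      by (intro tendsto_intros)
    have "\<forall>\<^sub>F n in sequentially. norm (?e n t - \<mu> s t (?e n s)) \<le> m * (t - s) powr \<theta>"
      using ev[OF st(1)] ev[OF st(2)]
    proof eventually_elim
      case (elim n)
      then obtain i k where i: "i \<le> 2 ^ r n" "s = \<delta> * real i / real (2 ^ r n)" "?e n s = euler (2 ^ r n) i"
        and k: "k \<le> 2 ^ r n" "t = \<delta> * real k / real (2 ^ r n)" "?e n t = euler (2 ^ r n) k"
        by blast
      have "i \<le> k" using st(3) i(2) k(2) \<delta> by (simp add: divide_le_cancel)
      then show ?case using euler_bound[OF k(1)] i k by simp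
    qed
    then show ?thesis using lim by (intro tendsto_upperbound) auto
  qed
  have zero: "0 \<in> dyadic" unfolding dyadic_def by (auto intro!: image_eqI[of _ _ 0])
  have "euler_path n 0 = \<xi>" for n by (simp add: euler_path_def)
  then have "y 0 = \<xi>" using y[OF zero] by (simp add: LIMSEQ_const_iff)
  then show thesis using that ball davie by blast
qed

text \<open>Restricting the premise to lengths at most 1 lets the dyadic estimate with its two
  exponents \<theta> and \<alpha> be reduced to the smaller one.\<close>

lemma hoelder_uniformly_continuous:
  fixes y :: "real \<Rightarrow> 'b::real_normed_vector"
  assumes "D \<ge> 0" "0 < \<beta>"
    and "\<And>s t. \<lbrakk>s \<in> S; t \<in> S; s \<le> t; t - s \<le> 1\<rbrakk> \<Longrightarrow> norm (y t - y s) \<le> D * (t - s) powr \<beta>"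
  shows "uniformly_continuous_on S y"
  unfolding uniformly_continuous_on_def
proof (intro allI impI)
  fix e :: real assume e: "e > 0"
  define d where "d = min 1 ((e / (D + 1)) powr (1 / \<beta>))"
  have d: "d > 0" "d \<le> 1" using e assms(1) by (auto simp: d_def)
  have *: "norm (y t - y s) < e" if "s \<in> S" "t \<in> S" "s \<le> t" "t - s < d" for s t
  proof -
    have "(t - s) powr \<beta> \<le> ((e / (D + 1)) powr (1 / \<beta>)) powr \<beta>"
      using that assms(2) by (intro powr_mono2) (auto simp: d_def)
    also have "\<dots> = e / (D + 1)" using assms e by (simp add: powr_powr)
    finally have "D * (t - s) powr \<beta> \<le> D * (e / (D + 1))" using assms(1) by (rule mult_left_mono)
    also have "\<dots> < e" using assms(1) e by (simp add: field_simps)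
    finally show ?thesis using assms(3)[of s t] that d by simp
  qed
  show "\<exists>d>0. \<forall>x\<in>S. \<forall>x'\<in>S. dist x' x < d \<longrightarrow> dist (y x') (y x) < e"
  proof (intro exI[of _ d] conjI ballI impI d)
    fix s t assume st: "s \<in> S" "t \<in> S" "dist t s < d"
    show "dist (y t) (y s) < e"
      using st *[of s t] *[of t s] by (cases "s \<le> t") (auto simp: dist_norm norm_minus_commute)
  qed
qed

lemma dyadic_lower:
  assumes "t \<in> {0..\<delta>}"
  obtains r where "\<And>n. r n \<in> dyadic" "\<And>n. r n \<le> t" "\<And>n. t - r n \<le> \<delta> / 2 ^ n"
proof
  define k where "k n = nat \<lfloor>t * 2 ^ n / \<delta>\<rfloor>" for n
  fix n
  have "0 \<le> t * 2 ^ n / \<delta>" "t * 2 ^ n / \<delta> \<le> 2 ^ n" using assms \<delta> by (auto simp: field_simps)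
  then have k: "real (k n) \<le> t * 2 ^ n / \<delta>" "t * 2 ^ n / \<delta> \<le> real (k n) + 1" "real (k n) \<le> 2 ^ n"
    unfolding k_def by linarith+
  from k(3) have "k n \<le> 2 ^ n" by simp
  then show "\<delta> * real (k n) / 2 ^ n \<in> dyadic" by (auto simp: dyadic_def)
  have kt: "\<delta> * real (k n) \<le> t * 2 ^ n" "t * 2 ^ n - \<delta> * real (k n) \<le> \<delta>"
    using k(1,2) \<delta> by (simp_all add: field_simps)
  then show "\<delta> * real (k n) / 2 ^ n \<le> t" by (simp add: divide_le_eq)
  have "t - \<delta> * real (k n) / 2 ^ n = (t * 2 ^ n - \<delta> * real (k n)) / 2 ^ n"
    by (simp add: field_simps)
  also have "\<dots> \<le> \<delta> / 2 ^ n" using kt(2) by (rule divide_right_mono) simp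
  finally show "t - \<delta> * real (k n) / 2 ^ n \<le> \<delta> / 2 ^ n" .
qed

lemma dyadic_reflect: "t \<in> dyadic \<Longrightarrow> \<delta> - t \<in> dyadic"
proof -
  assume "t \<in> dyadic"
  then obtain n k where nk: "t = \<delta> * real k / 2 ^ n" "k \<le> 2 ^ n" by (auto simp: dyadic_def)
  have "\<delta> - t = \<delta> * real (2 ^ n - k) / 2 ^ n"
    using nk by (simp add: of_nat_diff field_simps)
  then show ?thesis unfolding dyadic_def by (intro UN_I[of n] image_eqI[of _ _ "2 ^ n - k"]) auto
qed

lemma dyadic_upper:
  assumes "t \<in> {0..\<delta>}"
  obtains r where "\<And>n. r n \<in> dyadic" "\<And>n. t \<le> r n" "\<And>n. r n - t \<le> \<delta> / 2 ^ n"
proof -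
  obtain r where "\<And>n. r n \<in> dyadic" "\<And>n. r n \<le> \<delta> - t" "\<And>n. \<delta> - t - r n \<le> \<delta> / 2 ^ n"
    using dyadic_lower[of "\<delta> - t"] assms by auto
  then show thesis by (intro that[of "\<lambda>n. \<delta> - r n"] dyadic_reflect) (auto simp: algebra_simps)
qed

lemma mesh_tendsto: "(\<lambda>n. \<delta> / 2 ^ n) \<longlonglongrightarrow> 0"
  by (rule LIMSEQ_divide_realpow_zero) simp

text \<open>\<mu> is not assumed continuous in its times, so the estimate cannot simply be passed to
  the limit. Instead dyadic times \<open>a n\<close> and \<open>b n\<close> inside
  \<open>{s..t}\<close> are inserted; attaching each of the two short end pieces costs one flow
  defect, whence \<open>2 * C\<close>.\<close>

lemma davie_path:
  obtains y where "y 0 = \<xi>" "\<And>t. t \<in> {0..\<delta>} \<Longrightarrow> y t \<in> cball \<xi> R"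
    "\<And>s t. \<lbrakk>0 \<le> s; s \<le> t; t \<le> \<delta>\<rbrakk> \<Longrightarrow>
      norm (y t - \<mu> s t (y s)) \<le> (m + 2 * C) * (t - s) powr \<theta>"
proof -
  obtain y0 where y0: "y0 0 = \<xi>" "\<And>t. t \<in> dyadic \<Longrightarrow> y0 t \<in> cball \<xi> R"
    "\<And>s t. \<lbrakk>s \<in> dyadic; t \<in> dyadic; s \<le> t\<rbrakk> \<Longrightarrow> norm (y0 t - \<mu> s t (y0 s)) \<le> m * (t - s) powr \<theta>"
    using dyadic_limit by blast
  have "uniformly_continuous_on dyadic y0"
  proof (rule hoelder_uniformly_continuous)
    show "m + C1 \<ge> 0" using m(1) nonneg by simp
    fix s t assume st: "s \<in> dyadic" "t \<in> dyadic" "s \<le> t" "t - s \<le> 1"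
    have range: "0 \<le> s" "t \<le> \<delta>" using st dyadic_sub by auto
    have "norm (y0 t - y0 s) \<le> norm (y0 t - \<mu> s t (y0 s)) + norm (\<mu> s t (y0 s) - y0 s)"
      using norm_triangle_ineq[of "y0 t - \<mu> s t (y0 s)" "\<mu> s t (y0 s) - y0 s"] by simp
    also have "\<dots> \<le> m * (t - s) powr \<theta> + C1 * (t - s) powr \<alpha>"
      using st range by (intro add_mono y0 displacement subball) auto
    also have "\<dots> \<le> m * (t - s) powr \<alpha> + C1 * (t - s) powr \<alpha>"
      using st m(1) \<alpha> by (intro add_right_mono mult_left_mono powr_mono') auto
    finally show "norm (y0 t - y0 s) \<le> (m + C1) * (t - s) powr \<alpha>" by (simp add: algebra_simps)
  qed (rule \<alpha>(1))
  then obtain y where uc: "uniformly_continuous_on (closure dyadic) y" and yy0: "\<And>t. t \<in> dyadic \<Longrightarrow> y0 t = y t"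
    by (rule uniformly_continuous_on_extension_on_closure) blast
  have approx: "t \<in> closure dyadic" "(\<lambda>n. y (r n)) \<longlonglongrightarrow> y t"
    if r: "\<And>n. r n \<in> dyadic" "\<And>n. r n \<le> t \<and> t - r n \<le> \<delta> / 2 ^ n \<or> t \<le> r n \<and> r n - t \<le> \<delta> / 2 ^ n" for t r
  proof -
    have "(\<lambda>n. r n - t) \<longlonglongrightarrow> 0"
    proof (rule Lim_null_comparison[OF always_eventually mesh_tendsto], rule allI)
      show "norm (r n - t) \<le> \<delta> / 2 ^ n" for n using r(2)[of n] by auto
    qed
    then have lim: "r \<longlonglongrightarrow> t" by (rule LIM_zero_cancel)
    then show t: "t \<in> closure dyadic" using r(1) closure_sequential by blast
    have "r n \<in> closure dyadic" for n using r(1) closure_subset by blast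
    with t lim show "(\<lambda>n. y (r n)) \<longlonglongrightarrow> y t"
      by (intro continuous_on_tendsto_compose[OF uniformly_continuous_imp_continuous[OF uc]]) auto
  qed
  have ball: "y t \<in> cball \<xi> R" if t: "t \<in> {0..\<delta>}" for t
  proof -
    obtain r where r: "\<And>n. r n \<in> dyadic" "\<And>n. r n \<le> t" "\<And>n. t - r n \<le> \<delta> / 2 ^ n"
      using dyadic_lower[OF t] by blast
    have "(\<lambda>n. y (r n)) \<longlonglongrightarrow> y t" using r by (intro approx) simp_all
    then show ?thesis
      using y0(2) r(1) yy0 by (intro Lim_in_closed_set[OF closed_cball]) auto
  qed
  show thesis
  proof (rule that[of y])
    have "0 \<in> dyadic" unfolding dyadic_def by (auto intro!: image_eqI[of _ _ 0])
    then show "y 0 = \<xi>" using y0(1) yy0 by metis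
    show "y t \<in> cball \<xi> R" if "t \<in> {0..\<delta>}" for t by (rule ball[OF that])
    fix s t assume st: "0 \<le> s" "s \<le> t" "t \<le> \<delta>"
    show "norm (y t - \<mu> s t (y s)) \<le> (m + 2 * C) * (t - s) powr \<theta>"
    proof (cases "s = t")
      case True
      then show ?thesis using diag[of t "y t"] subball[OF ball[of t]] st m(1) nonneg by simp
    next
      case False
      obtain a where a: "\<And>n. a n \<in> dyadic" "\<And>n. s \<le> a n" "\<And>n. a n - s \<le> \<delta> / 2 ^ n"
        using dyadic_upper[of s] st by auto
      obtain b where b: "\<And>n. b n \<in> dyadic" "\<And>n. b n \<le> t" "\<And>n. t - b n \<le> \<delta> / 2 ^ n"
        using dyadic_lower[of t] st by auto
      have ya: "(\<lambda>n. y (a n)) \<longlonglongrightarrow> y s"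
        using a by (intro approx) simp_all
      have yb: "(\<lambda>n. y (b n)) \<longlonglongrightarrow> y t"
        using b by (intro approx) simp_all
      have alg: "p + m * w + e + C * w + c + C * w = (m + 2 * C) * w + (c + e + p)" for p w e c
        by (simp add: algebra_simps)
      let ?v = "(t - s) powr \<theta>" and ?h = "\<lambda>n. (\<delta> / 2 ^ n) powr \<alpha>" and ?z = "\<lambda>n. \<mu> s (b n) (y s)"
      define err where "err n = C1 * ?h n + (1 + L) * (C1 * ?h n + norm (y (a n) - y s)) +
        norm (y (b n) - y t)" for n
      have mesh\<alpha>: "(\<lambda>n. ?h n) \<longlonglongrightarrow> 0"
        using \<delta> \<alpha> by (intro tendsto_zero_powrI[OF mesh_tendsto tendsto_const]) auto
      have "err \<longlonglongrightarrow> C1 * 0 + (1 + L) * (C1 * 0 + norm (y s - y s)) + norm (y t - y t)"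
        unfolding err_def[abs_def] by (intro tendsto_intros mesh\<alpha> ya yb)
      then have err0: "(\<lambda>n. (m + 2 * C) * ?v + err n) \<longlonglongrightarrow> (m + 2 * C) * ?v + 0"
        by (intro tendsto_intros) simp
      \<comment> \<open>End pieces shorter than half the interval guarantee
        \<open>a n \<le> b n\<close>.\<close>
      have "\<forall>\<^sub>F n in sequentially. \<delta> / 2 ^ n < (t - s) / 2"
        using st False by (intro order_tendstoD(2)[OF mesh_tendsto]) auto
      then have "\<forall>\<^sub>F n in sequentially. norm (y t - \<mu> s t (y s)) \<le> (m + 2 * C) * ?v + err n"
      proof eventually_elim
        case (elim n)
        have "a' \<le> b'" if "a' - s \<le> e" "t - b' \<le> e" "e < (t - s) / 2" for a' b' e
          using that by argo
        from this[OF a(3) b(3) elim] have ab: "a n \<le> b n" .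
        have range: "0 \<le> a n" "b n \<le> \<delta>" "a n \<le> t" "s \<le> b n" "0 \<le> b n"
          using a(2)[of n] b(2)[of n] ab st by linarith+
        have bs: "y s \<in> cball \<xi> R" and ba: "y (a n) \<in> cball \<xi> R"
          using st range a(2)[of n] ab by (simp_all del: mem_cball add: ball)
        let ?\<mu> = "\<mu> (a n) (b n)" and ?x = "\<mu> s (a n) (y s)"
          and ?y = "y (a n)" and ?y' = "y (b n)" and ?q = "\<mu> (b n) t (?z n)"
        have x: "?x \<in> cball \<xi> (2 * R)" using st range a(2)[of n] bs ab by (intro stay) auto
        have 1: "norm (?q - \<mu> s t (y s)) \<le> C * ?v"
          using st range b(2)[of n] bs by (intro almost) auto
        have "norm (?q - ?z n) \<le> C1 * (t - b n) powr \<alpha>"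
          using st range b(2)[of n] bs by (intro displacement stay) auto
        also have "\<dots> \<le> C1 * ?h n"
          using nonneg \<alpha> b(2,3)[of n] by (intro mult_left_mono powr_mono2) auto
        finally have 2: "norm (?z n - ?q) \<le> C1 * ?h n"
          by (simp add: norm_minus_commute)
        have "norm (?\<mu> ?x - ?z n) \<le> C * (b n - s) powr \<theta>"
          using st range a(2)[of n] ab bs by (intro almost) auto
        also have "\<dots> \<le> C * ?v"
          using nonneg \<theta> range b(2)[of n] by (intro mult_left_mono powr_mono2) auto
        finally have 3: "norm (?\<mu> ?x - ?z n) \<le> C * ?v" .
        have "norm (?x - y s) \<le> C1 * (a n - s) powr \<alpha>"
          using st range a(2)[of n] ab bs by (intro displacement subball) auto
        also have "\<dots> \<le> C1 * ?h n"
          using nonneg \<alpha> a(2,3)[of n] by (intro mult_left_mono powr_mono2) auto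
        finally have "norm (?y - ?x) \<le> C1 * ?h n + norm (?y - y s)"
          using norm_triangle_ineq4[of "?y - y s" "?x - y s"] by simp
        then have "(1 + L) * norm (?y - ?x) \<le> (1 + L) * (C1 * ?h n + norm (?y - y s))"
          using nonneg by (intro mult_left_mono) auto
        then have 4: "norm (?\<mu> ?y - ?\<mu> ?x) \<le> (1 + L) * (C1 * ?h n + norm (?y - y s))"
          using lip'[OF range(1) ab range(2) subball[OF ba] x] by linarith
        have "norm (?y' - ?\<mu> ?y) \<le> m * (b n - a n) powr \<theta>"
          using y0(3)[OF a(1)[of n] b(1)[of n] ab] by (simp add: yy0 a(1) b(1))
        also have "\<dots> \<le> m * ?v"
          using m(1) \<theta> ab b(2)[of n] a(2)[of n] by (intro mult_left_mono powr_mono2) auto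
        finally have 5: "norm (?y' - ?\<mu> ?y) \<le> m * ?v" .
        have 0: "norm (y t - ?y') \<le> norm (?y' - y t)"
          by (simp add: norm_minus_commute)
        \<comment> \<open>The first, third and fifth differences tend to 0 and make up
          \<open>err\<close>; the second is the dyadic estimate, the fourth and the last are flow
          defects.\<close>
        have eq: "y t - \<mu> s t (y s) = (y t - ?y') + (?y' - ?\<mu> ?y) +
            (?\<mu> ?y - ?\<mu> ?x) + (?\<mu> ?x - ?z n) +
            (?z n - ?q) + (?q - \<mu> s t (y s))"
          by simp
        have "norm (y t - \<mu> s t (y s)) \<le> norm (?y' - y t) + m * ?v +
            (1 + L) * (C1 * ?h n + norm (?y - y s)) + C * ?v +
            C1 * ?h n + C * ?v"
          unfolding eq
          by (rule norm_triangle_mono[OF norm_triangle_mono[OF norm_triangle_mono[OF norm_triangle_mono[OF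
                norm_triangle_mono[OF 0 5] 4] 3] 2] 1])
        then show ?case unfolding err_def alg .
      qed
      from tendsto_lowerbound[OF err0[unfolded add_0_right] this trivial_limit_sequentially]
      show ?thesis .
    qed
  qed
qed

end

subsection \<open>Sewing\<close>

text \<open>Translations by the germ form an almost flow whose defect is the additivity defect of
  the germ. A path driven by it is the desired primitive.\<close>

lemma sewing:
  fixes \<Xi> :: "real \<Rightarrow> real \<Rightarrow> 'a::{real_normed_vector, heine_borel, complete_space}"
  assumes "\<delta> > 0" "\<theta> > 1" "0 < \<alpha>" "\<alpha> \<le> \<theta>" "C1 \<ge> 0" "C \<ge> 0"
    and "\<And>s t. \<lbrakk>0 \<le> s; s \<le> t; t \<le> \<delta>\<rbrakk> \<Longrightarrow> norm (\<Xi> s t) \<le> C1 * (t - s) powr \<alpha>"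
    and "\<And>s u t. \<lbrakk>0 \<le> s; s \<le> u; u \<le> t; t \<le> \<delta>\<rbrakk> \<Longrightarrow> norm (\<Xi> s u + \<Xi> u t - \<Xi> s t) \<le> C * (t - s) powr \<theta>"
  obtains I D where "D \<ge> 0"
    "\<And>s t. \<lbrakk>0 \<le> s; s \<le> t; t \<le> \<delta>\<rbrakk> \<Longrightarrow> norm (I t - I s - \<Xi> s t) \<le> D * (t - s) powr \<theta>"
proof -
  have q: "(2/3::real) powr (\<theta> - 1) < 1"
    using assms(2) powr_less_mono2[of "\<theta> - 1" "2/3" 1] by simp
  \<comment> \<open>The displacement does not depend on the point, so \<open>L = 0\<close> and any
    radius is admissible; it is chosen so that \<open>small\<close> holds with equality.\<close>
  interpret almost_flow "\<lambda>s t x. x + \<Xi> s t" \<delta> \<theta> \<alpha>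
    "C / (1 - (2/3) powr (\<theta> - 1)) * \<delta> powr \<theta> + C1 * \<delta> powr \<alpha>" C1 C 0 0
  proof (unfold_locales, goal_cases)
    case (9 s t x)
    then show ?case using assms(7)[of s t] by simp
  next
    case (10 s u t x)
    have "x + \<Xi> s u + \<Xi> u t - (x + \<Xi> s t) = \<Xi> s u + \<Xi> u t - \<Xi> s t" by simp
    then show ?case using assms(8)[of s u t] 10 by simp
  qed (use assms(1-6) q in simp_all)
  show thesis
  proof (rule davie_path)
    fix y
    assume y: "\<And>s t. \<lbrakk>0 \<le> s; s \<le> t; t \<le> \<delta>\<rbrakk> \<Longrightarrow>
      norm (y t - (y s + \<Xi> s t)) \<le> (m + 2 * C) * (t - s) powr \<theta>"
    show thesis
    proof (rule that)
      show "m + 2 * C \<ge> 0" using m(1) assms(6) by simp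
      show "norm (y t - y s - \<Xi> s t) \<le> (m + 2 * C) * (t - s) powr \<theta>"
        if "0 \<le> s" "s \<le> t" "t \<le> \<delta>" for s t
        using y[OF that] by (simp add: diff_diff_eq)
    qed
  qed
qed

lemma division_real_interval:
  assumes "\<pi> division_of {0..t::real}" "K \<in> \<pi>"
  shows "0 \<le> Inf K" "Inf K \<le> Sup K" "Sup K \<le> t" "K = {Inf K..Sup K}"
proof -
  obtain a b where K: "K = cbox a b" "K \<noteq> {}" "K \<subseteq> {0..t}"
    using division_ofD[OF assms(1)] assms(2) by metis
  then have "a \<le> b" by auto
  with K show "0 \<le> Inf K" "Inf K \<le> Sup K" "Sup K \<le> t" "K = {Inf K..Sup K}" by auto
qed

text \<open>A division has no tags; taking the left end points as tags makes
  \<open>additive_tagged_division_1\<close> applicable.\<close>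

lemma division_telescope:
  fixes I :: "real \<Rightarrow> 'a::real_normed_vector"
  assumes "\<pi> division_of {0..t}" "0 \<le> t"
  shows "(\<Sum>K\<in>\<pi>. I (Sup K) - I (Inf K)) = I t - I 0"
proof -
  let ?p = "(\<lambda>K. (Inf K, K)) ` \<pi>"
  have p: "?p tagged_division_of {0..t}"
  proof (rule tagged_division_ofI)
    show "finite ?p" using division_of_finite[OF assms(1)] by simp
    show "\<exists>a b. K = cbox a b" "x \<in> K" "K \<subseteq> {0..t}" if "(x, K) \<in> ?p" for x K
      using that division_real_interval[OF assms(1), of K] division_ofD(2,4)[OF assms(1), of K]
      by (auto simp: box_real)
    show "interior K1 \<inter> interior K2 = {}"
      if "(x1, K1) \<in> ?p" "(x2, K2) \<in> ?p" "(x1, K1) \<noteq> (x2, K2)" for x1 K1 x2 K2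
      using that division_ofD(5)[OF assms(1), of K1 K2] by auto
    show "\<Union>{K. \<exists>x. (x, K) \<in> ?p} = {0..t}"
    proof -
      have "{K. \<exists>x. (x, K) \<in> ?p} = \<pi>" by auto
      then show ?thesis using division_ofD(6)[OF assms(1)] by simp
    qed
  qed
  have "(\<Sum>(x, K)\<in>?p. I (Sup K) - I (Inf K)) = I t - I 0"
    by (rule additive_tagged_division_1[OF assms(2) p])
  then show ?thesis by (subst (asm) sum.reindex) (auto simp: inj_on_def)
qed

lemma eventually_partitions_mesh:
  "eventually P (partitions_mesh t) \<longleftrightarrow>
    (\<exists>\<eta>>0. \<forall>\<pi>. \<pi> division_of {0..t} \<and> (\<forall>K\<in>\<pi>. Sup K - Inf K < \<eta>) \<longrightarrow> P \<pi>)"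
proof -
  have "eventually P (partitions_mesh t) \<longleftrightarrow>
      (\<exists>\<eta>\<in>{0<..}. eventually P (principal {\<pi>. \<pi> division_of {0..t} \<and> (\<forall>K\<in>\<pi>. Sup K - Inf K < \<eta>)}))"
    unfolding partitions_mesh_def
  proof (rule eventually_INF_base)
    show "{0<..} \<noteq> ({} :: real set)" by auto
    show "\<exists>x\<in>{0<..}. principal {\<pi>. \<pi> division_of {0..t} \<and> (\<forall>K\<in>\<pi>. Sup K - Inf K < x)}
        \<le> inf (principal {\<pi>. \<pi> division_of {0..t} \<and> (\<forall>K\<in>\<pi>. Sup K - Inf K < a)})
            (principal {\<pi>. \<pi> division_of {0..t} \<and> (\<forall>K\<in>\<pi>. Sup K - Inf K < b)})"
      if "a \<in> {0<..}" "b \<in> {0<..}" for a b :: real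
      using that by (intro bexI[of _ "min a b"]) auto
  qed
  then show ?thesis by (auto simp: eventually_principal)
qed

text \<open>Cousin's lemma with balls of radius \<open>\<eta> / 2\<close> yields a division of mesh
  below \<open>\<eta>\<close>. This is what makes limits along the filter unique, hence
  \<open>rough_integral\<close> meaningful.\<close>

lemma partitions_mesh_nontrivial:
  assumes "0 \<le> t"
  shows "partitions_mesh t \<noteq> bot"
proof
  assume "partitions_mesh t = bot"
  then have "eventually (\<lambda>\<pi>. False) (partitions_mesh t)" by simp
  then obtain \<eta> where \<eta>: "\<eta> > 0" "\<And>\<pi>. \<pi> division_of {0..t} \<Longrightarrow> \<exists>K\<in>\<pi>. \<not> Sup K - Inf K < \<eta>"
    unfolding eventually_partitions_mesh by blast
  have "gauge (\<lambda>x::real. ball x (\<eta> / 2))" using \<eta>(1) by (simp add: gauge_ball)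
  then obtain p where p: "p tagged_division_of {0..t}" "(\<lambda>x. ball x (\<eta> / 2)) fine p"
    using fine_division_exists_real by blast
  note d = division_of_tagged_division[OF p(1)]
  obtain K where K: "K \<in> snd ` p" "\<not> Sup K - Inf K < \<eta>" using \<eta>(2)[OF d] by blast
  then obtain x where "(x, K) \<in> p" by auto
  then have sub: "K \<subseteq> ball x (\<eta> / 2)" using p(2) by (auto simp: fine_def)
  have "Inf K \<in> K" "Sup K \<in> K" using division_real_interval[OF d K(1)] by (metis atLeastAtMost_iff order_refl)+
  then have "dist (Inf K) x < \<eta> / 2" "dist x (Sup K) < \<eta> / 2" using sub by (auto simp: dist_commute)
  then have "dist (Inf K) (Sup K) < \<eta>" using dist_triangle[of "Inf K" "Sup K" x] by linarith
  then show False using K(2) by (simp add: dist_real_def)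
qed

text \<open>Summing C h^\<theta> over the intervals gives at most C \<tau> times the (\<theta> -
  1)-th power of the mesh. For the zero germ the lemma shows that a path with increments of order
  above 1 is constant.\<close>

lemma mesh_limit:
  fixes I :: "real \<Rightarrow> 'a::real_normed_vector"
  assumes "0 \<le> \<tau>" "\<theta> > 1" "C \<ge> 0"
    and "\<And>s t. \<lbrakk>0 \<le> s; s \<le> t; t \<le> \<tau>\<rbrakk> \<Longrightarrow> norm (I t - I s - \<Xi> s t) \<le> C * (t - s) powr \<theta>"
  shows "((\<lambda>\<pi>. \<Sum>K\<in>\<pi>. \<Xi> (Inf K) (Sup K)) \<longlongrightarrow> I \<tau> - I 0) (partitions_mesh \<tau>)"
proof (rule tendstoI)
  fix e :: real assume e: "e > 0"
  \<comment> \<open>Chosen so that \<open>\<eta> powr (\<theta> - 1)\<close> is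
    \<open>e / (C * \<tau> + 1)\<close>; the summand 1 makes the final inequality strict and the
    denominator positive.\<close>
  define \<eta> where "\<eta> = (e / (C * \<tau> + 1)) powr (1 / (\<theta> - 1))"
  have C\<tau>: "0 \<le> C * \<tau>" using assms by simp
  have \<eta>: "\<eta> > 0" using e C\<tau> by (auto simp: \<eta>_def)
  have "dist (\<Sum>K\<in>\<pi>. \<Xi> (Inf K) (Sup K)) (I \<tau> - I 0) < e"
    if d: "\<pi> division_of {0..\<tau>}" and mesh: "\<forall>K\<in>\<pi>. Sup K - Inf K < \<eta>" for \<pi>
  proof -
    let ?d = "\<lambda>K. I (Sup K) - I (Inf K) - \<Xi> (Inf K) (Sup K)" and ?e = "e / (C * \<tau> + 1)"
    note iv = division_real_interval[OF d]
    have "I \<tau> - I 0 - (\<Sum>K\<in>\<pi>. \<Xi> (Inf K) (Sup K)) = (\<Sum>K\<in>\<pi>. ?d K)"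
      using division_telescope[OF d assms(1), of I] by (simp add: sum_subtractf)
    then have "norm (I \<tau> - I 0 - (\<Sum>K\<in>\<pi>. \<Xi> (Inf K) (Sup K))) \<le> (\<Sum>K\<in>\<pi>. norm (?d K))"
      by (simp add: norm_sum)
    also have "\<dots> \<le> (\<Sum>K\<in>\<pi>. C * (?e) * (Sup K - Inf K))"
    proof (rule sum_mono)
      fix K assume K: "K \<in> \<pi>"
      let ?h = "Sup K - Inf K"
      have h: "0 \<le> ?h" "?h \<le> \<eta>" using iv[OF K] mesh K by auto
      have "?h powr (\<theta> - 1) \<le> \<eta> powr (\<theta> - 1)" using h assms by (intro powr_mono2) auto
      also have "\<dots> = ?e" using assms(2) e C\<tau> by (simp add: \<eta>_def powr_powr)
      finally have le: "?h powr (\<theta> - 1) \<le> ?e" .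
      have "norm (?d K) \<le> C * ?h powr \<theta>"
        using iv[OF K] by (intro assms(4)) auto
      also have "?h powr \<theta> = ?h powr (\<theta> - 1) * ?h"
        using h powr_add[of ?h "\<theta> - 1" 1] by (cases "?h = 0") auto
      also have "C * (?h powr (\<theta> - 1) * ?h) \<le> C * (?e * ?h)"
        using le h assms(3) by (intro mult_left_mono mult_right_mono) auto
      finally show "norm (?d K) \<le> C * (?e) * (Sup K - Inf K)"
        by (simp add: mult_ac)
    qed
    also have "\<dots> = C * (?e) * \<tau>"
      unfolding sum_distrib_left[symmetric] division_telescope[OF d assms(1), of "\<lambda>x. x"] by simp
    also have "\<dots> = C * \<tau> * e / (C * \<tau> + 1)" by simp
    also have "\<dots> < e" using e C\<tau> by (simp add: field_simps)
    finally show ?thesis by (simp add: dist_norm norm_minus_commute)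
  qed
  then show "\<forall>\<^sub>F \<pi> in partitions_mesh \<tau>. dist (\<Sum>K\<in>\<pi>. \<Xi> (Inf K) (Sup K)) (I \<tau> - I 0) < e"
    unfolding eventually_partitions_mesh using \<eta> by blast
qed

section \<open>Second differences and uniform bounds on balls\<close>

text \<open>With the shift \<open>k\<close> as parameter and its norm, scaled to at most 1, as
  \<open>lam\<close>, the Lipschitz half of \<open>OL_taylor1\<close> is the estimate for equal
  shifts; passing from \<open>k\<close> to \<open>k'\<close> is plain Lipschitz continuity.\<close>

lemma smooth_four_point:
  fixes V :: "real ^ 'n \<Rightarrow> real ^ 'm"
  assumes V: "smooth V"
  obtains C where "C \<ge> 0"
    "\<And>x x' k k'. \<lbrakk>x \<in> cball 0 R; x' \<in> cball 0 R; x + k \<in> cball 0 R; x' + k' \<in> cball 0 R\<rbrakk> \<Longrightarrow>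
      norm (V (x + k) - V x - (V (x' + k') - V x')) \<le> C * (norm (k - k') + norm k * norm (x - x'))"
proof -
  interpret S: scaled_family_vec "{k :: real ^ 'n. norm k \<le> 2 * \<bar>R\<bar>}" "\<lambda>k. norm k / (2 * \<bar>R\<bar> + 1)" "cball 0 R" R
    by unfold_locales auto
  have h: "S.OL 1 (\<lambda>k x. k)" by (rule S.OL_const[of "2 * \<bar>R\<bar> + 1"]) auto
  obtain C where "of_order_by C {k. norm k \<le> 2 * \<bar>R\<bar>} (\<lambda>k. norm k / (2 * \<bar>R\<bar> + 1)) (cball 0 R) 1 (\<lambda>k x. V (x + k) - V x)"
    by (rule of_orderE[OF S.OL_taylor1[OF V h]])
  note C = of_order_byD(1,3)[OF this]
  obtain L where L: "L \<ge> 0" "\<And>x y. x \<in> cball 0 (3 * \<bar>R\<bar>) \<Longrightarrow> y \<in> cball 0 (3 * \<bar>R\<bar>) \<Longrightarrow>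
      norm (V x - V y) \<le> L * norm (x - y)"
    using smooth_locally_lipschitz[OF V, of "3 * \<bar>R\<bar>"] by blast
  show thesis
  proof (rule that[of "C + L"])
    show "C + L \<ge> 0" using C(1) L(1) by simp
    fix x x' k k' :: "real ^ 'n"
    assume d: "x \<in> cball 0 R" "x' \<in> cball 0 R" "x + k \<in> cball 0 R" "x' + k' \<in> cball 0 R"
    have nk: "norm k \<le> 2 * \<bar>R\<bar>"
      using norm_triangle_ineq4[of "x + k" x] d by simp
    have "norm (V (x + k) - V x - (V (x' + k) - V x')) \<le> C * (norm k / (2 * \<bar>R\<bar> + 1)) * norm (x - x')"
      using C(2)[of k, OF _ d(1,2)] nk by simp
    also have "\<dots> \<le> C * norm k * norm (x - x')"
      using C(1) by (intro mult_right_mono mult_left_mono) (auto simp: divide_le_eq algebra_simps)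
    finally have 1: "norm (V (x + k) - V x - (V (x' + k) - V x')) \<le> C * norm k * norm (x - x')" .
    \<comment> \<open>Here \<open>x' + k\<close> may leave the ball of radius \<open>R\<close>,
      hence the radius \<open>3 * \<bar>R\<bar>\<close> in the choice of \<open>L\<close>.\<close>
    have "norm (V (x' + k) - V (x' + k')) \<le> L * norm ((x' + k) - (x' + k'))"
      using d nk norm_triangle_ineq[of x' k] by (intro L) auto
    then have 2: "norm (V (x' + k) - V (x' + k')) \<le> L * norm (k - k')" by simp
    have "V (x + k) - V x - (V (x' + k') - V x') =
        (V (x + k) - V x - (V (x' + k) - V x')) + (V (x' + k) - V (x' + k'))" by simp
    also have "norm \<dots> \<le> C * norm k * norm (x - x') + L * norm (k - k')"
      by (rule norm_triangle_mono[OF 1 2])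
    also have "\<dots> \<le> (C + L) * (norm (k - k') + norm k * norm (x - x'))"
    proof -
      have "0 \<le> C * norm (k - k')" "0 \<le> L * (norm k * norm (x - x'))" using C(1) L(1) by auto
      then show ?thesis by (simp add: algebra_simps)
    qed
    finally show "norm (V (x + k) - V x - (V (x' + k') - V x')) \<le> (C + L) * (norm (k - k') + norm k * norm (x - x'))" .
  qed
qed

context rough_data
begin

text \<open>The estimate for comparing two solutions: \<open>x\<close> and \<open>x'\<close> are
  their Euler predictions, \<open>k\<close> and \<open>k'\<close> the prediction errors. The
  distance of the base points is multiplied by the small quantity \<open>norm k\<close>.\<close>

definition four_point_by :: "real \<Rightarrow> real \<Rightarrow> (real \<Rightarrow> real \<Rightarrow> real ^ 'n \<Rightarrow> real ^ 'n) \<Rightarrow> bool" where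
  "four_point_by C R f \<longleftrightarrow> C \<ge> 0 \<and> (\<forall>s t x x' k k'. 0 \<le> s \<longrightarrow> s \<le> t \<longrightarrow> t \<le> T \<longrightarrow>
     x \<in> cball 0 R \<longrightarrow> x' \<in> cball 0 R \<longrightarrow> x + k \<in> cball 0 R \<longrightarrow> x' + k' \<in> cball 0 R \<longrightarrow>
     norm (f s t (x + k) - f s t x - (f s t (x' + k') - f s t x'))
       \<le> C * (t - s) powr \<alpha> * (norm (k - k') + norm k * norm (x - x')))"

abbreviation four_point :: "real \<Rightarrow> (real \<Rightarrow> real \<Rightarrow> real ^ 'n \<Rightarrow> real ^ 'n) \<Rightarrow> bool" where
  "four_point R f \<equiv> \<exists>C. four_point_by C R f"

lemma four_point_add:
  assumes "four_point R f" "four_point R g"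
  shows "four_point R (\<lambda>s t x. f s t x + g s t x)"
proof -
  obtain C D where C: "four_point_by C R f" and D: "four_point_by D R g" using assms by blast
  have eq: "a' + b' - (a + b) - (c' + d' - (c + d)) = (a' - a - (c' - c)) + (b' - b - (d' - d))"
    for a a' b b' c c' d d' :: "real ^ 'n" by simp
  have "four_point_by (C + D) R (\<lambda>s t x. f s t x + g s t x)"
    unfolding four_point_by_def eq distrib_right[of C D] distrib_right[of "C * _" "D * _"]
    using C[unfolded four_point_by_def] D[unfolded four_point_by_def]
    by (intro conjI allI impI norm_triangle_mono) simp_all
  then show ?thesis ..
qed

lemma four_point_zero: "four_point R (\<lambda>s t x. 0)"
  unfolding four_point_by_def by (intro exI[of _ 0]) auto

lemma four_point_sum:
  "finite I \<Longrightarrow> (\<And>i. i \<in> I \<Longrightarrow> four_point R (f i)) \<Longrightarrow> four_point R (\<lambda>s t x. \<Sum>i\<in>I. f i s t x)"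
  by (induction I rule: finite_induct) (auto intro: four_point_add four_point_zero)

lemma four_point_scaleR:
  assumes "smooth V" "k > 0" "\<And>s t. \<lbrakk>0 \<le> s; s \<le> t; t \<le> T\<rbrakk> \<Longrightarrow> \<bar>c s t\<bar> \<le> K * ((t - s) powr \<alpha>) ^ k"
  shows "four_point R (\<lambda>s t x. c s t *\<^sub>R V x)"
proof -
  obtain C where C: "C \<ge> 0"
    "\<And>x x' k k'. \<lbrakk>x \<in> cball 0 R; x' \<in> cball 0 R; x + k \<in> cball 0 R; x' + k' \<in> cball 0 R\<rbrakk> \<Longrightarrow>
      norm (V (x + k) - V x - (V (x' + k') - V x')) \<le> C * (norm (k - k') + norm k * norm (x - x'))"
    using smooth_four_point[OF assms(1), of R] by blast
  have "four_point_by (K * C) R (\<lambda>s t x. c s t *\<^sub>R V x)"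
    unfolding four_point_by_def
  proof (intro conjI allI impI)
    show "K * C \<ge> 0" using C K by simp
    fix s t and x x' z z' :: "real ^ 'n"
    assume d: "0 \<le> s" "s \<le> t" "t \<le> T" "x \<in> cball 0 R" "x' \<in> cball 0 R" "x + z \<in> cball 0 R" "x' + z' \<in> cball 0 R"
    let ?w = "(t - s) powr \<alpha>"
    have "?w \<le> 1" using width[of "(s, s, t)"] d by (simp add: times_def width_def)
    then have "?w ^ k \<le> ?w ^ 1" using assms(2) by (intro power_decreasing) auto
    then have c: "\<bar>c s t\<bar> \<le> K * ?w"
      using assms(3)[OF d(1-3)] K mult_left_mono[of "?w ^ k" ?w K] by simp
    have "norm (c s t *\<^sub>R V (x + z) - c s t *\<^sub>R V x - (c s t *\<^sub>R V (x' + z') - c s t *\<^sub>R V x')) =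
        \<bar>c s t\<bar> * norm (V (x + z) - V x - (V (x' + z') - V x'))"
      by (simp add: scaleR_diff_right[symmetric])
    also have "\<dots> \<le> (K * ?w) * (C * (norm (z - z') + norm z * norm (x - x')))"
      using c C(2)[OF d(4-7)] K by (intro mult_mono) auto
    finally show "norm (c s t *\<^sub>R V (x + z) - c s t *\<^sub>R V x - (c s t *\<^sub>R V (x' + z') - c s t *\<^sub>R V x'))
        \<le> K * C * ?w * (norm (z - z') + norm z * norm (x - x'))" by (simp add: mult_ac)
  qed
  then show ?thesis ..
qed

lemma four_point_part: "four_point R (part a)"
  unfolding part_def[abs_def]
  by (intro four_point_add four_point_sum four_point_scaleR[OF F, of 1] four_point_scaleR[OF smooth_V2, of 2]
      four_point_scaleR[OF smooth_V3, of 3] four_point_scaleR[OF smooth_V4, of 3])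
    (auto intro: bound1 bound2 bound3 bound4)

lemma width4: "((t - s) powr \<alpha>) ^ 4 = (t - s) powr (4 * \<alpha>)"
  by (cases "t = s") (simp_all add: powr_realpow[symmetric] powr_powr mult.commute)

lemma width_le1: "\<lbrakk>0 \<le> s; s \<le> t; t \<le> T\<rbrakk> \<Longrightarrow> (t - s) powr \<alpha> \<le> 1"
  using width[of "(s, s, t)"] by (simp add: times_def width_def)

abbreviation bounded_by :: "real \<Rightarrow> real \<Rightarrow> nat \<Rightarrow> (real \<times> real \<times> real \<Rightarrow> real ^ 'n \<Rightarrow> real ^ 'n) \<Rightarrow> bool" where
  "bounded_by R C \<equiv> of_order_by C times width (cball 0 R)"

text \<open>All order estimates on the ball of radius \<open>R\<close> with one common constant, so
  that a proof chooses a constant once for each radius.\<close>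

definition bounds_on :: "real \<Rightarrow> real \<Rightarrow> bool" where
  "bounds_on R C \<longleftrightarrow>
     (\<forall>a. bounded_by R C 1 (su (part a))) \<and>
     (\<forall>a. bounded_by R C 4 (\<lambda>p. defect a (fst p) (fst (snd p)) (snd (snd p)))) \<and>
     bounded_by R C 3 (su h3) \<and>
     (\<forall>a. bounded_by R C 2 (\<lambda>p x. F a (su davie p x) - F a x -
       (\<Sum>b\<in>UNIV. su x1 p b *\<^sub>R V2 a b x))) \<and>
     (\<forall>a. bounded_by R C 0 (\<lambda>p. F a)) \<and>
     (\<forall>ab. bounded_by R C 0 (\<lambda>p. V2 (fst ab) (snd ab))) \<and>
     bounded_by R C 1 (\<lambda>p x. su davie p x - x) \<and>
     bounded_by R C 4 (\<lambda>p x. ut davie p (su davie p x) -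
       davie (fst p) (snd (snd p)) x)"

lemma bounds_on_exists: obtains C where "bounds_on R C"
proof -
  interpret B: rough_data_ball T \<alpha> K x1 x2 x11 x3 x4 F R by unfold_locales
  have w: "0 \<le> width p" if "p \<in> times" for p using width[OF that] by simp
  let ?G = "\<lambda>a p x. F a (su davie p x) - F a x - (\<Sum>b\<in>UNIV. su x1 p b *\<^sub>R V2 a b x)"
  from uniform_of_order[where f = "\<lambda>a p. su (part a) p", OF B.OL_part w]
  obtain C1 where C1: "\<forall>a. bounded_by R C1 1 (su (part a))" ..
  from uniform_of_order[where f = "\<lambda>a p. defect a (fst p) (fst (snd p)) (snd (snd p))", OF B.OL_defect w]
  obtain C2 where C2: "\<forall>a. bounded_by R C2 4 (\<lambda>p. defect a (fst p) (fst (snd p)) (snd (snd p)))" ..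
  from uniform_of_order[where f = "?G", OF B.OL_first_order w]
  obtain C4 where C4: "\<forall>a. bounded_by R C4 2 (?G a)" ..
  from uniform_of_order[where f = "\<lambda>a p. F a", OF B.OL_smooth[OF F] w]
  obtain C5 where C5: "\<forall>a. bounded_by R C5 0 (\<lambda>p. F a)" ..
  from uniform_of_order[where f = "\<lambda>ab p. V2 (fst ab) (snd ab)", OF B.OL_smooth[OF smooth_V2] w]
  obtain C6 where C6: "\<forall>ab. bounded_by R C6 0 (\<lambda>p. V2 (fst ab) (snd ab))" ..
  obtain C3 where C3: "bounded_by R C3 3 (su h3)"
    by (rule of_orderE[OF B.OL_h3])
  obtain C7 where C7: "bounded_by R C7 1 (\<lambda>p x. su davie p x - x)"
    by (rule of_orderE[OF B.OL_davie])
  obtain C8 where C8: "bounded_by R C8 4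
      (\<lambda>p x. ut davie p (su davie p x) - davie (fst p) (snd (snd p)) x)"
    by (rule of_orderE[OF B.OL_davie_defect])
  note Cs = C1[rule_format] C2[rule_format] C3 C4[rule_format] C5[rule_format] C6[rule_format] C7 C8
  define C where "C = C1 + C2 + C3 + C4 + C5 + C6 + C7 + C8"
  have "C1 \<le> C" "C2 \<le> C" "C3 \<le> C" "C4 \<le> C" "C5 \<le> C" "C6 \<le> C" "C7 \<le> C" "C8 \<le> C"
    using Cs[THEN of_order_byD(1)] by (simp_all add: C_def)
  then have "bounds_on R C"
    unfolding bounds_on_def by (intro conjI allI Cs[THEN of_order_by_mono, OF _ w])
  then show thesis by (rule that)
qed

lemma bounds_onD:
  assumes "bounds_on R C"
  shows "C \<ge> 0"
    and "\<lbrakk>0 \<le> s; s \<le> t; t \<le> T; x \<in> cball 0 R\<rbrakk> \<Longrightarrow> norm (part a s t x) \<le> C * (t - s) powr \<alpha>"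
    and "\<lbrakk>0 \<le> s; s \<le> t; t \<le> T; x \<in> cball 0 R; y \<in> cball 0 R\<rbrakk> \<Longrightarrow>
      norm (part a s t x - part a s t y) \<le> C * (t - s) powr \<alpha> * norm (x - y)"
    and "\<lbrakk>0 \<le> s; s \<le> u; u \<le> t; t \<le> T; x \<in> cball 0 R\<rbrakk> \<Longrightarrow>
      norm (defect a s u t x) \<le> C * (t - s) powr (4 * \<alpha>)"
    and "\<lbrakk>0 \<le> s; s \<le> t; t \<le> T; x \<in> cball 0 R\<rbrakk> \<Longrightarrow> norm (h3 s t x) \<le> C * ((t - s) powr \<alpha>) ^ 3"
    and "\<lbrakk>0 \<le> s; s \<le> t; t \<le> T; x \<in> cball 0 R\<rbrakk> \<Longrightarrow>
      norm (F a (davie s t x) - F a x - (\<Sum>b\<in>UNIV. x1 s t b *\<^sub>R V2 a b x)) \<le> C * ((t - s) powr \<alpha>) ^ 2"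
    and "\<lbrakk>0 \<le> T; x \<in> cball 0 R; y \<in> cball 0 R\<rbrakk> \<Longrightarrow> norm (F a x - F a y) \<le> C * norm (x - y)"
    and "\<lbrakk>0 \<le> T; x \<in> cball 0 R; y \<in> cball 0 R\<rbrakk> \<Longrightarrow> norm (V2 a b x - V2 a b y) \<le> C * norm (x - y)"
    and "\<lbrakk>0 \<le> s; s \<le> t; t \<le> T; x \<in> cball 0 R\<rbrakk> \<Longrightarrow> norm (davie s t x - x) \<le> C * (t - s) powr \<alpha>"
    and "\<lbrakk>0 \<le> s; s \<le> t; t \<le> T; x \<in> cball 0 R; y \<in> cball 0 R\<rbrakk> \<Longrightarrow>
      norm ((davie s t x - x) - (davie s t y - y)) \<le> C * (t - s) powr \<alpha> * norm (x - y)"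
    and "\<lbrakk>0 \<le> s; s \<le> u; u \<le> t; t \<le> T; x \<in> cball 0 R\<rbrakk> \<Longrightarrow>
      norm (davie u t (davie s u x) - davie s t x) \<le> C * (t - s) powr (4 * \<alpha>)"
    and "\<lbrakk>0 \<le> s; s \<le> u; u \<le> t; t \<le> T; x \<in> cball 0 R; y \<in> cball 0 R\<rbrakk> \<Longrightarrow>
      norm ((davie u t (davie s u x) - davie s t x) - (davie u t (davie s u y) - davie s t y))
        \<le> C * (t - s) powr (4 * \<alpha>) * norm (x - y)"
proof goal_cases
  note B = assms[unfolded bounds_on_def]
  note P = of_order_byD[OF conjunct1[OF B, rule_format]] and B = conjunct2[OF B]
  note Q = of_order_byD[OF conjunct1[OF B, rule_format]] and B = conjunct2[OF B]
  note H = of_order_byD[OF conjunct1[OF B]] and B = conjunct2[OF B]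
  note A = of_order_byD[OF conjunct1[OF B, rule_format]] and B = conjunct2[OF B]
  note L = of_order_byD[OF conjunct1[OF B, rule_format]] and B = conjunct2[OF B]
  note M = of_order_byD[OF conjunct1[OF B, rule_format]] and B = conjunct2[OF B]
  note d = of_order_byD[OF conjunct1[OF B]] and D = of_order_byD[OF conjunct2[OF B]]
  note [simp] = times_def width_def width4
  {
  case 1 show ?case by (rule P(1))
  next
    \<comment> \<open>Estimates over one interval are those for the triple with
      \<open>u = t\<close>, whose width is the length of \<open>{s..t}\<close>.\<close>
    case 2 then show ?case using P(2)[of "(s, t, t)" x a] by simp
  next
    case 3 then show ?case using P(3)[of "(s, t, t)" x y a] by simp
  next
    case 4 then show ?case using Q(2)[of "(s, u, t)" x a] by simp
  next
    case 5 then show ?case using H(2)[of "(s, t, t)" x] by simp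
  next
    case 6 then show ?case using A(2)[of "(s, t, t)" x a] by simp
  next
    case 7 then show ?case using L(3)[of "(0, 0, 0)" x y a] by simp
  next
    case 8 then show ?case using M(3)[of "(0, 0, 0)" x y "(a, b)"] by simp
  next
    case 9 then show ?case using d(2)[of "(s, t, t)" x] by simp
  next
    case 10 then show ?case using d(3)[of "(s, t, t)" x y] by simp
  next
    case 11 then show ?case using D(2)[of "(s, u, t)" x] by simp
  next
    case 12 then show ?case using D(3)[of "(s, u, t)" x y] by simp
  }
qed

text \<open>
  Solutions in the sense of Davie, with values in a ball. The weaker order \<open>3\<close> is what a controlled
  path gives directly; sewing improves it to \<open>4\<close>.
\<close>

definition davie_solution :: "nat \<Rightarrow> real \<Rightarrow> real \<Rightarrow> real \<Rightarrow> (real \<Rightarrow> real ^ 'n) \<Rightarrow> bool" where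
  "davie_solution k R D \<delta> y \<longleftrightarrow> D \<ge> 0 \<and> (\<forall>t\<in>{0..\<delta>}. y t \<in> cball 0 R) \<and>
     (\<forall>s t. 0 \<le> s \<longrightarrow> s \<le> t \<longrightarrow> t \<le> \<delta> \<longrightarrow> norm (y t - davie s t (y s)) \<le> D * ((t - s) powr \<alpha>) ^ k)"

lemma davie_solutionD:
  assumes "davie_solution k R D \<delta> y"
  shows "D \<ge> 0" "\<And>t. t \<in> {0..\<delta>} \<Longrightarrow> y t \<in> cball 0 R"
    "\<And>s t. \<lbrakk>0 \<le> s; s \<le> t; t \<le> \<delta>\<rbrakk> \<Longrightarrow> norm (y t - davie s t (y s)) \<le> D * ((t - s) powr \<alpha>) ^ k"
  using assms unfolding davie_solution_def by blast+

lemma davie_solutionI: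
  assumes "D \<ge> 0" "\<And>t. t \<in> {0..\<delta>} \<Longrightarrow> y t \<in> cball 0 R"
    "\<And>s t. \<lbrakk>0 \<le> s; s \<le> t; t \<le> \<delta>\<rbrakk> \<Longrightarrow> norm (y t - davie s t (y s)) \<le> D * ((t - s) powr \<alpha>) ^ k"
  shows "davie_solution k R D \<delta> y"
  using assms unfolding davie_solution_def by blast

lemma davie_solution_mono:
  assumes "davie_solution k R D \<delta> y" "R \<le> R'" "D \<le> D'" "j \<le> k" "\<delta> \<le> T"
  shows "davie_solution j R' D' \<delta> y"
proof (rule davie_solutionI)
  note y = davie_solutionD[OF assms(1)]
  show "D' \<ge> 0" using y(1) assms(3) by simp
  show "y t \<in> cball 0 R'" if "t \<in> {0..\<delta>}" for t using y(2)[OF that] assms(2) by simp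
  fix s t assume st: "0 \<le> s" "s \<le> t" "t \<le> \<delta>"
  have "((t - s) powr \<alpha>) ^ k \<le> ((t - s) powr \<alpha>) ^ j"
    using width_le1[of s t] st assms(4,5) by (intro power_decreasing) auto
  then have "D * ((t - s) powr \<alpha>) ^ k \<le> D' * ((t - s) powr \<alpha>) ^ j"
    using y(1) assms(3) by (intro mult_mono) auto
  then show "norm (y t - davie s t (y s)) \<le> D' * ((t - s) powr \<alpha>) ^ j"
    using y(3)[OF st] by (rule order_trans[rotated])
qed

section \<open>Existence and uniqueness of Davie solutions, existence of the integrals\<close>

text \<open>The Lipschitz constant of the displacement is \<open>C * \<delta> powr \<alpha>\<close>
  on \<open>{0..\<delta>}\<close>, so shortening the interval achieves both the contraction
  \<open>q\<close> and the stay in the ball of radius 1 around \<open>\<xi>\<close>. The bounds are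
  taken on the ball around 0 that contains the doubled ball.\<close>

lemma davie_solution_exists:
  assumes T0: "T > 0" and \<alpha>4: "4 * \<alpha> > 1"
  obtains \<delta>\<^sub>0 where "\<delta>\<^sub>0 > 0" "\<delta>\<^sub>0 \<le> T"
    "\<And>\<delta>. 0 < \<delta> \<Longrightarrow> \<delta> < \<delta>\<^sub>0 \<Longrightarrow> \<exists>y R D. y 0 = \<xi> \<and> davie_solution 4 R D \<delta> y"
proof -
  obtain C where "bounds_on (norm \<xi> + 2) C" by (rule bounds_on_exists)
  note C = bounds_onD[OF this]
  define q where "q = (2/3::real) powr (4 * \<alpha> - 1)"
  have q: "0 \<le> q" "q < 1" using \<alpha>4 powr_less_mono2[of "4 * \<alpha> - 1" "2/3" 1] by (auto simp: q_def)
  \<comment> \<open>Once \<open>L\<close> is at most \<open>(1 - q) / 2\<close>, the coefficient in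
    \<open>small\<close> is at most \<open>2 * C / (1 - q)\<close>; adding \<open>C\<close> accounts
    for the displacement, and 1 keeps \<open>D\<close> positive.\<close>
  define D where "D = 2 * C / (1 - q) + C + 1"
  have D: "D \<ge> 1" "C \<le> D" using C(1) q by (auto simp: D_def)
  \<comment> \<open>Makes \<open>D * \<delta> powr \<alpha>\<close> at most
    \<open>(1 - q) / 2\<close>, which bounds \<open>L\<close> and the left side of
    \<open>small\<close> together.\<close>
  define \<epsilon> where "\<epsilon> = (1 - q) / (2 * D)"
  have \<epsilon>: "\<epsilon> > 0" "D * \<epsilon> = (1 - q) / 2" using q D by (auto simp: \<epsilon>_def)
  show thesis
  proof (rule that[of "min T (\<epsilon> powr (1 / \<alpha>))"])
    show "min T (\<epsilon> powr (1 / \<alpha>)) > 0" using T0 \<epsilon> by simp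
    show "min T (\<epsilon> powr (1 / \<alpha>)) \<le> T" by simp
    fix \<delta> assume \<delta>: "0 < \<delta>" "\<delta> < min T (\<epsilon> powr (1 / \<alpha>))"
    have "\<delta> powr \<alpha> \<le> (\<epsilon> powr (1 / \<alpha>)) powr \<alpha>" using \<delta> \<alpha> by (intro powr_mono2) auto
    also have "\<dots> = \<epsilon>" using \<alpha> \<epsilon> by (simp add: powr_powr)
    finally have \<delta>\<epsilon>: "\<delta> powr \<alpha> \<le> \<epsilon>" .
    have D\<delta>: "D * \<delta> powr \<alpha> \<le> (1 - q) / 2"
      using mult_left_mono[OF \<delta>\<epsilon>, of D] D \<epsilon>(2) by simp
    have C\<delta>: "C * \<delta> powr \<alpha> \<le> (1 - q) / 2"
      using mult_right_mono[OF D(2), of "\<delta> powr \<alpha>"] D\<delta> by simp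
    let ?c = "C * \<delta> powr \<alpha>"
    have sub: "x \<in> cball 0 (norm \<xi> + 2)" if "x \<in> cball \<xi> (2 * 1)" for x
      using that norm_triangle_ineq[of \<xi> "x - \<xi>"] by (simp add: dist_norm norm_minus_commute)
    interpret almost_flow davie \<delta> "4 * \<alpha>" \<alpha> 1 C C ?c \<xi>
    proof unfold_locales
      show "0 < \<delta>" "1 < 4 * \<alpha>" "0 < \<alpha>" "\<alpha> \<le> 4 * \<alpha>" "0 \<le> C" "0 \<le> ?c"
        using \<delta> \<alpha>4 \<alpha> C(1) by auto
      show "norm ((davie s t x - x) - (davie s t y - y)) \<le> ?c * norm (x - y)"
        if "0 \<le> s" "s \<le> t" "t \<le> \<delta>" "x \<in> cball \<xi> (2 * 1)" "y \<in> cball \<xi> (2 * 1)" for s t x y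
      proof -
        have "norm ((davie s t x - x) - (davie s t y - y)) \<le> C * (t - s) powr \<alpha> * norm (x - y)"
          using that \<delta> by (intro C sub) auto
        also have "\<dots> \<le> ?c * norm (x - y)"
          using that C(1) \<alpha> by (intro mult_right_mono mult_left_mono powr_mono2) auto
        finally show ?thesis .
      qed
      show "norm (davie s t x - x) \<le> C * (t - s) powr \<alpha>"
        if "0 \<le> s" "s \<le> t" "t \<le> \<delta>" "x \<in> cball \<xi> (2 * 1)" for s t x
        using that \<delta> by (intro C sub) auto
      show "norm (davie u t (davie s u x) - davie s t x) \<le> C * (t - s) powr (4 * \<alpha>)"
        if "0 \<le> s" "s \<le> u" "u \<le> t" "t \<le> \<delta>" "x \<in> cball \<xi> 1" for s u t x
        using that \<delta> by (intro C sub) auto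
      show "(2/3) powr (4 * \<alpha> - 1) + ?c < 1"
        using C\<delta> q by (simp add: q_def[symmetric])
      have "\<delta> powr (4 * \<alpha>) \<le> \<delta> powr \<alpha>" using \<delta> T \<alpha> by (intro powr_mono') auto
      moreover have "C / (1 - (q + ?c)) \<le> C / ((1 - q) / 2)"
        using C(1) C\<delta> q by (intro divide_left_mono) auto
      ultimately have "C / (1 - (q + ?c)) * \<delta> powr (4 * \<alpha>) \<le> C / ((1 - q) / 2) * \<delta> powr \<alpha>"
        using C(1) q by (intro mult_mono) auto
      also have "\<dots> + ?c \<le> D * \<delta> powr \<alpha>"
      proof -
        have e: "C / ((1 - q) / 2) = 2 * C / (1 - q)" by simp
        show ?thesis unfolding e D_def distrib_right by simp
      qed
      also have "\<dots> \<le> 1" using D\<delta> q by simp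
      finally show "C / (1 - ((2/3) powr (4 * \<alpha> - 1) + ?c)) * \<delta> powr (4 * \<alpha>) + ?c \<le> 1"
        by (simp add: q_def)
    qed
    show "\<exists>y R D. y 0 = \<xi> \<and> davie_solution 4 R D \<delta> y"
    proof (rule davie_path)
      fix y
      assume y: "y 0 = \<xi>" "\<And>t. t \<in> {0..\<delta>} \<Longrightarrow> y t \<in> cball \<xi> 1"
        "\<And>s t. \<lbrakk>0 \<le> s; s \<le> t; t \<le> \<delta>\<rbrakk> \<Longrightarrow> norm (y t - davie s t (y s)) \<le> (m + 2 * C) * (t - s) powr (4 * \<alpha>)"
      have "davie_solution 4 (norm \<xi> + 2) (m + 2 * C) \<delta> y"
      proof (rule davie_solutionI)
        show "y t \<in> cball 0 (norm \<xi> + 2)" if "t \<in> {0..\<delta>}" for t by (intro sub subball y(2) that)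
      qed (use m(1) C(1) y(3) in \<open>auto simp: width4\<close>)
      with y(1) show ?thesis by blast
    qed
  qed
qed

text \<open>Let \<open>\<Delta> s t\<close> be the difference of the defects of the two solutions.
  If they agree at \<open>a\<close>, a bound of \<open>\<Delta>\<close> by \<open>M\<close> times (t
  - s)^(4 \<alpha>) near \<open>a\<close> improves to \<open>\<rho> * M\<close>: two halves
  contribute the factor \<open>2 powr (1 - 4 * \<alpha>)\<close>, below 1, and all other terms
  contain a small power of the window length \<open>\<eta>\<close>.\<close>

lemma davie_solution_unique:
  assumes \<alpha>4: "4 * \<alpha> > 1" and \<delta>: "\<delta> \<le> T"
    and sol: "davie_solution 4 R D \<delta> y" "davie_solution 4 R D \<delta> z"
    and init: "y 0 = z 0" and t: "t \<in> {0..\<delta>}"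
  shows "y t = z t"
proof -
  let ?g = "\<lambda>s t x. davie s t x - x" and ?v = "\<lambda>s t. (t - s) powr \<alpha>" and ?w = "\<lambda>s t. (t - s) powr (4 * \<alpha>)"
  have "D \<ge> 0" by (rule davie_solutionD(1)[OF sol(1)])
  obtain N where "bounds_on R N" by (rule bounds_on_exists)
  note N = bounds_onD[OF this]
  \<comment> \<open>The second differences are taken at Euler predictions, which lie at most
    \<open>N\<close> away from the ball of radius \<open>R\<close>.\<close>
  have "four_point (R + N) (\<lambda>s t x. \<Sum>a\<in>UNIV. part a s t x)"
    by (intro four_point_sum four_point_part) auto
  then obtain E where "four_point_by E (R + N) (\<lambda>s t x. \<Sum>a\<in>UNIV. part a s t x)" ..
  note E = this[unfolded four_point_by_def, THEN conjunct1] this[unfolded four_point_by_def, THEN conjunct2, rule_format]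
  define C where "C = 1 + N + D + E"
  have C: "C \<ge> 0" "1 + N \<le> C" "D \<le> C" "E \<le> C" "N \<le> C" using N(1) E(1) \<open>D \<ge> 0\<close> by (auto simp: C_def)
  have lip: "norm (davie s t x - davie s t x') \<le> C * norm (x - x')"
    if "0 \<le> s" "s \<le> t" "t \<le> \<delta>" "x \<in> cball 0 R" "x' \<in> cball 0 R" for s t x x'
  proof -
    have "norm (?g s t x - ?g s t x') \<le> N * ?v s t * norm (x - x')"
      using that \<delta> by (intro N) auto
    also have "\<dots> \<le> N * norm (x - x')"
      using mult_left_le[of "?v s t" N] width_le1[of s t] that \<delta> N(1) by (intro mult_right_mono) auto
    finally have "norm (davie s t x - davie s t x') \<le> (1 + N) * norm (x - x')"
      using norm_triangle_ineq[of "?g s t x - ?g s t x'" "x - x'"] by (simp add: algebra_simps)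
    also have "\<dots> \<le> C * norm (x - x')" using C by (intro mult_right_mono) auto
    finally show ?thesis .
  qed
  have into: "davie s t x \<in> cball 0 (R + N)" if "0 \<le> s" "s \<le> t" "t \<le> \<delta>" "x \<in> cball 0 R" for s t x
  proof -
    have "norm (?g s t x) \<le> N * ?v s t" using that \<delta> by (intro N) auto
    also have "\<dots> \<le> N" using width_le1[of s t] that \<delta> N(1) by (intro mult_left_le) auto
    finally show ?thesis using that norm_triangle_ineq[of x "davie s t x - x"] by simp
  qed
  have four_pt: "norm ((?g s t (x + k) - ?g s t x) - (?g s t (x' + k') - ?g s t x'))
      \<le> C * ?v s t * (norm (k - k') + norm k * norm (x - x'))"
    if "0 \<le> s" "s \<le> t" "t \<le> \<delta>" "x \<in> cball 0 (R + N)" "x' \<in> cball 0 (R + N)" "x + k \<in> cball 0 (R + N)" "x' + k' \<in> cball 0 (R + N)"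
    for s t x x' k k'
    using order_trans[OF E(2) mult_right_mono[OF mult_right_mono[OF C(4)]]] that \<delta> by (simp add: davie_def)
  have almost_lip: "norm ((davie u t (davie s u x) - davie s t x) - (davie u t (davie s u x') - davie s t x')) \<le> C * ?w s t * norm (x - x')"
    if "0 \<le> s" "s \<le> u" "u \<le> t" "t \<le> \<delta>" "x \<in> cball 0 R" "x' \<in> cball 0 R" for s u t x x'
    using that \<delta> order_trans[OF N(12) mult_right_mono[OF mult_right_mono[OF C(5)]]] by auto
  have \<alpha>s: "0 < \<alpha>" "\<alpha> \<le> 4 * \<alpha>" using \<alpha> by auto
  have DC: "norm x \<le> C * ?w s t" if "norm x \<le> D * (?v s t) ^ 4" for x :: "real ^ 'n" and s t
    using that mult_right_mono[OF C(3), of "?w s t"] by (simp add: width4)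
  note y = davie_solutionD(2)[OF sol(1)] DC[OF davie_solutionD(3)[OF sol(1)]]
    and z = davie_solutionD(2)[OF sol(2)] DC[OF davie_solutionD(3)[OF sol(2)]]
  define r where "r = (2::real) powr (1 - (4 * \<alpha>))"
  have r: "0 \<le> r" "r < 1" using \<alpha>4 powr_less_mono[of "1 - (4 * \<alpha>)" 0 "2::real"] by (auto simp: r_def)
  \<comment> \<open>The first summand comes from the four-point estimate, the second from the
    Lipschitz bound of the flow defect; \<open>\<eta>\<close> is chosen so that
    \<open>G * \<eta> powr \<alpha>\<close> uses up at most half of \<open>1 - r\<close>.\<close>
  define G where "G = C * (1 + C * C) + C"
  have G: "G \<ge> 0" using C(1) by (simp add: G_def)
  define \<eta> where "\<eta> = min 1 (((1 - r) / (2 * (G + 1))) powr (1 / \<alpha>))"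
  have \<eta>: "\<eta> > 0" "\<eta> \<le> 1" using r G by (auto simp: \<eta>_def)
  define \<rho> where "\<rho> = (1 + r) / 2"
  have \<rho>: "0 \<le> \<rho>" "\<rho> < 1" using r by (auto simp: \<rho>_def)
  let ?h = "\<eta> powr \<alpha>"
  have G\<eta>: "r + G * ?h \<le> \<rho>"
  proof -
    have "?h \<le> (((1 - r) / (2 * (G + 1))) powr (1 / \<alpha>)) powr \<alpha>"
      using \<eta> \<alpha>s by (intro powr_mono2) (auto simp: \<eta>_def)
    also have "\<dots> = (1 - r) / (2 * (G + 1))" using r G \<alpha>s by (simp add: powr_powr)
    finally have "G * ?h \<le> G * ((1 - r) / (2 * (G + 1)))" using G by (rule mult_left_mono)
    also have "\<dots> \<le> (G + 1) * ((1 - r) / (2 * (G + 1)))" using r G by (intro mult_right_mono) auto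
    also have "\<dots> = (1 - r) / 2" using G by (simp add: field_simps)
    finally show ?thesis by (simp add: \<rho>_def field_simps)
  qed
  define \<Delta> where "\<Delta> s t = (y t - davie s t (y s)) - (z t - davie s t (z s))" for s t
  have step: "norm (\<Delta> s t) \<le> \<rho> * M * ?w s t"
    if M: "M \<ge> 0" and a: "0 \<le> a" "y a = z a"
      and E: "\<And>s t. \<lbrakk>a \<le> s; s \<le> t; t \<le> \<delta>; t \<le> a + \<eta>\<rbrakk> \<Longrightarrow> norm (\<Delta> s t) \<le> M * ?w s t"
      and st: "a \<le> s" "s \<le> t" "t \<le> \<delta>" "t \<le> a + \<eta>" for M a s t
  proof -
    define u where "u = (s + t) / 2"
    have u: "s \<le> u" "u \<le> t" "0 \<le> s" "u \<le> \<delta>" "u \<le> a + \<eta>" "a \<le> u" "s \<le> \<delta>" "0 \<le> u"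
      using st a by (auto simp: u_def)
    define h where "h = ?w s t"
    have h: "h \<ge> 0" by (simp add: h_def)
    have tu: "t - u = (t - s) / 2" "u - s = (t - s) / 2" by (simp_all add: u_def field_simps)
    have half: "?w u t = h / 2 powr (4 * \<alpha>)" "?w s u = h / 2 powr (4 * \<alpha>)"
      unfolding tu h_def using st by (simp_all add: powr_divide)
    have half_le: "?w s u \<le> h" "?v s t \<le> ?h" "?v u t \<le> ?h"
      using u st a \<alpha>4 \<alpha>s \<eta> unfolding h_def by (auto intro!: powr_mono2)
    \<comment> \<open>Since the solutions agree at \<open>a\<close>, their difference at
      \<open>s\<close> is \<open>\<Delta> a s\<close>; its bound carries the window length and
      supplies the spare factor \<open>\<eta> powr \<alpha>\<close>.\<close>
    have gap: "norm (y s - z s) \<le> M * ?h"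
    proof -
      have "\<Delta> a s = y s - z s" using a by (simp add: \<Delta>_def)
      then have "norm (y s - z s) \<le> M * ?w a s" using E[of a s] st u by simp
      also have "?w a s \<le> \<eta> powr (4 * \<alpha>)" using st u \<alpha>4 by (intro powr_mono2) auto
      also have "\<eta> powr (4 * \<alpha>) \<le> ?h" using \<eta> \<alpha>s by (intro powr_mono') auto
      finally show ?thesis using M by (auto intro: mult_left_mono)
    qed
    have ys: "y s \<in> cball 0 R" "z s \<in> cball 0 R" "y u \<in> cball 0 R" "z u \<in> cball 0 R" using u y(1) z(1) by auto
    let ?x = "davie s u (y s)" and ?x' = "davie s u (z s)"
    let ?k = "y u - ?x" and ?k' = "z u - ?x'"
    have kk: "?k - ?k' = \<Delta> s u" by (simp add: \<Delta>_def)
    have nk: "norm ?k \<le> C * h"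
      using y(2)[of s u] u half_le(1) C(1) by (meson order_trans mult_left_mono)
    have nx: "norm (?x - ?x') \<le> C * (M * ?h)"
      using lip[of s u "y s" "z s"] u ys gap C(1) by (meson order_trans mult_left_mono)
    have n\<Delta>: "norm (\<Delta> s u) \<le> M * h"
      using E[of s u] u st half_le(1) M by (meson order_trans mult_left_mono)
    \<comment> \<open>The shifts are the defects over \<open>{s..u}\<close>, so that the difference
      of the shifts is \<open>\<Delta> s u\<close> itself, and adding a shift to its prediction
      gives the true value at \<open>u\<close>.\<close>
    have f: "norm ((?g u t (?x + ?k) - ?g u t ?x) - (?g u t (?x' + ?k') - ?g u t ?x'))
        \<le> C * ?v u t * (norm (?k - ?k') + norm ?k * norm (?x - ?x'))"
      using u st ys into N(1) by (intro four_pt) auto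
    also have "\<dots> \<le> C * ?h * (M * h + (C * h) * (C * (M * ?h)))"
      unfolding kk using n\<Delta> nk nx half_le(3) C(1) M h
      by (intro mult_mono add_mono) (auto intro!: mult_nonneg_nonneg add_nonneg_nonneg)
    also have "\<dots> \<le> C * ?h * (M * h + (C * h) * (C * (M * 1)))"
    proof -
      have "?h \<le> 1" using \<eta> \<alpha>s powr_mono2[of \<alpha> \<eta> 1] by simp
      then show ?thesis using C(1) M h
        by (intro mult_left_mono add_left_mono) (auto intro!: mult_nonneg_nonneg)
    qed
    also have "\<dots> = C * (1 + C * C) * ?h * (M * h)" by (simp add: algebra_simps)
    finally have f': "norm ((?g u t (y u) - ?g u t ?x) - (?g u t (z u) - ?g u t ?x'))
        \<le> C * (1 + C * C) * ?h * (M * h)" by simp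
    have "norm ((davie u t ?x - davie s t (y s)) - (davie u t ?x' - davie s t (z s))) \<le> C * ?w s t * norm (y s - z s)"
      using u st ys by (intro almost_lip) auto
    also have "\<dots> \<le> C * h * (M * ?h)"
      unfolding h_def using gap C(1) by (intro mult_left_mono) auto
    finally have d': "norm ((davie u t ?x - davie s t (y s)) - (davie u t ?x' - davie s t (z s))) \<le> C * ?h * (M * h)"
      by (simp add: mult_ac)
    have e1: "norm (\<Delta> u t) \<le> M * (h / 2 powr (4 * \<alpha>))" using E[of u t] u st by (simp add: half)
    have e2: "norm (\<Delta> s u) \<le> M * (h / 2 powr (4 * \<alpha>))" using E[of s u] u st by (simp add: half)
    \<comment> \<open>The defects over the halves, the effect of restarting at the true value
      instead of the prediction, and the flow defect, each as a difference between the two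
      solutions.\<close>
    have eq: "\<Delta> s t = \<Delta> u t + \<Delta> s u +
        ((?g u t (y u) - ?g u t ?x) - (?g u t (z u) - ?g u t ?x')) +
        ((davie u t ?x - davie s t (y s)) - (davie u t ?x' - davie s t (z s)))"
      by (simp add: \<Delta>_def)
    have "norm (\<Delta> s t) \<le> M * (h / 2 powr (4 * \<alpha>)) + M * (h / 2 powr (4 * \<alpha>)) + C * (1 + C * C) * ?h * (M * h) + C * ?h * (M * h)"
      unfolding eq by (rule norm_triangle_mono[OF norm_triangle_mono[OF norm_triangle_mono[OF e1 e2] f'] d'])
    also have "\<dots> = (r + G * ?h) * (M * h)"
    proof -
      have r2: "r = 2 / 2 powr (4 * \<alpha>)" by (simp add: r_def powr_diff)
      show ?thesis unfolding r2 G_def by (simp add: algebra_simps)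
    qed
    also have "\<dots> \<le> \<rho> * (M * h)" using G\<eta> M h by (intro mult_right_mono) auto
    finally show ?thesis by (simp add: h_def mult.assoc)
  qed
  have local: "y t = z t" if a: "0 \<le> a" "y a = z a" and t: "a \<le> t" "t \<le> \<delta>" "t \<le> a + \<eta>" for a t
  proof -
    \<comment> \<open>The two Davie bounds start the iteration with \<open>2 * C\<close>; every
      application of \<open>step\<close> gains a factor \<open>\<rho>\<close>.\<close>
    have iter: "norm (\<Delta> s t) \<le> \<rho> ^ n * (2 * C) * ?w s t"
      if "a \<le> s" "s \<le> t" "t \<le> \<delta>" "t \<le> a + \<eta>" for n s t
      using that
    proof (induction n arbitrary: s t)
      case 0
      have "norm (\<Delta> s t) \<le> norm (y t - davie s t (y s)) + norm (z t - davie s t (z s))"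
        unfolding \<Delta>_def by (rule norm_triangle_ineq4)
      also have "\<dots> \<le> C * ?w s t + C * ?w s t"
        using 0 a by (intro add_mono y z) auto
      finally show ?case by simp
    next
      case (Suc n)
      have "norm (\<Delta> s t) \<le> \<rho> * (\<rho> ^ n * (2 * C)) * ?w s t"
        using Suc.prems \<rho> C(1) by (intro step[OF _ a Suc.IH]) auto
      then show ?case by (simp add: mult_ac)
    qed
    have "(\<lambda>n. \<rho> ^ n) \<longlonglongrightarrow> 0" by (rule LIMSEQ_realpow_zero[OF \<rho>])
    then have "(\<lambda>n. \<rho> ^ n * (2 * C) * ?w a t) \<longlonglongrightarrow> 0 * (2 * C) * ?w a t"
      by (intro tendsto_mult tendsto_const)
    then have "norm (\<Delta> a t) \<le> 0 * (2 * C) * ?w a t"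
      using iter[OF order_refl t] by (intro tendsto_lowerbound[OF _ always_eventually]) auto
    then show ?thesis using a by (simp add: \<Delta>_def)
  qed
  \<comment> \<open>\<open>\<eta>\<close> does not depend on the starting time, so agreement can be
    propagated in steps of this length.\<close>
  have "\<forall>t\<in>{0..\<delta>}. t \<le> real n * \<eta> \<longrightarrow> y t = z t" for n
  proof (induction n)
    case 0
    then show ?case using init by auto
  next
    case (Suc n)
    show ?case
    proof (intro ballI impI)
      fix t assume t: "t \<in> {0..\<delta>}" "t \<le> real (Suc n) * \<eta>"
      show "y t = z t"
      proof (cases "t \<le> real n * \<eta>")
        case True then show ?thesis using Suc t by blast
      next
        case False
        have n: "0 \<le> real n * \<eta>" using \<eta> by simp
        then have "real n * \<eta> \<in> {0..\<delta>}" using False t(1) by simp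
        then have yz: "y (real n * \<eta>) = z (real n * \<eta>)" using Suc by blast
        have "real (Suc n) * \<eta> = real n * \<eta> + \<eta>" by (simp add: algebra_simps)
        then show ?thesis using t False by (intro local[OF n yz]) simp_all
      qed
    qed
  qed
  note all = this
  obtain n where "t < real n * \<eta>" using reals_Archimedean3[OF \<eta>(1)] by blast
  then have "t \<le> real n * \<eta>" by simp
  with all t show ?thesis by blast
qed

lemma davie_in_ball:
  assumes "\<delta> \<le> T" "davie_solution 3 R D \<delta> y" and st: "0 \<le> s" "s \<le> t" "t \<le> \<delta>"
  shows "davie s t (y s) \<in> cball 0 (R + D)"
proof -
  note y = davie_solutionD[OF assms(2)]
  have "((t - s) powr \<alpha>) ^ 3 \<le> 1" using width_le1[of s t] st assms(1) by (intro power_le_one) auto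
  then have "norm (y t - davie s t (y s)) \<le> D"
    using y(3)[OF st] mult_left_mono[of "((t - s) powr \<alpha>) ^ 3" 1 D] y(1) by simp
  then show ?thesis
    using y(2)[of t] st norm_triangle_ineq4[of "y t" "y t - davie s t (y s)"] by simp
qed

text \<open>Order 3 is enough: replacing the scheme by the path at the middle time costs the
  Lipschitz constant of \<open>part\<close>, of order 1, times an error of order 3. Together with
  \<open>defect\<close> the germ is additive up to order 4.\<close>

lemma part_integral:
  assumes \<alpha>4: "4 * \<alpha> > 1" and \<delta>: "0 < \<delta>" "\<delta> \<le> T" and sol: "davie_solution 3 R D \<delta> y"
  shows "\<exists>I E. E \<ge> 0 \<and> (\<forall>s t. 0 \<le> s \<longrightarrow> s \<le> t \<longrightarrow> t \<le> \<delta> \<longrightarrow>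
      norm (I t - I s - part a s t (y s)) \<le> E * (t - s) powr (4 * \<alpha>))"
proof -
  note y = davie_solutionD(2,3)[OF sol]
  have "D \<ge> 0" by (rule davie_solutionD(1)[OF sol])
  obtain C where "bounds_on (R + D) C" by (rule bounds_on_exists)
  note C = bounds_onD[OF this]
  have yR: "y t \<in> cball 0 (R + D)" if "t \<in> {0..\<delta>}" for t using y(1)[OF that] \<open>D \<ge> 0\<close> by simp
  note dR = davie_in_ball[OF \<delta>(2) sol]
  have germ: "norm (part a s u (y s) + part a u t (y u) - part a s t (y s)) \<le> (C + C * D) * (t - s) powr (4 * \<alpha>)"
    if st: "0 \<le> s" "s \<le> u" "u \<le> t" "t \<le> \<delta>" for s u t
  proof -
    have "norm (part a u t (y u) - part a u t (davie s u (y s))) \<le> C * (t - u) powr \<alpha> * norm (y u - davie s u (y s))"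
      using st \<delta> by (intro C yR dR) auto
    also have "\<dots> \<le> C * (t - s) powr \<alpha> * (D * ((t - s) powr \<alpha>) ^ 3)"
    proof (intro mult_mono)
      have "((u - s) powr \<alpha>) ^ 3 \<le> ((t - s) powr \<alpha>) ^ 3"
        using st \<alpha> by (intro power_mono powr_mono2) auto
      then show "norm (y u - davie s u (y s)) \<le> D * ((t - s) powr \<alpha>) ^ 3"
        using y(2)[of s u] st mult_left_mono[OF _ \<open>D \<ge> 0\<close>] by (meson order_trans)
    qed (use st C \<alpha> \<open>D \<ge> 0\<close> in \<open>auto intro!: powr_mono2\<close>)
    also have "\<dots> = C * D * (t - s) powr (4 * \<alpha>)"
      by (simp add: width4[symmetric] numeral_eq_Suc)
    finally have 1: "norm (part a u t (y u) - part a u t (davie s u (y s))) \<le> C * D * (t - s) powr (4 * \<alpha>)" .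
    have 2: "norm (defect a s u t (y s)) \<le> C * (t - s) powr (4 * \<alpha>)"
      using st \<delta> by (intro C yR) auto
    have eq: "part a s u (y s) + part a u t (y u) - part a s t (y s) =
        defect a s u t (y s) + (part a u t (y u) - part a u t (davie s u (y s)))"
      by (simp add: defect_def)
    show ?thesis unfolding eq distrib_right by (rule norm_triangle_mono[OF 2 1])
  qed
  have bound: "norm (part a s t (y s)) \<le> C * (t - s) powr \<alpha>" if "0 \<le> s" "s \<le> t" "t \<le> \<delta>" for s t
    using that \<delta> by (intro C yR) auto
  have CD: "0 \<le> C + C * D" using C(1) \<open>D \<ge> 0\<close> by simp
  have \<alpha>le: "\<alpha> \<le> 4 * \<alpha>" using \<alpha> by simp
  show ?thesis
    by (rule sewing[OF \<delta>(1) \<alpha>4 \<alpha> \<alpha>le C(1) CD bound germ]) blast+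
qed

end

section \<open>Enumeration of the forests with at most two vertices\<close>

lemma forest_size_1: "forest_size \<omega> \<le> Suc 0 \<longleftrightarrow> \<omega> = [] \<or> (\<exists>b. \<omega> = [bullet b])"
proof (cases \<omega>)
  case (Cons t \<omega>')
  obtain a ts where t: "t = Node a ts" by (cases t)
  have pos: "forest_size \<rho> = 0 \<longleftrightarrow> \<rho> = []" for \<rho> :: "'a pforest"
  proof (cases \<rho>)
    case (Cons v \<rho>')
    then show ?thesis by (cases v) simp
  qed simp
  show ?thesis using Cons t pos[of \<omega>'] pos[of ts] by (auto simp: forest_size_def[symmetric])
qed simp

lemma num_vertices_Node: "num_vertices (Node a ts) = Suc (forest_size ts)"
  by (simp add: forest_size_def)

lemma forest_size_pos: "\<omega> \<noteq> [] \<Longrightarrow> 0 < forest_size \<omega>"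
proof (cases \<omega>)
  case (Cons t \<omega>')
  then show ?thesis by (cases t) simp
qed simp

lemma forests_le_2_eq:
  "forests_le 2 = {[]} \<union> range (\<lambda>b. [bullet b]) \<union> range (\<lambda>(b, c). [bullet b, bullet c]) \<union>
    range (\<lambda>(b, c). [Node b [bullet c]])" (is "_ = ?S")
proof (intro set_eqI iffI)
  fix \<omega> :: "'a pforest" assume w: "\<omega> \<in> forests_le 2"
  show "\<omega> \<in> ?S"
  proof (cases \<omega>)
    case (Cons t \<omega>')
    obtain a ts where t: "t = Node a ts" by (cases t)
    have sz: "forest_size ts + forest_size \<omega>' \<le> Suc 0"
      using w Cons t by (simp add: forests_le_def num_vertices_Node del: num_vertices.simps)
    show ?thesis
    proof (cases "ts = []")
      case True
      then have "\<omega>' = [] \<or> (\<exists>b. \<omega>' = [bullet b])" using sz forest_size_1[of \<omega>'] by simp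
      then show ?thesis using True Cons t by auto
    next
      case False
      then have "\<omega>' = []" using sz forest_size_pos[of ts] forest_size_pos[of \<omega>'] by fastforce
      moreover have "\<exists>b. ts = [bullet b]" using sz False forest_size_1[of ts] by auto
      ultimately show ?thesis using Cons t by auto
    qed
  qed simp
qed (auto simp: forests_le_def)

lemma sum_forests_le_2:
  fixes f :: "'d::finite pforest \<Rightarrow> 'b::comm_monoid_add"
  shows "(\<Sum>\<tau>\<in>forests_le 2. f \<tau>) = f [] + (\<Sum>b\<in>UNIV. f [bullet b]) +
    (\<Sum>b\<in>UNIV. \<Sum>c\<in>UNIV. f [bullet b, bullet c]) + (\<Sum>b\<in>UNIV. \<Sum>c\<in>UNIV. f [Node b [bullet c]])"
proof -
  have "(\<Sum>\<tau>\<in>forests_le 2. f \<tau>) = sum f {[]} + sum f (range (\<lambda>b. [bullet b])) +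
      sum f (range (\<lambda>(b, c). [bullet b, bullet c])) + sum f (range (\<lambda>(b, c). [Node b [bullet c]]))"
    unfolding forests_le_2_eq by (subst sum.union_disjoint, simp, simp, force)+ simp
  also have "sum f (range (\<lambda>b. [bullet b])) = (\<Sum>b\<in>UNIV. f [bullet b])"
    by (subst sum.reindex) (auto simp: inj_on_def)
  also have "sum f (range (\<lambda>(b, c). [bullet b, bullet c])) = (\<Sum>b\<in>UNIV. \<Sum>c\<in>UNIV. f [bullet b, bullet c])"
    by (subst sum.reindex) (auto simp: inj_on_def sum.cartesian_product case_prod_unfold)
  also have "sum f (range (\<lambda>(b, c). [Node b [bullet c]])) = (\<Sum>b\<in>UNIV. \<Sum>c\<in>UNIV. f [Node b [bullet c]])"
    by (subst sum.reindex) (auto simp: inj_on_def sum.cartesian_product case_prod_unfold)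
  finally show ?thesis by simp
qed

subsection \<open>Solutions of the rough differential equation\<close>

lemma filterlim_partitions_mesh_cong:
  assumes "\<And>\<pi>. \<pi> division_of {0..t} \<Longrightarrow> f \<pi> = g \<pi>"
  shows "(f \<longlongrightarrow> L) (partitions_mesh t) \<longleftrightarrow> (g \<longlongrightarrow> L) (partitions_mesh t)"
  by (intro tendsto_cong) (auto simp: eventually_partitions_mesh assms intro: exI[of _ 1])

lemma controlled_remainder_bound:
  fixes XX :: "real \<Rightarrow> real \<Rightarrow> 'd::finite pforest \<Rightarrow> real"
  assumes "Y \<in> controlled XX \<alpha> \<delta>" "\<tau> \<in> forests_le 2"
  obtains B where "\<And>s t. \<lbrakk>s \<in> {0..\<delta>}; t \<in> {0..\<delta>}; s \<noteq> t\<rbrakk> \<Longrightarrow>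
    norm (remainder XX Y \<tau> s t) / \<bar>t - s\<bar> powr ((3 - real (forest_size \<tau>)) * \<alpha>) \<le> B"
proof -
  have "bdd_above {norm (remainder XX Y \<tau> s t) / \<bar>t - s\<bar> powr ((3 - real (forest_size \<tau>)) * \<alpha>) | s t.
      s \<in> {0..\<delta>} \<and> t \<in> {0..\<delta>} \<and> s \<noteq> t}"
    by (rule bspec[OF conjunct2[OF CollectD[OF assms(1)[unfolded controlled_def]]] assms(2)])
  then obtain B where B: "\<And>x. x \<in> {norm (remainder XX Y \<tau> s t) / \<bar>t - s\<bar> powr ((3 - real (forest_size \<tau>)) * \<alpha>) | s t.
      s \<in> {0..\<delta>} \<and> t \<in> {0..\<delta>} \<and> s \<noteq> t} \<Longrightarrow> x \<le> B"
    unfolding bdd_above_def by blast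
  show thesis
    by (rule that, rule B) blast
qed

text \<open>\<open>controlled\<close> bounds remainders for both orders of the two times, while
  \<open>rough_data\<close> only speaks of increasing times. The reversal identities bridge
  this.\<close>

locale planar_rde =
  rough_data T \<alpha> K "\<lambda>s t a. XX s t [bullet a]" "\<lambda>s t a b. XX s t [Node a [bullet b]]"
    "\<lambda>s t b c. XX s t [bullet b, bullet c]" "\<lambda>s t a b c. XX s t [Node a [bullet b, bullet c]]"
    "\<lambda>s t a b c. XX s t [Node a [Node b [bullet c]]]" F
  for T \<alpha> K :: real and XX :: "real \<Rightarrow> real \<Rightarrow> 'd::finite pforest \<Rightarrow> real"
    and F :: "'d \<Rightarrow> real ^ 'n \<Rightarrow> real ^ 'n" +
  assumes reverse1: "\<lbrakk>0 \<le> s; s \<le> t; t \<le> T\<rbrakk> \<Longrightarrow> XX t s [bullet a] = - XX s t [bullet a]"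
    and reverse2: "\<lbrakk>0 \<le> s; s \<le> t; t \<le> T\<rbrakk> \<Longrightarrow> XX t s [Node a [bullet b]] =
      XX s t [bullet b] * XX s t [bullet a] - XX s t [Node a [bullet b]]"
    and \<alpha>4: "4 * \<alpha> > 1" and T0: "T > 0"
begin

text \<open>The only controlled path above \<open>y\<close> that can solve the equation.\<close>

definition lift :: "(real \<Rightarrow> real ^ 'n) \<Rightarrow> real \<Rightarrow> 'd pforest \<Rightarrow> real ^ 'n" where
  "lift y t \<tau> = (case \<tau> of [] \<Rightarrow> y t | [Node a []] \<Rightarrow> F a (y t)
     | [Node a [Node b []]] \<Rightarrow> V2 a b (y t) | _ \<Rightarrow> 0)"

lemma lift_simps [simp]:
  "lift y t [] = y t"
  "lift y t [bullet a] = F a (y t)"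
  "lift y t [Node a [bullet b]] = V2 a b (y t)"
  "lift y t (u # v # \<omega>) = 0"
  "lift y t [Node a (u # v # \<omega>)] = 0"
  "lift y t [Node a [Node b (u # \<omega>)]] = 0"
  by (simp_all add: lift_def split: list.split ptree.split)

lemma lift_graded: "lift y t \<in> graded_le 2"
  unfolding graded_le_def forests_le_2_eq
  by (auto simp: lift_def split: list.splits ptree.splits)

text \<open>The lift vanishes on two-tree forests, so only the second-derivative term survives
  there; the composition with \<open>F a\<close> then reproduces the coefficients of
  \<open>part a\<close>.\<close>

lemma compose_lift:
  "compose_controlled (F a) (lift y) t [] = F a (y t)"
  "compose_controlled (F a) (lift y) t [bullet b] = V2 a b (y t)"
  "compose_controlled (F a) (lift y) t [bullet b, bullet c] = V3 a b c (y t)"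
  "compose_controlled (F a) (lift y) t [Node b [bullet c]] = V4 a b c (y t)"
  by (simp_all add: compose_controlled_def V2_def V3_def V4_def linear_0[OF smooth_linear[OF F]])

lemma compose_cong:
  fixes G :: "real ^ 'n \<Rightarrow> real ^ 'n" and Y Y' :: "real \<Rightarrow> 'd pforest \<Rightarrow> real ^ 'n"
  assumes "Y t = Y' t"
  shows "compose_controlled G Y t = compose_controlled G Y' t"
proof -
  have const: "compose_controlled G Y t = compose_controlled G (\<lambda>_. Y t) t" for Y :: "real \<Rightarrow> 'd pforest \<Rightarrow> real ^ 'n"
    unfolding compose_controlled_def by (rule refl)
  show ?thesis using const[of Y] const[of Y', symmetric] assms by (simp only:)
qed

lemma rough_sum_lift:
  assumes "\<And>t. t \<in> {0..r} \<Longrightarrow> Y t = lift y t" "\<pi> division_of {0..r}"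
  shows "rough_sum XX (compose_controlled (F a) Y) a \<pi> = (\<Sum>K\<in>\<pi>. part a (Inf K) (Sup K) (y (Inf K)))"
  unfolding rough_sum_def
proof (rule sum.cong[OF refl])
  fix K assume "K \<in> \<pi>"
  then have "Inf K \<in> {0..r}" using division_real_interval[OF assms(2), of K] by auto
  then have "compose_controlled (F a) Y (Inf K) = compose_controlled (F a) (lift y) (Inf K)"
    using assms(1) by (intro compose_cong)
  then show "(\<Sum>\<tau>\<in>forests_le 2. XX (Inf K) (Sup K) [Node a \<tau>] *\<^sub>R compose_controlled (F a) Y (Inf K) \<tau>) =
      part a (Inf K) (Sup K) (y (Inf K))"
    by (simp add: sum_forests_le_2 compose_lift part_def)
qed

text \<open>The integral path has no component on forests with two trees. On a one-vertex tree the
  equation gives \<open>F a\<close>, and inserting this into the composition determines the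
  component on the two-vertex tree.\<close>

lemma solution_is_lift:
  assumes "solves_RDE XX F \<delta> Y" "t \<in> {0..\<delta>}"
  shows "Y t = lift (\<lambda>t. Y t []) t"
proof
  fix \<tau>
  have eq: "Y t \<tau> = unit_multiple (Y 0 []) \<tau> + integral_path XX (\<lambda>a. compose_controlled (F a) Y) t \<tau>" for \<tau>
    using assms unfolding solves_RDE_def by blast
  have b: "Y t [bullet a] = F a (Y t [])" for a
    using eq[of "[bullet a]"]
    by (simp add: unit_multiple_def integral_path_def forests_le_def compose_controlled_def)
  show "Y t \<tau> = lift (\<lambda>t. Y t []) t \<tau>"
  proof (cases \<tau>)
    case (Cons u \<omega>)
    obtain a \<sigma> where u: "u = Node a \<sigma>" by (cases u)
    show ?thesis
    proof (cases \<omega>)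
      case (Cons v \<omega>')
      then show ?thesis using \<open>\<tau> = u # \<omega>\<close> eq[of \<tau>] u by (simp add: unit_multiple_def integral_path_def)
    next
      case Nil
      have e: "Y t [Node a \<sigma>] = (if [Node a \<sigma>] \<in> forests_le 2 then compose_controlled (F a) Y t \<sigma> else 0)"
        using eq[of "[Node a \<sigma>]"] by (simp add: unit_multiple_def integral_path_def)
      have "[Node a \<sigma>] \<in> forests_le 2 \<Longrightarrow> \<sigma> = [] \<or> (\<exists>b. \<sigma> = [bullet b])"
        unfolding forests_le_2_eq by auto
      then consider "\<sigma> = []" | b where "\<sigma> = [bullet b]" | "[Node a \<sigma>] \<notin> forests_le 2"
        by blast
      then have "Y t [Node a \<sigma>] = lift (\<lambda>t. Y t []) t [Node a \<sigma>]"
      proof cases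
        case 1
        then show ?thesis using b by simp
      next
        case (2 c)
        then show ?thesis using e b
          by (simp add: forests_le_def compose_controlled_def V2_def)
      next
        case 3
        then have "lift (\<lambda>t. Y t []) t [Node a \<sigma>] = 0"
          using lift_graded[of "\<lambda>t. Y t []" t] unfolding graded_le_def by blast
        then show ?thesis using e 3 by simp
      qed
      then show ?thesis using \<open>\<tau> = u # \<omega>\<close> Nil u by simp
    qed
  qed simp
qed

text \<open>The remainder subtracts only the terms up to degree 2, so the degree 3 part
  \<open>h3\<close> of the scheme is left over and the remainder has order 3 only.\<close>

lemma remainder_lift_Nil:
  assumes "Y s = lift y s" "Y t = lift y t"
  shows "remainder XX Y [] s t = y t - davie s t (y s) + h3 s t (y s)"
  using assms by (simp add: remainder_def davie_eq h1_def h2_def)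

text \<open>Stated for Davie solutions of order 3 so that it serves both directions: raising the
  order for a given solution and verifying the equation for a constructed one.\<close>

lemma lift_integral:
  assumes \<delta>: "0 < \<delta>" "\<delta> \<le> T" and sol: "davie_solution 3 R D \<delta> y"
    and Y: "\<And>t. t \<in> {0..\<delta>} \<Longrightarrow> Y t = lift y t"
  obtains J E where "E \<ge> 0" "\<And>a. J a 0 = 0"
    "\<And>a r. r \<in> {0..\<delta>} \<Longrightarrow> (rough_sum XX (compose_controlled (F a) Y) a \<longlongrightarrow> J a r) (partitions_mesh r)"
    "\<And>a r. r \<in> {0..\<delta>} \<Longrightarrow> rough_integral XX (compose_controlled (F a) Y) a r = J a r"
    "\<And>s t. \<lbrakk>0 \<le> s; s \<le> t; t \<le> \<delta>\<rbrakk> \<Longrightarrow>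
      norm ((\<Sum>a\<in>UNIV. J a t) - (\<Sum>a\<in>UNIV. J a s) - (davie s t (y s) - y s)) \<le> E * (t - s) powr (4 * \<alpha>)"
proof -
  have "\<forall>a. \<exists>I E. E \<ge> 0 \<and> (\<forall>s t. 0 \<le> s \<longrightarrow> s \<le> t \<longrightarrow> t \<le> \<delta> \<longrightarrow>
      norm (I t - I s - part a s t (y s)) \<le> E * (t - s) powr (4 * \<alpha>))"
    by (intro allI part_integral[OF \<alpha>4 \<delta> sol])
  from choice[OF this] obtain I where "\<forall>a. \<exists>E. E \<ge> 0 \<and> (\<forall>s t. 0 \<le> s \<longrightarrow> s \<le> t \<longrightarrow> t \<le> \<delta> \<longrightarrow>
      norm (I a t - I a s - part a s t (y s)) \<le> E * (t - s) powr (4 * \<alpha>))" by blast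
  from choice[OF this] obtain E where E: "\<And>a. E a \<ge> 0" "\<And>a s t. \<lbrakk>0 \<le> s; s \<le> t; t \<le> \<delta>\<rbrakk> \<Longrightarrow>
      norm (I a t - I a s - part a s t (y s)) \<le> E a * (t - s) powr (4 * \<alpha>)" by blast
  have lim: "(rough_sum XX (compose_controlled (F a) Y) a \<longlongrightarrow> I a r - I a 0) (partitions_mesh r)"
    if r: "r \<in> {0..\<delta>}" for a r
  proof -
    have "((\<lambda>\<pi>. \<Sum>K\<in>\<pi>. part a (Inf K) (Sup K) (y (Inf K))) \<longlongrightarrow> I a r - I a 0) (partitions_mesh r)"
      by (rule mesh_limit[OF _ \<alpha>4 E(1)[of a]]) (use r E(2)[of _ _ a] in auto)
    then show ?thesis
      using r by (subst filterlim_partitions_mesh_cong[OF rough_sum_lift[where y = y]]) (auto intro: Y)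
  qed
  show thesis
  proof (rule that[where J = "\<lambda>a r. I a r - I a 0"])
    show "0 \<le> (\<Sum>a\<in>UNIV. E a)" using E(1) by (intro sum_nonneg) auto
    show "I a 0 - I a 0 = 0" for a by simp
    fix a r assume r: "r \<in> {0..\<delta>}"
    show "(rough_sum XX (compose_controlled (F a) Y) a \<longlongrightarrow> I a r - I a 0) (partitions_mesh r)" by (rule lim[OF r])
    show "rough_integral XX (compose_controlled (F a) Y) a r = I a r - I a 0"
      unfolding rough_integral_def using partitions_mesh_nontrivial[of r] r by (intro tendsto_Lim lim) auto
  next
    fix s t assume st: "0 \<le> s" "s \<le> t" "t \<le> \<delta>"
    have "(\<Sum>a\<in>UNIV. I a t - I a 0) - (\<Sum>a\<in>UNIV. I a s - I a 0) - (davie s t (y s) - y s) =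
        (\<Sum>a\<in>UNIV. I a t - I a s - part a s t (y s))"
      by (simp add: davie_def sum_subtractf)
    also have "norm \<dots> \<le> (\<Sum>a\<in>UNIV. E a * (t - s) powr (4 * \<alpha>))"
      using st E(2) by (intro order_trans[OF norm_sum] sum_mono) auto
    finally show "norm ((\<Sum>a\<in>UNIV. I a t - I a 0) - (\<Sum>a\<in>UNIV. I a s - I a 0) - (davie s t (y s) - y s))
        \<le> (\<Sum>a\<in>UNIV. E a) * (t - s) powr (4 * \<alpha>)"
      by (simp add: sum_distrib_right)
  qed
qed

text \<open>Bootstrap: the controlled remainder gives a Davie solution of order 3, its integrals
  then exist with error of order 4, and by the equation the increments of the path are those
  integrals.\<close>

lemma solution_is_davie:
  assumes \<delta>: "0 < \<delta>" "\<delta> \<le> T" and Y: "Y \<in> controlled XX \<alpha> \<delta>" "solves_RDE XX F \<delta> Y"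
  obtains R D where "davie_solution 4 R D \<delta> (\<lambda>t. Y t [])"
proof -
  let ?y = "\<lambda>t. Y t []"
  let ?w = "\<lambda>s t. ((t - s) powr \<alpha>) ^ 3"
    and ?r = "\<lambda>s t. ?y t - davie s t (?y s) + h3 s t (?y s)"
  have lift: "Y t = lift ?y t" if "t \<in> {0..\<delta>}" for t by (rule solution_is_lift[OF Y(2) that])
  obtain B where B: "\<And>s t. \<lbrakk>s \<in> {0..\<delta>}; t \<in> {0..\<delta>}; s \<noteq> t\<rbrakk> \<Longrightarrow>
      norm (remainder XX Y [] s t) / \<bar>t - s\<bar> powr (3 * \<alpha>) \<le> B"
    by (rule controlled_remainder_bound[OF Y(1), of "[]"]) (auto simp: forests_le_def)
  define B' where "B' = max B 0"
  have w3: "\<bar>t - s\<bar> powr (3 * \<alpha>) = (\<bar>t - s\<bar> powr \<alpha>) ^ 3" if "s \<noteq> t" for s t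
    using that by (simp add: powr_realpow[symmetric] powr_powr mult.commute)
  have rem: "norm (?r s t) \<le> B' * ?w s t"
    if st: "0 \<le> s" "s < t" "t \<le> \<delta>" for s t
  proof -
    have "norm (remainder XX Y [] s t) / \<bar>t - s\<bar> powr (3 * \<alpha>) \<le> B" using st by (intro B) auto
    then have "norm (remainder XX Y [] s t) \<le> B * ?w s t"
      using st w3[of s t] by (simp add: divide_le_eq)
    also have "\<dots> \<le> B' * ?w s t" unfolding B'_def by (intro mult_right_mono) auto
    finally have "norm (remainder XX Y [] s t) \<le> B' * ?w s t" .
    moreover have "remainder XX Y [] s t = ?r s t"
      by (rule remainder_lift_Nil; rule lift) (use st in simp_all)
    ultimately show ?thesis by (simp only:)
  qed
  obtain C0 where "bounds_on (norm (?y 0)) C0" by (rule bounds_on_exists)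
  note C0 = bounds_onD[OF this]
  \<comment> \<open>A priori bound from one expansion at time 0: the displacement and
    \<open>h3\<close> are each at most \<open>C0\<close>, the remainder at most \<open>B'\<close>,
    since all widths are at most 1.\<close>
  define R where "R = norm (?y 0) + C0 + B' + C0"
  have B': "B' \<ge> 0" by (simp add: B'_def)
  have yR: "?y t \<in> cball 0 R" if t: "t \<in> {0..\<delta>}" for t
  proof (cases "t = 0")
    case True then show ?thesis using B' C0(1) by (simp add: R_def)
  next
    case False
    then have t': "0 \<le> t" "0 < t" "t \<le> \<delta>" "t \<le> T" using t \<delta> by auto
    have w: "0 \<le> t powr \<alpha>" "t powr \<alpha> \<le> 1" using width_le1[of 0 t] t' by auto
    then have w3: "(t powr \<alpha>) ^ 3 \<le> 1" by (intro power_le_one)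
    have 1: "norm (?r 0 t) \<le> B'"
      using rem[of 0 t] t' mult_left_mono[OF w3 B'] by simp
    have 2: "norm (h3 0 t (?y 0)) \<le> C0"
      using C0(5)[of 0 t "?y 0"] t' mult_left_mono[OF w3 C0(1)] by simp
    have "norm (davie 0 t (?y 0) - ?y 0) \<le> C0 * (t - 0) powr \<alpha>" using t' by (intro C0) auto
    also have "\<dots> \<le> C0" using mult_left_mono[OF w(2) C0(1)] by simp
    finally have 3: "norm (davie 0 t (?y 0) - ?y 0) \<le> C0" .
    have eq: "?y t = ?y 0 + (davie 0 t (?y 0) - ?y 0) + (?r 0 t) - h3 0 t (?y 0)"
      by simp
    have "norm (?y t) \<le> norm (?y 0) + C0 + B' + C0"
      by (subst eq) (rule order_trans[OF norm_triangle_ineq4 add_mono[OF norm_triangle_mono[OF norm_triangle_mono[OF order_refl 3] 1] 2]])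
    then show ?thesis by (simp add: R_def)
  qed
  obtain C where "bounds_on R C" by (rule bounds_on_exists)
  note C = bounds_onD[OF this]
  have weak: "norm (?y t - davie s t (?y s)) \<le> (B' + C) * ?w s t"
    if st: "0 \<le> s" "s \<le> t" "t \<le> \<delta>" for s t
  proof (cases "s = t")
    case True
    have "part a s s (?y s) = 0" for a using C(2)[OF _ _ _ yR, of s s s a] st \<delta> by simp
    then have "davie s s (?y s) = ?y s" by (simp add: davie_def)
    then show ?thesis using True by simp
  next
    case False
    have 2: "norm (h3 s t (?y s)) \<le> C * ?w s t" using st \<delta> by (intro C yR) auto
    have eq: "?y t - davie s t (?y s) = (?r s t) - h3 s t (?y s)" by simp
    show ?thesis
      by (subst eq, subst distrib_right) (rule order_trans[OF norm_triangle_ineq4 add_mono[OF rem 2]], use st False in auto)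
  qed
  have "davie_solution 3 R (B' + C) \<delta> ?y"
    using B' C(1) by (intro davie_solutionI yR weak) auto
  then show thesis
  proof (rule lift_integral[OF \<delta> _ lift])
    fix J E
    assume E: "E \<ge> 0" and int: "\<And>a r. r \<in> {0..\<delta>} \<Longrightarrow> rough_integral XX (compose_controlled (F a) Y) a r = J a r"
      and J: "\<And>s t. \<lbrakk>0 \<le> s; s \<le> t; t \<le> \<delta>\<rbrakk> \<Longrightarrow>
        norm ((\<Sum>a\<in>UNIV. J a t) - (\<Sum>a\<in>UNIV. J a s) - (davie s t (?y s) - ?y s)) \<le> E * (t - s) powr (4 * \<alpha>)"
    have yJ: "?y r = ?y 0 + (\<Sum>a\<in>UNIV. J a r)" if r: "r \<in> {0..\<delta>}" for r
    proof -
      have "Y r [] = unit_multiple (Y 0 []) ([] :: 'd pforest) + integral_path XX (\<lambda>a. compose_controlled (F a) Y) r []"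
        using Y(2) r unfolding solves_RDE_def by blast
      then show ?thesis by (simp add: unit_multiple_def integral_path_def int[OF r])
    qed
    show thesis
    proof (rule that, rule davie_solutionI[OF E yR])
      fix s t assume st: "0 \<le> s" "s \<le> t" "t \<le> \<delta>"
      have "?y t - ?y s = (\<Sum>a\<in>UNIV. J a t) - (\<Sum>a\<in>UNIV. J a s)"
        using yJ[of s] yJ[of t] st by simp
      then have eq: "?y t - davie s t (?y s) = (\<Sum>a\<in>UNIV. J a t) - (\<Sum>a\<in>UNIV. J a s) - (davie s t (?y s) - ?y s)"
        by (simp add: algebra_simps)
      show "norm (?y t - davie s t (?y s)) \<le> E * ((t - s) powr \<alpha>) ^ 4"
        unfolding eq width4 by (rule J[OF st])
    qed
  qed
qed

end

lemma norm_sum_scaleR_le: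
  fixes v :: "'i :: finite \<Rightarrow> 'a :: real_normed_vector"
  assumes "\<And>i. \<bar>c i\<bar> \<le> A" "\<And>i. norm (v i) \<le> B"
  shows "norm (\<Sum>i\<in>UNIV. c i *\<^sub>R v i) \<le> real CARD('i) * (A * B)"
proof -
  have "norm (c i *\<^sub>R v i) \<le> A * B" for i
    using assms(1)[of i] assms(2)[of i] by (auto intro!: mult_mono)
  then show ?thesis by (intro order_trans[OF norm_sum sum_bounded_above])
qed

text \<open>The natural-number difference in the exponent is harmless, as these forests have at most
  two vertices.\<close>

lemma controlledI:
  assumes "Y \<in> {0..\<delta>} \<rightarrow>\<^sub>E graded_le 2"
    and "\<And>\<tau>. \<tau> \<in> forests_le 2 \<Longrightarrow> \<exists>B. \<forall>s\<in>{0..\<delta>}. \<forall>t\<in>{0..\<delta>}. s \<noteq> t \<longrightarrow>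
      norm (remainder XX Y \<tau> s t) \<le> B * (\<bar>t - s\<bar> powr \<alpha>) ^ (3 - forest_size \<tau>)"
  shows "Y \<in> controlled XX \<alpha> \<delta>"
  unfolding controlled_def
proof (intro CollectI conjI ballI assms(1))
  fix \<tau> :: "'a pforest" assume \<tau>: "\<tau> \<in> forests_le 2"
  then obtain B where B: "\<forall>s\<in>{0..\<delta>}. \<forall>t\<in>{0..\<delta>}. s \<noteq> t \<longrightarrow>
      norm (remainder XX Y \<tau> s t) \<le> B * (\<bar>t - s\<bar> powr \<alpha>) ^ (3 - forest_size \<tau>)"
    using assms(2) by blast
  have sz: "real (3 - forest_size \<tau>) = 3 - real (forest_size \<tau>)"
    using \<tau> by (simp add: forests_le_def of_nat_diff)
  have "norm (remainder XX Y \<tau> s t) / \<bar>t - s\<bar> powr ((3 - real (forest_size \<tau>)) * \<alpha>) \<le> B"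
    if "s \<in> {0..\<delta>}" "t \<in> {0..\<delta>}" "s \<noteq> t" for s t
  proof -
    have "(\<bar>t - s\<bar> powr \<alpha>) ^ (3 - forest_size \<tau>) = \<bar>t - s\<bar> powr ((3 - real (forest_size \<tau>)) * \<alpha>)"
      using that(3) by (simp add: powr_realpow[symmetric] powr_powr sz mult.commute)
    moreover have "norm (remainder XX Y \<tau> s t) \<le> B * (\<bar>t - s\<bar> powr \<alpha>) ^ (3 - forest_size \<tau>)"
      using B that by blast
    ultimately show ?thesis using that(3) by (simp add: divide_le_eq)
  qed
  then show "bdd_above {norm (remainder XX Y \<tau> s t) / \<bar>t - s\<bar> powr ((3 - real (forest_size \<tau>)) * \<alpha>) | s t.
      s \<in> {0..\<delta>} \<and> t \<in> {0..\<delta>} \<and> s \<noteq> t}"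
    by (intro bdd_aboveI[of _ B]) blast
qed

context planar_rde
begin

text \<open>The backward remainder is rewritten about the earlier time \<open>p\<close>, so that
  only forward estimates are needed: the three groups have orders 3, 1 + 2 and 2 + 1.\<close>

lemma remainder_lift_reverse:
  assumes pq: "0 \<le> p" "p \<le> q" "q \<le> T" and Y: "Y p = lift y p" "Y q = lift y q"
  shows "remainder XX Y [] q p = - (y q - y p - h1 p q (y p) - h2 p q (y p)) +
    (\<Sum>a\<in>UNIV. XX p q [bullet a] *\<^sub>R (F a (y q) - F a (y p) - (\<Sum>b\<in>UNIV. XX p q [bullet b] *\<^sub>R V2 a b (y p)))) +
    (\<Sum>a\<in>UNIV. \<Sum>b\<in>UNIV. (XX p q [Node a [bullet b]] - XX p q [bullet a] * XX p q [bullet b]) *\<^sub>R (V2 a b (y q) - V2 a b (y p)))"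
  using Y by (simp add: remainder_def h1_def h2_def reverse1[OF pq] reverse2[OF pq] scaleR_diff_left
      scaleR_diff_right scaleR_sum_right sum_subtractf sum.distrib sum_negf mult.commute)

text \<open>Controlledness rests on \<open>fC\<close>, \<open>fA\<close> and \<open>fB\<close>, the
  forward estimates of order 3, 2 and 1 on forests with zero, one and two vertices. Full order 4 is
  used for the equation itself.\<close>

lemma davie_is_solution:
  assumes \<delta>: "0 < \<delta>" "\<delta> \<le> T" and sol: "davie_solution 4 R D \<delta> y"
  shows "restrict (lift y) {0..\<delta>} \<in> controlled XX \<alpha> \<delta>" "solves_RDE XX F \<delta> (restrict (lift y) {0..\<delta>})"
proof -
  define Y where "Y = restrict (lift y) {0..\<delta>}"
  have Y: "Y t = lift y t" if "t \<in> {0..\<delta>}" for t using that by (simp add: Y_def)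
  let ?w = "\<lambda>s t. (t - s) powr \<alpha>"
  let ?A = "\<lambda>p q a. F a (y q) - F a (y p) - (\<Sum>b\<in>UNIV. XX p q [bullet b] *\<^sub>R V2 a b (y p))"
    and ?B = "\<lambda>p q a b. V2 a b (y q) - V2 a b (y p)"
    and ?X = "\<lambda>p q a b. XX p q [Node a [bullet b]] - XX p q [bullet a] * XX p q [bullet b]"
  have w: "0 \<le> ?w s t" "?w s t \<le> 1" if "0 \<le> s" "s \<le> t" "t \<le> \<delta>" for s t
    using width_le1[of s t] that \<delta> by auto
  have sol3: "davie_solution 3 R D \<delta> y"
    by (rule davie_solution_mono[OF sol order_refl order_refl _ \<delta>(2)]) simp
  note D = davie_solutionD(1)[OF sol] and yR = davie_solutionD(2)[OF sol] and yD3 = davie_solutionD(3)[OF sol3]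
    and dR = davie_in_ball[OF \<delta>(2) sol3]
  obtain C where "bounds_on R C" by (rule bounds_on_exists)
  note C = bounds_onD[OF this]
  obtain L where "bounds_on (R + D) L" by (rule bounds_on_exists)
  note L = bounds_onD[OF this]
  have T0': "0 \<le> T" using T0 by simp
  define N where "N = real CARD('d)"
  have N: "N \<ge> 0" by (simp add: N_def)
  have fC: "norm (y q - y p - h1 p q (y p) - h2 p q (y p)) \<le> (D + C) * ?w p q ^ 3"
    if pq: "0 \<le> p" "p \<le> q" "q \<le> \<delta>" for p q
  proof -
    have eq: "y q - y p - h1 p q (y p) - h2 p q (y p) = (y q - davie p q (y p)) + h3 p q (y p)"
      by (simp add: davie_eq)
    show ?thesis unfolding eq distrib_right
      using pq \<delta> by (intro norm_triangle_mono yD3 C yR) auto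
  qed
  have yhoelder: "norm (y q - y p) \<le> (D + C) * ?w p q" if pq: "0 \<le> p" "p \<le> q" "q \<le> \<delta>" for p q
  proof -
    have "?w p q ^ 3 \<le> ?w p q ^ 1" using w[OF pq] by (intro power_decreasing) auto
    then have 1: "norm (y q - davie p q (y p)) \<le> D * ?w p q"
      using yD3[OF pq] mult_left_mono[OF _ D, of "?w p q ^ 3" "?w p q"] by simp
    have 2: "norm (davie p q (y p) - y p) \<le> C * ?w p q" using pq \<delta> by (intro C yR) auto
    have eq: "y q - y p = (y q - davie p q (y p)) + (davie p q (y p) - y p)" by simp
    show ?thesis unfolding eq distrib_right by (rule norm_triangle_mono[OF 1 2])
  qed
  have yR': "y t \<in> cball 0 (R + D)" if "t \<in> {0..\<delta>}" for t using yR[OF that] D by simp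
  have fA: "norm (?A p q a) \<le> (L * D + C) * ?w p q ^ 2"
    if pq: "0 \<le> p" "p \<le> q" "q \<le> \<delta>" for a p q
  proof -
    have "norm (F a (y q) - F a (davie p q (y p))) \<le> L * norm (y q - davie p q (y p))"
      using pq by (intro L dR yR' T0') auto
    also have "\<dots> \<le> L * (D * ?w p q ^ 3)" using yD3[OF pq] L(1) by (rule mult_left_mono)
    also have "\<dots> \<le> L * (D * ?w p q ^ 2)"
      using w[OF pq] L(1) D by (intro mult_left_mono power_decreasing) auto
    finally have 1: "norm (F a (y q) - F a (davie p q (y p))) \<le> L * D * ?w p q ^ 2" by (simp add: mult.assoc)
    have 2: "norm (F a (davie p q (y p)) - F a (y p) - (\<Sum>b\<in>UNIV. XX p q [bullet b] *\<^sub>R V2 a b (y p))) \<le> C * ?w p q ^ 2"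
      using pq \<delta> by (intro C yR) auto
    \<comment> \<open>Replacing the path by the scheme costs order 3, so the order 2 of
      \<open>OL_first_order\<close> survives.\<close>
    have eq: "?A p q a =
        (F a (y q) - F a (davie p q (y p))) + (F a (davie p q (y p)) - F a (y p) - (\<Sum>b\<in>UNIV. XX p q [bullet b] *\<^sub>R V2 a b (y p)))"
      by simp
    show ?thesis unfolding distrib_right by (subst eq) (rule norm_triangle_mono[OF 1 2])
  qed
  define M where "M = C * (D + C)"
  have M: "M \<ge> 0" using D N C(1) by (simp add: M_def)
  have fB: "norm (?B p q a b) \<le> M * ?w p q" if pq: "0 \<le> p" "p \<le> q" "q \<le> \<delta>" for a b p q
  proof -
    have "norm (?B p q a b) \<le> C * norm (y q - y p)" using pq by (intro C yR T0') auto
    also have "\<dots> \<le> C * ((D + C) * ?w p q)" using yhoelder[OF pq] C(1) by (rule mult_left_mono)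
    finally show ?thesis by (simp add: M_def mult.assoc)
  qed
  show "restrict (lift y) {0..\<delta>} \<in> controlled XX \<alpha> \<delta>"
    unfolding Y_def[symmetric]
  proof (rule controlledI)
    show "Y \<in> {0..\<delta>} \<rightarrow>\<^sub>E graded_le 2"
      unfolding Y_def using lift_graded by auto
    fix \<tau> :: "'d pforest" assume "\<tau> \<in> forests_le 2"
    let ?r = "remainder XX Y \<tau>"
    have both: "\<exists>B. \<forall>s\<in>{0..\<delta>}. \<forall>t\<in>{0..\<delta>}. s \<noteq> t \<longrightarrow>
        norm (?r s t) \<le> B * (\<bar>t - s\<bar> powr \<alpha>) ^ k"
      if f: "\<And>p q. \<lbrakk>0 \<le> p; p \<le> q; q \<le> \<delta>\<rbrakk> \<Longrightarrow> norm (?r p q) \<le> B1 * ?w p q ^ k"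
        and b: "\<And>p q. \<lbrakk>0 \<le> p; p \<le> q; q \<le> \<delta>\<rbrakk> \<Longrightarrow> norm (?r q p) \<le> B2 * ?w p q ^ k" for B1 B2 k
    proof (intro exI[of _ "max B1 B2"] ballI impI)
      fix s t assume st: "s \<in> {0..\<delta>}" "t \<in> {0..\<delta>}" "s \<noteq> t"
      have mx: "B1 * v ^ k \<le> max B1 B2 * v ^ k" "B2 * v ^ k \<le> max B1 B2 * v ^ k" if "v \<ge> 0" for v
        using that by (auto intro: mult_right_mono)
      show "norm (?r s t) \<le> max B1 B2 * (\<bar>t - s\<bar> powr \<alpha>) ^ k"
      proof (cases "s \<le> t")
        case True
        then show ?thesis using order_trans[OF f[of s t] mx(1)] st by simp
      next
        case False
        then show ?thesis using order_trans[OF b[of t s] mx(2)] st by (simp add: abs_minus_commute)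
      qed
    qed
    have Y_lift: "Y p = lift y p" "Y q = lift y q" if "0 \<le> p" "p \<le> q" "q \<le> \<delta>" for p q
      using that by (auto intro: Y)
    from \<open>\<tau> \<in> forests_le 2\<close> consider "\<tau> = []" | a where "\<tau> = [bullet a]" | a b where "\<tau> = [bullet a, bullet b]"
      | a b where "\<tau> = [Node a [bullet b]]"
      unfolding forests_le_2_eq by auto
    then show "\<exists>B. \<forall>s\<in>{0..\<delta>}. \<forall>t\<in>{0..\<delta>}. s \<noteq> t \<longrightarrow>
        norm (?r s t) \<le> B * (\<bar>t - s\<bar> powr \<alpha>) ^ (3 - forest_size \<tau>)"
    proof cases
      case 1
      show ?thesis
      proof (rule both)
        fix p q assume pq: "0 \<le> p" "p \<le> q" "q \<le> \<delta>"
        have pT: "q \<le> T" using pq \<delta> by simp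
        note Ypq = Y_lift[OF pq]
        have k: "3 - forest_size \<tau> = 3" using 1 by simp
        have "?r p q = y q - y p - h1 p q (y p) - h2 p q (y p)"
          unfolding 1 using Ypq by (simp add: remainder_lift_Nil[of Y p y q] davie_eq)
        then show "norm (?r p q) \<le> (D + C) * ?w p q ^ (3 - forest_size \<tau>)"
          using fC[OF pq] k by simp
        have x1: "\<bar>XX p q [bullet a]\<bar> \<le> K * ?w p q" for a using bound1 pq pT by simp
        have x2: "\<bar>XX p q [Node a [bullet b]]\<bar> \<le> K * ?w p q ^ 2" for a b using bound2 pq pT by simp
        have x3: "\<bar>?X p q a b\<bar> \<le> (K + K * K) * ?w p q ^ 2" for a b
        proof -
          have "\<bar>XX p q [bullet a] * XX p q [bullet b]\<bar> \<le> (K * ?w p q) * (K * ?w p q)"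
            unfolding abs_mult using x1[of a] x1[of b] K w[OF pq] by (intro mult_mono) auto
          then show ?thesis
            using x2[of a b] abs_triangle_ineq4[of "XX p q [Node a [bullet b]]" "XX p q [bullet a] * XX p q [bullet b]"]
            by (simp add: algebra_simps power2_eq_square)
        qed
        have n0: "norm (- (y q - y p - h1 p q (y p) - h2 p q (y p))) \<le> (D + C) * ?w p q ^ 3"
          unfolding norm_minus_cancel by (rule fC[OF pq])
        note n1 = norm_sum_scaleR_le[OF x1 fA[OF pq]]
        note n2 = order_trans[OF norm_sum sum_bounded_above[OF norm_sum_scaleR_le[OF x3 fB[OF pq]]]]
        have "norm (remainder XX Y [] q p) \<le> (D + C) * ?w p q ^ 3 + N * (K * ?w p q * ((L * D + C) * ?w p q ^ 2)) +
            N * (N * ((K + K * K) * ?w p q ^ 2 * (M * ?w p q)))"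
          unfolding remainder_lift_reverse[OF pq(1,2) pT Ypq] N_def
          by (rule norm_triangle_mono[OF norm_triangle_mono[OF n0 n1] n2])
        also have "\<dots> = ((D + C) + N * (K * (L * D + C)) + N * (N * ((K + K * K) * M))) * ?w p q ^ 3"
          by (simp add: algebra_simps numeral_eq_Suc)
        finally show "norm (?r q p) \<le>
            ((D + C) + N * (K * (L * D + C)) + N * (N * ((K + K * K) * M))) * ?w p q ^ (3 - forest_size \<tau>)"
          unfolding 1 forest_size_simps diff_zero .
      qed
    next
      case (2 a)
      show ?thesis
      proof (rule both)
        fix p q assume pq: "0 \<le> p" "p \<le> q" "q \<le> \<delta>"
        have pT: "q \<le> T" using pq \<delta> by simp
        note Ypq = Y_lift[OF pq]
        have k: "3 - forest_size \<tau> = 2" using 2 by simp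
        have "?r p q = ?A p q a"
          unfolding 2 using Ypq by (simp add: remainder_def)
        then show "norm (?r p q) \<le> (L * D + C) * ?w p q ^ (3 - forest_size \<tau>)"
          using fA[OF pq, of a] k by simp
        have 3: "norm (\<Sum>b\<in>UNIV. XX p q [bullet b] *\<^sub>R ?B p q a b) \<le> N * (K * ?w p q * (M * ?w p q))"
          unfolding N_def using bound1 pq pT fB[OF pq] by (intro norm_sum_scaleR_le) auto
        have eq: "?r q p = (\<Sum>b\<in>UNIV. XX p q [bullet b] *\<^sub>R ?B p q a b) -
            ?A p q a"
          unfolding 2 using Ypq
          by (simp add: remainder_def reverse1[OF pq(1,2) pT] sum_negf scaleR_diff_right sum_subtractf)
        show "norm (?r q p) \<le> (N * (K * M) + (L * D + C)) * ?w p q ^ (3 - forest_size \<tau>)"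
          unfolding k eq
          using order_trans[OF norm_triangle_ineq4 add_mono[OF 3 fA[OF pq, of a]]]
          by (simp add: algebra_simps power2_eq_square)
      qed
    next
      case (3 a b)
      show ?thesis
      proof (rule both[of 0 _ 0])
        fix p q assume pq: "0 \<le> p" "p \<le> q" "q \<le> \<delta>"
        note Ypq = Y_lift[OF pq]
        show "norm (?r p q) \<le> 0 * ?w p q ^ (3 - forest_size \<tau>)"
          "norm (?r q p) \<le> 0 * ?w p q ^ (3 - forest_size \<tau>)"
          unfolding 3 using Ypq by (simp_all add: remainder_def)
      qed
    next
      case (4 a b)
      show ?thesis
      proof (rule both)
        fix p q assume pq: "0 \<le> p" "p \<le> q" "q \<le> \<delta>"
        note Ypq = Y_lift[OF pq]
        show "norm (?r p q) \<le> M * ?w p q ^ (3 - forest_size \<tau>)"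
          "norm (?r q p) \<le> M * ?w p q ^ (3 - forest_size \<tau>)"
          unfolding 4 using Ypq fB[OF pq, of a b] by (simp_all add: remainder_def norm_minus_commute)
      qed
    qed
  qed
  show "solves_RDE XX F \<delta> (restrict (lift y) {0..\<delta>})"
    unfolding Y_def[symmetric]
  proof (rule lift_integral[OF \<delta> sol3 Y])
    fix J E
    assume E: "E \<ge> 0" and J0: "\<And>a. J a 0 = 0"
      and rlim: "\<And>a r. r \<in> {0..\<delta>} \<Longrightarrow> (rough_sum XX (compose_controlled (F a) Y) a \<longlongrightarrow> J a r) (partitions_mesh r)"
      and int: "\<And>a r. r \<in> {0..\<delta>} \<Longrightarrow> rough_integral XX (compose_controlled (F a) Y) a r = J a r"
      and J: "\<And>s t. \<lbrakk>0 \<le> s; s \<le> t; t \<le> \<delta>\<rbrakk> \<Longrightarrow>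
        norm ((\<Sum>a\<in>UNIV. J a t) - (\<Sum>a\<in>UNIV. J a s) - (davie s t (y s) - y s)) \<le> E * (t - s) powr (4 * \<alpha>)"
    have zero: "0 \<in> {0..\<delta>}" using \<delta> by simp
    \<comment> \<open>\<open>y\<close> and the sum of the integrals differ by a path of order \<open>4 \<alpha> > 1\<close>, which is constant.\<close>
    define g where "g t = y t - (\<Sum>a\<in>UNIV. J a t)" for t
    have g: "norm (g t - g s - 0) \<le> (D + E) * (t - s) powr (4 * \<alpha>)" if st: "0 \<le> s" "s \<le> t" "t \<le> \<delta>" for s t
    proof -
      have "g t - g s - 0 = (y t - davie s t (y s)) - ((\<Sum>a\<in>UNIV. J a t) - (\<Sum>a\<in>UNIV. J a s) - (davie s t (y s) - y s))"
        by (simp add: g_def)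
      then show ?thesis
        using order_trans[OF norm_triangle_ineq4 add_mono[OF davie_solutionD(3)[OF sol st] J[OF st]]]
        by (simp add: width4 distrib_right)
    qed
    have yJ: "y r = y 0 + (\<Sum>a\<in>UNIV. J a r)" if r: "r \<in> {0..\<delta>}" for r
    proof -
      have "((\<lambda>\<pi>. \<Sum>K\<in>\<pi>. 0) \<longlongrightarrow> g r - g 0) (partitions_mesh r)"
        by (rule mesh_limit[where \<Xi> = "\<lambda>_ _. 0", OF _ \<alpha>4 _ g]) (use r D E in auto)
      then have "g r - g 0 = 0"
        using partitions_mesh_nontrivial[of r] r by (intro tendsto_unique[OF _ _ tendsto_const]) auto
      then show ?thesis by (simp add: g_def J0 algebra_simps)
    qed
    show "solves_RDE XX F \<delta> Y"
      unfolding solves_RDE_def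
    proof (intro ballI conjI allI)
      fix t a assume t: "t \<in> {0..\<delta>}"
      show "rough_integrable XX (compose_controlled (F a) Y) a t"
        unfolding rough_integrable_def using rlim[OF t] by blast
    next
      fix t and \<tau> :: "'d pforest" assume t: "t \<in> {0..\<delta>}"
      have cl: "compose_controlled (F a) Y t = compose_controlled (F a) (lift y) t" for a
        by (rule compose_cong) (rule Y[OF t])
      consider "\<tau> = []" | a \<sigma> where "\<tau> = [Node a \<sigma>]" | u v \<omega> where "\<tau> = u # v # \<omega>"
        by (metis neq_Nil_conv ptree.exhaust)
      then have "lift y t \<tau> = unit_multiple (y 0) \<tau> + integral_path XX (\<lambda>a. compose_controlled (F a) Y) t \<tau>"
      proof cases
        case 1
        then show ?thesis using yJ[OF t] by (simp add: unit_multiple_def integral_path_def int[OF t])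
      next
        case (2 a \<sigma>)
        show ?thesis
        proof (cases "\<tau> \<in> forests_le 2")
          case True
          then have "\<sigma> = [] \<or> (\<exists>b. \<sigma> = [bullet b])" unfolding 2 forests_le_2_eq by auto
          then show ?thesis
            using True by (auto simp: 2 unit_multiple_def integral_path_def cl compose_lift)
        next
          case False
          then have "lift y t \<tau> = 0" using lift_graded[of y t] unfolding graded_le_def by blast
          then show ?thesis using False by (simp add: 2 unit_multiple_def integral_path_def)
        qed
      next
        case (3 u v \<omega>)
        then show ?thesis by (cases u) (simp add: unit_multiple_def integral_path_def)
      qed
      then show "Y t \<tau> = unit_multiple (Y 0 []) \<tau> + integral_path XX (\<lambda>a. compose_controlled (F a) Y) t \<tau>"
        by (simp add: Y[OF t] Y[OF zero])
    qed
  qed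
qed

lemma lift_cong:
  assumes "y t = z t"
  shows "lift y t = lift z t"
proof -
  have const: "lift y t = lift (\<lambda>_. y t) t" for y
    unfolding lift_def by (rule refl)
  show ?thesis using const[of y] const[of z, symmetric] assms by (simp only:)
qed

text \<open>Smallness of \<open>\<delta>\<close> is imposed by existence. A competing controlled
  solution is a Davie solution with some radius and constant of its own, and the comparison is made
  with the larger of the two.\<close>

lemma unique_solution:
  obtains \<delta>\<^sub>0 where "\<delta>\<^sub>0 > 0" "\<And>\<delta>. 0 < \<delta> \<Longrightarrow> \<delta> < \<delta>\<^sub>0 \<Longrightarrow>
    \<exists>!Y. Y \<in> controlled XX \<alpha> \<delta> \<and> Y 0 [] = \<xi> \<and> solves_RDE XX F \<delta> Y"
proof (rule davie_solution_exists[OF T0 \<alpha>4, of \<xi>])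
  fix \<delta>\<^sub>0
  assume \<delta>0: "\<delta>\<^sub>0 > 0" "\<delta>\<^sub>0 \<le> T"
    and ex: "\<And>\<delta>. 0 < \<delta> \<Longrightarrow> \<delta> < \<delta>\<^sub>0 \<Longrightarrow> \<exists>y R D. y 0 = \<xi> \<and> davie_solution 4 R D \<delta> y"
  show thesis
  proof (rule that[OF \<delta>0(1)])
    fix \<delta> assume \<delta>: "0 < \<delta>" "\<delta> < \<delta>\<^sub>0"
    then have \<delta>T: "\<delta> \<le> T" using \<delta>0 by simp
    obtain y R D where y: "y 0 = \<xi>" "davie_solution 4 R D \<delta> y" using ex[OF \<delta>] by blast
    note sol = davie_is_solution[OF \<delta>(1) \<delta>T y(2)]
    let ?Y = "restrict (lift y) {0..\<delta>}"
    show "\<exists>!Y. Y \<in> controlled XX \<alpha> \<delta> \<and> Y 0 [] = \<xi> \<and> solves_RDE XX F \<delta> Y"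
    proof (rule ex1I[of _ ?Y])
      show "?Y \<in> controlled XX \<alpha> \<delta> \<and> ?Y 0 [] = \<xi> \<and>
          solves_RDE XX F \<delta> ?Y"
        using sol \<delta> y(1) by simp
      fix Z assume Z: "Z \<in> controlled XX \<alpha> \<delta> \<and> Z 0 [] = \<xi> \<and> solves_RDE XX F \<delta> Z"
      show "Z = ?Y"
      proof (rule solution_is_davie[of \<delta> Z])
        fix R' D' assume z: "davie_solution 4 R' D' \<delta> (\<lambda>t. Z t [])"
        have eq: "Z t [] = y t" if "t \<in> {0..\<delta>}" for t
        proof (rule davie_solution_unique[OF \<alpha>4 \<delta>T])
          show "davie_solution 4 (max R R') (max D D') \<delta> (\<lambda>t. Z t [])" "davie_solution 4 (max R R') (max D D') \<delta> y"
            by (rule davie_solution_mono[OF z] davie_solution_mono[OF y(2)]; simp add: \<delta>T)+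
          show "Z 0 [] = y 0" using Z y(1) by simp
        qed (rule that)
        show "Z = ?Y"
        proof
          fix t
          show "Z t = ?Y t"
          proof (cases "t \<in> {0..\<delta>}")
            case True
            then have "Z t = lift (\<lambda>t. Z t []) t" using Z solution_is_lift by blast
            also have "\<dots> = lift y t" using eq[OF True] by (rule lift_cong)
            finally show ?thesis using True by simp
          next
            case False
            have "Z \<in> {0..\<delta>} \<rightarrow>\<^sub>E graded_le 2" using Z unfolding controlled_def by blast
            from PiE_arb[OF this False] show ?thesis by (simp only: restrict_def False if_False)
          qed
        qed
      qed (use \<delta> \<delta>T Z in simp_all)
    qed
  qed
qed

end

section \<open>From the rough path to the theorem\<close>

lemma PBRP_planar_rde:
  fixes XX :: "real \<Rightarrow> real \<Rightarrow> 'd::finite pforest \<Rightarrow> real" and F :: "'d \<Rightarrow> real ^ 'n \<Rightarrow> real ^ 'n"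
  assumes XX: "XX \<in> PBRP \<alpha> T" and T: "T > 0" and \<alpha>: "1 / 4 < \<alpha>" and F: "\<And>i. smooth (F i)"
  obtains K where "planar_rde (min T 1) \<alpha> K XX F"
proof -
  note chen = PBRP_chen[OF XX]
  \<comment> \<open>Chen's relation with three equal times doubles the value; for larger trees the
    product terms vanish by the preceding cases.\<close>
  have d1: "XX s s [bullet a] = 0" if "s \<in> {0..T}" for s a
    using chen(1)[OF that that that, of a] by simp
  have d: "XX s s [Node a [bullet b]] = 0" "XX s s [Node a [bullet b, bullet c]] = 0"
    "XX s s [Node a [Node b [bullet c]]] = 0" if "s \<in> {0..T}" for s a b c
    using chen(2)[OF that that that, of a b] chen(3,4)[OF that that that, of a b c] d1[OF that] by simp_all
  obtain K where "K \<ge> 0" and K: "\<forall>\<tau>\<in>forests_le 3. (\<forall>s\<in>{0..T}. XX s s \<tau> = 0) \<longrightarrow>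
    (\<forall>s\<in>{0..T}. \<forall>t\<in>{0..T}. \<bar>XX s t \<tau>\<bar> \<le> K * (\<bar>t - s\<bar> powr \<alpha>) ^ forest_size \<tau>)"
    using PBRP_bounds[OF XX] by blast
  have bound: "\<bar>XX s t \<tau>\<bar> \<le> K * ((t - s) powr \<alpha>) ^ forest_size \<tau>"
    if "\<tau> \<in> forests_le 3" "\<And>s. s \<in> {0..T} \<Longrightarrow> XX s s \<tau> = 0" "0 \<le> s" "s \<le> t" "t \<le> min T 1" for \<tau> s t
    using K[rule_format, OF that(1,2), of s t] that(3-5) by simp
  have reverse: "XX t s [bullet a] = - XX s t [bullet a]"
    "XX t s [Node a [bullet b]] = XX s t [bullet b] * XX s t [bullet a] - XX s t [Node a [bullet b]]"
    if "0 \<le> s" "s \<le> t" "t \<le> min T 1" for s t a b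
  proof -
    have st: "s \<in> {0..T}" "t \<in> {0..T}" using that by auto
    show r: "XX t s [bullet a] = - XX s t [bullet a]" for a
      \<comment> \<open>Chen's relation from \<open>s\<close> to \<open>t\<close> and back, with
        vanishing diagonal, determines the reversed values.\<close>
      using chen(1)[OF st(1) st(2) st(1), of a] d1[OF st(1), of a] by simp
    show "XX t s [Node a [bullet b]] = XX s t [bullet b] * XX s t [bullet a] - XX s t [Node a [bullet b]]"
      using chen(2)[OF st(1) st(2) st(1), of a b] d(1)[OF st(1), of a b] r[of a] by simp
  qed
  have "planar_rde (min T 1) \<alpha> K XX F"
  proof (unfold_locales, goal_cases)
    case (4 s t a) then show ?case using bound[OF _ d1, of a s t] by (simp add: forests_le_def)
  next
    case (5 s t a b) then show ?case using bound[OF _ d(1), of a b s t] by (simp add: forests_le_def numeral_eq_Suc)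
  next
    case (6 s t a b c) then show ?case using bound[OF _ d(2), of a b c s t] by (simp add: forests_le_def numeral_eq_Suc)
  next
    case (7 s t a b c) then show ?case using bound[OF _ d(3), of a b c s t] by (simp add: forests_le_def numeral_eq_Suc)
  next
    case 8 then show ?case by (intro chen(1)) auto
  next
    case 9 then show ?case by (intro chen(2)) auto
  next
    case 10 then show ?case by (intro chen(3)) auto
  next
    case 11 then show ?case by (intro chen(4)) auto
  next
    case 12 then show ?case by (intro PBRP_shuffle[OF XX]) auto
  qed (use \<open>K \<ge> 0\<close> T \<alpha> F reverse in auto)
  then show thesis by (rule that)
qed

theorem theorem3p8:
  fixes T \<alpha> :: real
    and X :: "real \<Rightarrow> real ^ 'd"
    and F :: "'d \<Rightarrow> real ^ 'n \<Rightarrow> real ^ 'n"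
    and XX :: "real \<Rightarrow> real \<Rightarrow> 'd pforest \<Rightarrow> real"
    and \<xi> :: "real ^ 'n"
  assumes "T > 0"
    and "1 / 4 < \<alpha>" and "\<alpha> \<le> 1 / 3"
    and "\<And>i. smooth (F i)"
    and "XX \<in> PBRP \<alpha> T"
    and "lies_above T XX X"
  shows "\<exists>\<delta>\<^sub>0>0. \<forall>\<delta>. 0 < \<delta> \<and> \<delta> < T \<and> \<delta> < \<delta>\<^sub>0 \<longrightarrow>
           (\<exists>!Y. Y \<in> controlled XX \<alpha> \<delta> \<and> Y 0 [] = \<xi> \<and> solves_RDE XX F \<delta> Y) \<and>
           (\<exists>!y. RDE_solution XX \<alpha> F \<xi> \<delta> y)"
proof -
  obtain K where "planar_rde (min T 1) \<alpha> K XX F"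
    using PBRP_planar_rde[OF assms(5,1,2,4)] .
  then interpret planar_rde "min T 1" \<alpha> K XX F .
  show ?thesis
  proof (rule unique_solution[of \<xi>])
    fix \<delta>\<^sub>0
    assume \<delta>0: "\<delta>\<^sub>0 > 0" and ex1: "\<And>\<delta>. 0 < \<delta> \<Longrightarrow> \<delta> < \<delta>\<^sub>0 \<Longrightarrow>
      \<exists>!Y. Y \<in> controlled XX \<alpha> \<delta> \<and> Y 0 [] = \<xi> \<and> solves_RDE XX F \<delta> Y"
    have "\<exists>!y. RDE_solution XX \<alpha> F \<xi> \<delta> y" if \<delta>: "0 < \<delta>" "\<delta> < \<delta>\<^sub>0" for \<delta>
    proof -
      obtain Y where Y: "Y \<in> controlled XX \<alpha> \<delta>" "Y 0 [] = \<xi>" "solves_RDE XX F \<delta> Y"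
        and uniq: "\<And>Z. Z \<in> controlled XX \<alpha> \<delta> \<Longrightarrow> Z 0 [] = \<xi> \<Longrightarrow> solves_RDE XX F \<delta> Z \<Longrightarrow> Z = Y"
        using ex1[OF \<delta>] by (elim ex1E) blast
      have zero: "0 \<in> {0..\<delta>}" using \<delta> by simp
      show ?thesis
      \<comment> \<open>Every solution path carries a controlled solution above it, which must be
        \<open>Y\<close>; the restriction fixes the default values outside the interval.\<close>
      proof (rule ex1I[of _ "restrict (\<lambda>t. Y t []) {0..\<delta>}"])
        show "RDE_solution XX \<alpha> F \<xi> \<delta> (restrict (\<lambda>t. Y t []) {0..\<delta>})"
          unfolding RDE_solution_def using Y zero by (auto intro!: bexI[of _ Y])
        fix z assume z: "RDE_solution XX \<alpha> F \<xi> \<delta> z"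
        then obtain Z where Z: "Z \<in> controlled XX \<alpha> \<delta>" "\<forall>t\<in>{0..\<delta>}. Z t [] = z t" "solves_RDE XX F \<delta> Z"
          unfolding RDE_solution_def by blast
        have "z 0 = \<xi>" "z \<in> extensional {0..\<delta>}" using z unfolding RDE_solution_def by blast+
        moreover have "Z = Y" using Z zero \<open>z 0 = \<xi>\<close> by (intro uniq) auto
        ultimately show "z = restrict (\<lambda>t. Y t []) {0..\<delta>}"
          using Z(2) by (intro extensionalityI[of _ "{0..\<delta>}"]) auto
      qed
    qed
    with ex1 show ?thesis
      by (intro exI[of _ \<delta>\<^sub>0] conjI[OF \<delta>0] allI impI) (elim conjE, intro conjI)
  qed
qed

end
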